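(* Suppose (A1) the problem assumptions, (A2) the block/delay assumptions, (A4) the error assumptions, and (A5) the backtracking stepsize assumptions, all given in the context, hold for the Algorithm with backtracking described in the context. Then either the Algorithm terminates (executes its "return" instruction) in a finite number of iterations at a point $(z^{k+1},w_1^{k+1},\dots,w_{n-1}^{k+1})\in\mathcal{S}$, or there exists $(\bar z,\overline{\mathbf{w}})=(\bar z,\overline w_1,\dots,\overline w_{n-1})\in\mathcal{S}$ such that $(z^k,\mathbf{w}^k)\rightharpoonup(\bar z,\overline{\mathbf{w}})$, $x_i^k\rightharpoonup G_i\bar z$ and $y_i^k\rightharpoonup\overline w_i$ for all $i=1,\dots,n-1$, $x_n^k\rightharpoonup\bar z$, and $y_n^k\rightharpoonup-\sum_{i=1}^{n-1}G_i^*\overline w_i$ (here $\rightharpoonup$ denotes weak convergence).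
   Context: **(A1) Problem.** $n\ge 1$; $\mathcal{H}_0=\mathcal{H}_n$ and $\mathcal{H}_1,\dots,\mathcal{H}_{n-1}$ are real Hilbert spaces; $\boldsymbol{\mathcal{H}}=\mathcal{H}_0\times\mathcal{H}_1\times\cdots\times\mathcal{H}_{n-1}$. For $i=1,\dots,n$ the (set-valued) operator $T_i:\mathcal{H}_i\to 2^{\mathcal{H}_i}$ is monotone. $\{1,\dots,n\}$ is the disjoint union of $\mathcal{I}_{\mathrm F}$ and $\mathcal{I}_{\mathrm B}$: for $i\in\mathcal{I}_{\mathrm F}$, $T_i$ is single-valued with domain $\mathcal{H}_i$ and $L_i$-Lipschitz continuous, $L_i\ge 0$; for $i\in\mathcal{I}_{\mathrm B}$, $T_i$ is maximal monotone and $\mathrm{prox}_{\rho T_i}$ can be computed to within the error tolerance in (A4). $G_i:\mathcal{H}_0\to\mathcal{H}_i$, $i=1,\dots,n-1$, are bounded linear, and $G_n=I$ (identity). The Kuhn–Tucker set $$\mathcal{S}=\Big\{(z,w_1,\dots,w_{n-1})\in\boldsymbol{\mathcal{H}}: w_i\in T_i(G_iz),\ i=1,\dots,n-1,\ -\sum_{i=1}^{n-1}G_i^*w_i\in T_n(z)\Big\}$$ is nonempty. (Empty sums are $0$.) For maximal monotone $A$ and $\rho>0$, $\mathrm{prox}_{\rho A}=(I+\rho A)^{-1}$, which is single-valued and everywhere defined. **Algorithm with backtracking.** Inputs: $(z^1,\mathbf{w}^1)\in\boldsymbol{\mathcal{H}}$, where $\mathbf{w}^k=(w_1^k,\dots,w_{n-1}^k)$,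 and $(x_i^0,y_i^0)\in\mathcal{H}_i^2$ for $i=1,\dots,n$ (arbitrary). Parameters: sets $I_k\subseteq\{1,\dots,n\}$ for $k\ge1$; indices $d(i,k)\in\{1,\dots,k\}$; scalars $\rho_i^k>0$; $\Delta>0$; constants $0<\underline\beta\le\overline\beta<2$ and $\beta_k\in[\underline\beta,\overline\beta]$; $\gamma>0$; errors $e_i^k\in\mathcal{H}_i$ for $i\in\mathcal{I}_{\mathrm B}$. Set $w_n^k=-\sum_{i=1}^{n-1}G_i^*w_i^k$ for all $k$. For $k=1,2,\dots$: 1. For $i\in I_k\cap\mathcal{I}_{\mathrm B}$: $a=G_iz^{d(i,k)}+\rho_i^{d(i,k)}w_i^{d(i,k)}+e_i^k$, $x_i^k=\mathrm{prox}_{\rho_i^{d(i,k)}T_i}(a)$, $y_i^k=(\rho_i^{d(i,k)})^{-1}(a-x_i^k)$. 2. For $i\in I_k\cap\mathcal{I}_{\mathrm F}$ (backtracking): let $\theta_i^k=G_iz^{d(i,k)}$, $\zeta_i^k=T_i\theta_i^k$, $\rho_i^{(1,k)}=\rho_i^{d(i,k)}$. For $j=1,2,\dots$: set $\tilde x_i^{(j,k)}=\theta_i^k-\rho_i^{(j,k)}(\zeta_i^k-w_i^{d(i,k)})$ and $\tilde y_i^{(j,k)}=T_i\tilde x_i^{(j,k)}$; if $\Delta\|\theta_i^k-\tilde x_i^{(j,k)}\|^2-\langle\theta_i^k-\tilde x_i^{(j,k)},\tilde y_i^{(j,k)}-w_i^{d(i,k)}\rangle\le0$, stop this inner loop with $\hat\rho_i^{d(i,k)}=\rho_i^{(j,k)}$,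 $x_i^k=\tilde x_i^{(j,k)}$, $y_i^k=\tilde y_i^{(j,k)}$; otherwise set $\rho_i^{(j+1,k)}=\rho_i^{(j,k)}/2$ and continue. 3. For $i\notin I_k$: $(x_i^k,y_i^k)=(x_i^{k-1},y_i^{k-1})$. 4. $u_i^k=x_i^k-G_ix_n^k$ ($i=1,\dots,n-1$), $v^k=\sum_{i=1}^{n-1}G_i^*y_i^k+y_n^k$, $\pi_k=\sum_{i=1}^{n-1}\|u_i^k\|^2+\gamma^{-1}\|v^k\|^2$. 5. If $\pi_k>0$: $\varphi_k(p^k)=\langle z^k,v^k\rangle+\sum_{i=1}^{n-1}\langle w_i^k,u_i^k\rangle-\sum_{i=1}^n\langle x_i^k,y_i^k\rangle$ and $\alpha_k=\frac{\beta_k}{\pi_k}\max\{0,\varphi_k(p^k)\}$. If $\pi_k=0$: if $\bigcup_{j=1}^kI_j=\{1,\dots,n\}$, return (terminate) with $z^{k+1}=x_n^k$, $w_i^{k+1}=y_i^k$ for $i=1,\dots,n-1$; else $\alpha_k=0$. 6. $z^{k+1}=z^k-\gamma^{-1}\alpha_kv^k$, $w_i^{k+1}=w_i^k-\alpha_ku_i^k$ ($i=1,\dots,n-1$), $w_n^{k+1}=-\sum_{i=1}^{n-1}G_i^*w_i^{k+1}$. For $i\in\mathcal{I}_{\mathrm F}$, $\rho_i^{d(i,k)}$ is the initial trial stepsize at iteration $k$ and $\hat\rho_i^{d(i,k)}$, assigned in step 2 at outer iteration $k$ when $i\in I_k$, is the stepsize actually used. When $i\notin I_k$, put $\hat\rho_i^{d(i,k)}=\rho_i^{d(i,k)}$.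 **(A2)** (1) For some integer $M\ge1$, $\bigcup_{k=j}^{j+M-1}I_k=\{1,\dots,n\}$ for all $j\ge1$. (2) For some integer $D\ge0$, $k-d(i,k)\le D$ for all $i,k$ with $i\in I_k$. **(A4)** Let $s(i,k)$ be the largest $j\le k$ with $i\in I_j$ ($s(i,k)=0$ if there is none), and $l(i,k)=d(i,s(i,k))$, with $d(i,0)=0$. The sequences $\{e_i^k\}_k$, $i\in\mathcal{I}_{\mathrm B}$, are bounded, and for some $\sigma\in[0,1)$, for all $i\in\mathcal{I}_{\mathrm B}$ and all $k\ge1$ with $s(i,k)\ge1$: $\langle G_iz^{l(i,k)}-x_i^k,e_i^{s(i,k)}\rangle\ge-\sigma\|G_iz^{l(i,k)}-x_i^k\|^2$ and $\langle e_i^{s(i,k)},y_i^k-w_i^{l(i,k)}\rangle\le\rho_i^{l(i,k)}\sigma\|y_i^k-w_i^{l(i,k)}\|^2$. **(A5)** The forward steps are carried out by the backtracking procedure of step 2; $\overline\rho=\max_{i=1,\dots,n}\{\sup_k\rho_i^k\}<\infty$; and either (i) $\underline\rho=\min_{i=1,\dots,n}\{\inf_k\rho_i^k\}>0$, or (ii) (a rule for initializing the linesearch) for the forward-step operators $i\in\mathcal{I}_{\mathrm F}$: $\rho_i^{d(i,1)}>0$ and $\rho_i^{d(i,k)}\ge\hat\rho_i^{d(i,k-1)}$ for all $k\ge2$.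
   Formalization: In alternative (ii) of (A5), the stepsizes of the backward-step operators are additionally required to satisfy inf_k ρ_i^k > 0; without this the claim fails (n=1, T_1=Id on the reals, ρ_1^k=2^{-k}). *)

theory Defs
  imports "HOL-Analysis.Analysis"
begin

section \<open>Hilbert spaces as complete subspaces\<close>

text \<open>
  The number of Hilbert spaces is a variable, so they cannot be separate types. They are complete
  linear subspaces of one real inner product space, with the restricted inner product. Every finite
  family of real Hilbert spaces occurs in this way inside its direct sum. The subspaces are
  unrelated to each other: neither orthogonality nor trivial intersection is assumed.
\<close>

definition hilbert_subspace :: "'a::real_inner set \<Rightarrow> bool" where
  "hilbert_subspace H \<longleftrightarrow> subspace H \<and> complete H"

definition bounded_linear_on ::
  "'a::real_inner set \<Rightarrow> 'a set \<Rightarrow> ('a \<Rightarrow> 'a) \<Rightarrow> bool" where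
  "bounded_linear_on X Y f \<longleftrightarrow>
     (\<forall>x\<in>X. f x \<in> Y) \<and>
     (\<forall>x\<in>X. \<forall>x'\<in>X. f (x + x') = f x + f x') \<and>
     (\<forall>c. \<forall>x\<in>X. f (c *\<^sub>R x) = c *\<^sub>R f x) \<and>
     (\<exists>K. \<forall>x\<in>X. norm (f x) \<le> norm x * K)"

text \<open>
  The library constant \<^const>\<open>adjoint\<close> concerns maps on whole types. The following is the
  Hilbert space adjoint of an operator with domain \<open>X\<close>; for bounded linear \<open>f\<close> on a complete
  \<open>X\<close> the described vector exists by the Riesz representation theorem.
\<close>

definition adjoint_on :: "'a::real_inner set \<Rightarrow> ('a \<Rightarrow> 'a) \<Rightarrow> 'a \<Rightarrow> 'a" where
  "adjoint_on X f y = (THE x. x \<in> X \<and> (\<forall>u\<in>X. u \<bullet> x = f u \<bullet> y))"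

definition weakly_converges ::
  "'a::real_inner set \<Rightarrow> (nat \<Rightarrow> 'a) \<Rightarrow> 'a \<Rightarrow> bool" where
  "weakly_converges H f l \<longleftrightarrow> (\<forall>u\<in>H. (\<lambda>k. f k \<bullet> u) \<longlonglongrightarrow> l \<bullet> u)"

section \<open>Monotone operators\<close>

text \<open>A set-valued operator on \<open>H\<close> is a function whose values outside \<open>H\<close> play no role.\<close>

definition monotone_op :: "'a::real_inner set \<Rightarrow> ('a \<Rightarrow> 'a set) \<Rightarrow> bool" where
  "monotone_op H A \<longleftrightarrow>
     (\<forall>x\<in>H. A x \<subseteq> H) \<and>
     (\<forall>x\<in>H. \<forall>x'\<in>H. \<forall>y\<in>A x. \<forall>y'\<in>A x'. (x - x') \<bullet> (y - y') \<ge> 0)"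

definition maximal_monotone_op :: "'a::real_inner set \<Rightarrow> ('a \<Rightarrow> 'a set) \<Rightarrow> bool" where
  "maximal_monotone_op H A \<longleftrightarrow>
     monotone_op H A \<and>
     (\<forall>B. monotone_op H B \<and> (\<forall>x\<in>H. A x \<subseteq> B x) \<longrightarrow> (\<forall>x\<in>H. B x = A x))"

definition prox :: "'a::real_inner set \<Rightarrow> real \<Rightarrow> ('a \<Rightarrow> 'a set) \<Rightarrow> 'a \<Rightarrow> 'a" where
  "prox H \<rho> A a = (THE x. x \<in> H \<and> (\<exists>y\<in>A x. a = x + \<rho> *\<^sub>R y))"

section \<open>The problem\<close>

record 'a ps_problem =
  num :: nat                            \<comment> \<open>\<open>n\<close>\<close>
  sp :: "nat \<Rightarrow> 'a set"                 \<comment> \<open>\<open>H\<^sub>i\<close>\<close>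
  op :: "nat \<Rightarrow> 'a \<Rightarrow> 'a set"           \<comment> \<open>\<open>T\<^sub>i\<close>\<close>
  lin :: "nat \<Rightarrow> 'a \<Rightarrow> 'a"              \<comment> \<open>\<open>G\<^sub>i\<close>\<close>
  fwd :: "nat set"                      \<comment> \<open>indices treated by forward steps\<close>
  bwd :: "nat set"                      \<comment> \<open>indices treated by backward steps\<close>
  lip :: "nat \<Rightarrow> real"                  \<comment> \<open>\<open>L\<^sub>i\<close>, for forward indices\<close>

abbreviation op1 :: "'a::real_inner ps_problem \<Rightarrow> nat \<Rightarrow> 'a \<Rightarrow> 'a" where
  "op1 P i x \<equiv> the_elem (op P i x)"

abbreviation lin_adj :: "'a::real_inner ps_problem \<Rightarrow> nat \<Rightarrow> 'a \<Rightarrow> 'a" where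
  "lin_adj P i \<equiv> adjoint_on (sp P 0) (lin P i)"

text \<open>
  A point of the product space is a pair \<open>(z, w)\<close>, where only the values \<open>w i\<close> with
  \<open>1 \<le> i < n\<close> matter.
\<close>

definition kuhn_tucker_set :: "'a::real_inner ps_problem \<Rightarrow> ('a \<times> (nat \<Rightarrow> 'a)) set" where
  "kuhn_tucker_set P = {(z, w).
     z \<in> sp P 0 \<and>
     (\<forall>i\<in>{1..<num P}. w i \<in> sp P i \<and> w i \<in> op P i (lin P i z)) \<and>
     - (\<Sum>i\<in>{1..<num P}. lin_adj P i (w i)) \<in> op P (num P) z}"

definition problem_assumptions :: "'a::real_inner ps_problem \<Rightarrow> bool" where
  "problem_assumptions P \<longleftrightarrow>
     num P \<ge> 1 \<and>
     (\<forall>i\<in>{0..<num P}. hilbert_subspace (sp P i)) \<and> sp P (num P) = sp P 0 \<and>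
     (\<forall>i\<in>{1..num P}. monotone_op (sp P i) (op P i)) \<and>
     fwd P \<union> bwd P = {1..num P} \<and> fwd P \<inter> bwd P = {} \<and>
     (\<forall>i\<in>fwd P. (\<forall>x\<in>sp P i. is_singleton (op P i x)) \<and>
                (lip P i)-lipschitz_on (sp P i) (op1 P i)) \<and>
     (\<forall>i\<in>bwd P. maximal_monotone_op (sp P i) (op P i)) \<and>
     (\<forall>i\<in>{1..<num P}. bounded_linear_on (sp P 0) (sp P i) (lin P i)) \<and>
     (\<forall>z\<in>sp P 0. lin P (num P) z = z) \<and>
     kuhn_tucker_set P \<noteq> {}"

text \<open>Weak convergence in the product Hilbert space, tested against its inner product.\<close>

definition weakly_converges_prod ::
  "'a::real_inner ps_problem \<Rightarrow> (nat \<Rightarrow> 'a \<times> (nat \<Rightarrow> 'a)) \<Rightarrow> 'a \<times> (nat \<Rightarrow> 'a) \<Rightarrow> bool" where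
  "weakly_converges_prod P p q \<longleftrightarrow>
     (\<forall>u\<in>sp P 0. \<forall>v. (\<forall>i\<in>{1..<num P}. v i \<in> sp P i) \<longrightarrow>
        (\<lambda>k. fst (p k) \<bullet> u + (\<Sum>i\<in>{1..<num P}. snd (p k) i \<bullet> v i))
          \<longlonglongrightarrow> fst q \<bullet> u + (\<Sum>i\<in>{1..<num P}. snd q i \<bullet> v i))"

section \<open>Runs of the algorithm\<close>

text \<open>
  A run consists of the parameters and the iterates. Doubly indexed quantities take the operator
  index first and the iteration second. Iterates are total functions of the iteration number, but
  they are constrained only as far as the algorithm actually computes them.
\<close>

record 'a ps_run =
  blk :: "nat \<Rightarrow> nat set"               \<comment> \<open>\<open>I\<^sub>k\<close>\<close>
  del :: "nat \<Rightarrow> nat \<Rightarrow> nat"            \<comment> \<open>\<open>d(i,k)\<close>\<close>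
  rho :: "nat \<Rightarrow> nat \<Rightarrow> real"           \<comment> \<open>stepsizes; initial trial stepsizes for forward indices\<close>
  Delta :: real
  beta_lo :: real
  beta_hi :: real
  beta :: "nat \<Rightarrow> real"
  gamma :: real
  err :: "nat \<Rightarrow> nat \<Rightarrow> 'a"             \<comment> \<open>\<open>e\<^sub>i\<^sup>k\<close>\<close>
  zit :: "nat \<Rightarrow> 'a"
  wit :: "nat \<Rightarrow> nat \<Rightarrow> 'a"
  xit :: "nat \<Rightarrow> nat \<Rightarrow> 'a"
  yit :: "nat \<Rightarrow> nat \<Rightarrow> 'a"

definition parameters_ok :: "'a::real_inner ps_problem \<Rightarrow> 'a ps_run \<Rightarrow> bool" where
  "parameters_ok P R \<longleftrightarrow>
     (\<forall>k\<ge>1. blk R k \<subseteq> {1..num P}) \<and>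
     (\<forall>i\<in>{1..num P}. \<forall>k\<ge>1. del R i k \<in> {1..k}) \<and>
     (\<forall>i\<in>{1..num P}. \<forall>k\<ge>1. rho R i k > 0) \<and>
     Delta R > 0 \<and> gamma R > 0 \<and>
     0 < beta_lo R \<and> beta_lo R \<le> beta_hi R \<and> beta_hi R < 2 \<and>
     (\<forall>k\<ge>1. beta R k \<in> {beta_lo R..beta_hi R}) \<and>
     (\<forall>i\<in>bwd P. \<forall>k\<ge>1. err R i k \<in> sp P i)"

definition initial_ok :: "'a::real_inner ps_problem \<Rightarrow> 'a ps_run \<Rightarrow> bool" where
  "initial_ok P R \<longleftrightarrow>
     zit R 1 \<in> sp P 0 \<and>
     (\<forall>i\<in>{1..<num P}. wit R i 1 \<in> sp P i) \<and>
     wit R (num P) 1 = - (\<Sum>i\<in>{1..<num P}. lin_adj P i (wit R i 1)) \<and>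
     (\<forall>i\<in>{1..num P}. xit R i 0 \<in> sp P i \<and> yit R i 0 \<in> sp P i)"

subsection \<open>Backtracking\<close>

definition bt_theta :: "'a::real_inner ps_problem \<Rightarrow> 'a ps_run \<Rightarrow> nat \<Rightarrow> nat \<Rightarrow> 'a" where
  "bt_theta P R i k = lin P i (zit R (del R i k))"

definition bt_zeta :: "'a::real_inner ps_problem \<Rightarrow> 'a ps_run \<Rightarrow> nat \<Rightarrow> nat \<Rightarrow> 'a" where
  "bt_zeta P R i k = op1 P i (bt_theta P R i k)"

text \<open>The trial stepsize is halved in each of the trials \<open>j = 1, 2, \<dots>\<close>.\<close>

definition bt_rho :: "'a::real_inner ps_run \<Rightarrow> nat \<Rightarrow> nat \<Rightarrow> nat \<Rightarrow> real" where
  "bt_rho R i k j = rho R i (del R i k) / 2 ^ (j - 1)"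

definition bt_x :: "'a::real_inner ps_problem \<Rightarrow> 'a ps_run \<Rightarrow> nat \<Rightarrow> nat \<Rightarrow> nat \<Rightarrow> 'a" where
  "bt_x P R i k j =
     bt_theta P R i k - bt_rho R i k j *\<^sub>R (bt_zeta P R i k - wit R i (del R i k))"

definition bt_y :: "'a::real_inner ps_problem \<Rightarrow> 'a ps_run \<Rightarrow> nat \<Rightarrow> nat \<Rightarrow> nat \<Rightarrow> 'a" where
  "bt_y P R i k j = op1 P i (bt_x P R i k j)"

definition bt_accept :: "'a::real_inner ps_problem \<Rightarrow> 'a ps_run \<Rightarrow> nat \<Rightarrow> nat \<Rightarrow> nat \<Rightarrow> bool" where
  "bt_accept P R i k j \<longleftrightarrow>
     Delta R * (norm (bt_theta P R i k - bt_x P R i k j))\<^sup>2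
       - (bt_theta P R i k - bt_x P R i k j) \<bullet> (bt_y P R i k j - wit R i (del R i k)) \<le> 0"

definition bt_stops :: "'a::real_inner ps_problem \<Rightarrow> 'a ps_run \<Rightarrow> nat \<Rightarrow> nat \<Rightarrow> bool" where
  "bt_stops P R i k \<longleftrightarrow> (\<exists>j\<ge>1. bt_accept P R i k j)"

definition bt_index :: "'a::real_inner ps_problem \<Rightarrow> 'a ps_run \<Rightarrow> nat \<Rightarrow> nat \<Rightarrow> nat" where
  "bt_index P R i k = (LEAST j. j \<ge> 1 \<and> bt_accept P R i k j)"

text \<open>
  \<open>rho_hat P R i k\<close> is the stepsize usually written as rho-hat with superscript \<open>d(i,k)\<close>. It is
  indexed by the iteration \<open>k\<close> that determines it, since \<open>d(i,k)\<close> may be the same for several \<open>k\<close>.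
\<close>

definition rho_hat :: "'a::real_inner ps_problem \<Rightarrow> 'a ps_run \<Rightarrow> nat \<Rightarrow> nat \<Rightarrow> real" where
  "rho_hat P R i k =
     (if i \<in> blk R k then bt_rho R i k (bt_index P R i k) else rho R i (del R i k))"

subsection \<open>Separating hyperplane and projection\<close>

definition u_vec :: "'a::real_inner ps_problem \<Rightarrow> 'a ps_run \<Rightarrow> nat \<Rightarrow> nat \<Rightarrow> 'a" where
  "u_vec P R i k = xit R i k - lin P i (xit R (num P) k)"

definition v_vec :: "'a::real_inner ps_problem \<Rightarrow> 'a ps_run \<Rightarrow> nat \<Rightarrow> 'a" where
  "v_vec P R k = (\<Sum>i\<in>{1..<num P}. lin_adj P i (yit R i k)) + yit R (num P) k"

definition pi_val :: "'a::real_inner ps_problem \<Rightarrow> 'a ps_run \<Rightarrow> nat \<Rightarrow> real" where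
  "pi_val P R k =
     (\<Sum>i\<in>{1..<num P}. (norm (u_vec P R i k))\<^sup>2) + inverse (gamma R) * (norm (v_vec P R k))\<^sup>2"

definition phi_val :: "'a::real_inner ps_problem \<Rightarrow> 'a ps_run \<Rightarrow> nat \<Rightarrow> real" where
  "phi_val P R k =
     zit R k \<bullet> v_vec P R k + (\<Sum>i\<in>{1..<num P}. wit R i k \<bullet> u_vec P R i k)
       - (\<Sum>i\<in>{1..num P}. xit R i k \<bullet> yit R i k)"

definition alpha_val :: "'a::real_inner ps_problem \<Rightarrow> 'a ps_run \<Rightarrow> nat \<Rightarrow> real" where
  "alpha_val P R k =
     (if pi_val P R k > 0 then beta R k / pi_val P R k * max 0 (phi_val P R k) else 0)"

subsection \<open>Control flow\<close>

definition searches_stop :: "'a::real_inner ps_problem \<Rightarrow> 'a ps_run \<Rightarrow> nat \<Rightarrow> bool" where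
  "searches_stop P R k \<longleftrightarrow> (\<forall>i\<in>blk R k \<inter> fwd P. bt_stops P R i k)"

definition return_test :: "'a::real_inner ps_problem \<Rightarrow> 'a ps_run \<Rightarrow> nat \<Rightarrow> bool" where
  "return_test P R k \<longleftrightarrow> pi_val P R k = 0 \<and> (\<Union>j\<in>{1..k}. blk R j) = {1..num P}"

text \<open>
  Iteration \<open>k\<close> is begun iff in every earlier iteration all line searches stopped and the algorithm
  did not return. Finiteness of the line searches is thus not built into the notion of a run;
  an infinite line search blocks all later iterations.
\<close>

definition reached :: "'a::real_inner ps_problem \<Rightarrow> 'a ps_run \<Rightarrow> nat \<Rightarrow> bool" where
  "reached P R k \<longleftrightarrow> (\<forall>k'\<in>{1..<k}. searches_stop P R k' \<and> \<not> return_test P R k')"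

definition returns_at :: "'a::real_inner ps_problem \<Rightarrow> 'a ps_run \<Rightarrow> nat \<Rightarrow> bool" where
  "returns_at P R k \<longleftrightarrow> k \<ge> 1 \<and> reached P R k \<and> searches_stop P R k \<and> return_test P R k"

definition backward_step :: "'a::real_inner ps_problem \<Rightarrow> 'a ps_run \<Rightarrow> nat \<Rightarrow> nat \<Rightarrow> bool" where
  "backward_step P R i k \<longleftrightarrow>
     (let d = del R i k;
          a = lin P i (zit R d) + rho R i d *\<^sub>R wit R i d + err R i k
      in xit R i k = prox (sp P i) (rho R i d) (op P i) a \<and>
         yit R i k = inverse (rho R i d) *\<^sub>R (a - xit R i k))"

definition forward_step :: "'a::real_inner ps_problem \<Rightarrow> 'a ps_run \<Rightarrow> nat \<Rightarrow> nat \<Rightarrow> bool" where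
  "forward_step P R i k \<longleftrightarrow>
     (bt_stops P R i k \<longrightarrow>
        xit R i k = bt_x P R i k (bt_index P R i k) \<and>
        yit R i k = bt_y P R i k (bt_index P R i k))"

definition return_step :: "'a::real_inner ps_problem \<Rightarrow> 'a ps_run \<Rightarrow> nat \<Rightarrow> bool" where
  "return_step P R k \<longleftrightarrow>
     zit R (Suc k) = xit R (num P) k \<and>
     (\<forall>i\<in>{1..<num P}. wit R i (Suc k) = yit R i k)"

definition update_step :: "'a::real_inner ps_problem \<Rightarrow> 'a ps_run \<Rightarrow> nat \<Rightarrow> bool" where
  "update_step P R k \<longleftrightarrow>
     zit R (Suc k) = zit R k - (inverse (gamma R) * alpha_val P R k) *\<^sub>R v_vec P R k \<and>
     (\<forall>i\<in>{1..<num P}. wit R i (Suc k) = wit R i k - alpha_val P R k *\<^sub>R u_vec P R i k) \<and>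
     wit R (num P) (Suc k) = - (\<Sum>i\<in>{1..<num P}. lin_adj P i (wit R i (Suc k)))"

definition iteration :: "'a::real_inner ps_problem \<Rightarrow> 'a ps_run \<Rightarrow> nat \<Rightarrow> bool" where
  "iteration P R k \<longleftrightarrow>
     (\<forall>i\<in>blk R k \<inter> bwd P. backward_step P R i k) \<and>
     (\<forall>i\<in>blk R k \<inter> fwd P. forward_step P R i k) \<and>
     (\<forall>i\<in>{1..num P} - blk R k. xit R i k = xit R i (k - 1) \<and> yit R i k = yit R i (k - 1)) \<and>
     (searches_stop P R k \<longrightarrow>
        (if return_test P R k then return_step P R k else update_step P R k))"

definition algorithm_run :: "'a::real_inner ps_problem \<Rightarrow> 'a ps_run \<Rightarrow> bool" where
  "algorithm_run P R \<longleftrightarrow>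
     parameters_ok P R \<and> initial_ok P R \<and>
     (\<forall>k\<ge>1. reached P R k \<longrightarrow> iteration P R k)"

section \<open>Assumptions on the run\<close>

definition block_delay_assumptions :: "'a::real_inner ps_problem \<Rightarrow> 'a ps_run \<Rightarrow> bool" where
  "block_delay_assumptions P R \<longleftrightarrow>
     (\<exists>M\<ge>1. \<forall>j\<ge>1. (\<Union>k\<in>{j..j + M - 1}. blk R k) = {1..num P}) \<and>
     (\<exists>D. \<forall>k\<ge>1. \<forall>i\<in>blk R k. k - del R i k \<le> D)"

definition last_processed :: "'a::real_inner ps_run \<Rightarrow> nat \<Rightarrow> nat \<Rightarrow> nat" where
  "last_processed R i k = Max (insert 0 {j \<in> {1..k}. i \<in> blk R j})"

definition last_info :: "'a::real_inner ps_run \<Rightarrow> nat \<Rightarrow> nat \<Rightarrow> nat" where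
  "last_info R i k =
     (if last_processed R i k = 0 then 0 else del R i (last_processed R i k))"

definition error_assumptions :: "'a::real_inner ps_problem \<Rightarrow> 'a ps_run \<Rightarrow> bool" where
  "error_assumptions P R \<longleftrightarrow>
     (\<forall>i\<in>bwd P. bounded (err R i ` {1..})) \<and>
     (\<exists>\<sigma>::real. 0 \<le> \<sigma> \<and> \<sigma> < 1 \<and>
        (\<forall>i\<in>bwd P. \<forall>k\<ge>1. reached P R k \<and> last_processed R i k \<ge> 1 \<longrightarrow>
           (let l = last_info R i k; e = err R i (last_processed R i k) in
              (lin P i (zit R l) - xit R i k) \<bullet> e
                \<ge> - \<sigma> * (norm (lin P i (zit R l) - xit R i k))\<^sup>2 \<and>
              e \<bullet> (yit R i k - wit R i l)
                \<le> rho R i l * \<sigma> * (norm (yit R i k - wit R i l))\<^sup>2)))"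

text \<open>
  The line search initialization rule replaces the positive lower bound on the stepsizes for the
  forward indices only. For the backward indices the lower bound is needed in either case: for
  \<open>n = 1\<close>, no forward index and \<open>T\<^sub>1\<close> the identity of the real line, the algorithm with summable
  stepsizes converges to a nonzero point.
\<close>

definition stepsize_assumptions :: "'a::real_inner ps_problem \<Rightarrow> 'a ps_run \<Rightarrow> bool" where
  "stepsize_assumptions P R \<longleftrightarrow>
     (\<forall>i\<in>{1..num P}. bdd_above (rho R i ` {1..})) \<and>
     ((\<forall>i\<in>{1..num P}. (INF k\<in>{1..}. rho R i k) > 0) \<or>
      (\<forall>i\<in>bwd P. (INF k\<in>{1..}. rho R i k) > 0) \<and>
      (\<forall>i\<in>fwd P. rho R i (del R i 1) > 0 \<and>
         (\<forall>k\<ge>2. reached P R k \<longrightarrow> rho R i (del R i k) \<ge> rho_hat P R i (k - 1))))"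

end

theory Submission
  imports Defs
begin

text \<open>
  Once every block has been processed, \<open>(x\<^sub>i, y\<^sub>i)\<close> lies in the graph of \<open>T\<^sub>i\<close>, so by monotonicity the affine
  function \<open>\<phi>\<^sub>k\<close> is nonpositive on the Kuhn-Tucker set and the iterates, being relaxed projections onto
  its zero sublevel set, are Fejer monotone. Hence \<open>max 0 (\<phi>\<^sub>k(p\<^sup>k))\<close> tends to \<open>0\<close>. Up to vanishing
  delay terms, \<open>\<phi>\<^sub>k(p\<^sup>k)\<close> is the sum over \<open>i\<close> of the inner products of the residuals
  \<open>G\<^sub>i z - x\<^sub>i\<close> and \<open>y\<^sub>i - w\<^sub>i\<close>, each of which dominates a multiple of the squared norm of either
  residual; for forward indices this rests on the acceptance test and on a lower bound of the
  accepted stepsizes, which also shows that every line search stops. So all residuals vanish, weak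
  cluster points solve the problem by maximality, and Opial's argument gives weak convergence.
  Minty's theorem is needed because \<^const>\<open>prox\<close> is a definite description.
\<close>

section \<open>Complete subspaces\<close>

text \<open>Fejer monotonicity by itself only sends \<open>gain\<close>, the squared positive part
  of the hyperplane value divided by \<open>pi_val\<close>, to zero; a bound on
  \<open>pi_val\<close> has to be supplied. It cannot come from vanishing residuals, which are
  deduced from it, so \<open>x\<close> and \<open>y\<close> are bounded beforehand by playing
  coercivity against monotonicity at one solution. Residuals are taken at the delayed point because
  the error tolerances and the acceptance test speak only of the information a step was computed
  from; since consecutive iterates approach each other and delays are bounded, everything can be
  moved to the current point afterwards. The last operator is treated like the others by giving it
  the dependent dual component, which turns the coupling into one orthogonality relation. A run
  promises nothing beyond an unfinished line search, and a search is known to finish only if its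
  data lie in the right subspaces; membership of the iterates is therefore proved for reached
  iterations first, and termination of the searches is read off from it.\<close>

lemma riesz_on:
  fixes f :: "'a::real_inner \<Rightarrow> real"
  assumes H: "hilbert_subspace H"
    and add: "\<And>u v. u \<in> H \<Longrightarrow> v \<in> H \<Longrightarrow> f (u + v) = f u + f v"
    and scale: "\<And>c u. u \<in> H \<Longrightarrow> f (c *\<^sub>R u) = c * f u"
    and bound: "\<And>u. u \<in> H \<Longrightarrow> \<bar>f u\<bar> \<le> C * norm u"
  obtains x where "x \<in> H" "\<And>u. u \<in> H \<Longrightarrow> u \<bullet> x = f u"
proof -
  have S: "subspace H" and K: "complete H"
    using H by (auto simp: hilbert_subspace_def)
  \<comment> \<open>If \<open>x\<close> represents \<open>f\<close>, then \<open>J u\<close> is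
    \<open>(norm (u - x))^2 - (norm x)^2\<close>; the representing vector is therefore sought as the
    minimiser of \<open>J\<close>.\<close>
  define J where "J u = (norm u)\<^sup>2 - 2 * f u" for u
  have Jlow: "J u \<ge> - C\<^sup>2" if "u \<in> H" for u
  proof -
    have "f u \<le> C * norm u"
      using bound[OF that] by linarith
    moreover have "0 \<le> (norm u - C)\<^sup>2"
      by simp
    ultimately show ?thesis
      by (simp add: J_def power2_diff algebra_simps)
  qed
  define m where "m = (INF u\<in>H. J u)"
  have bdd: "bdd_below (J ` H)"
    using Jlow by (auto simp: bdd_below_def)
  have mle: "m \<le> J u" if "u \<in> H" for u
    unfolding m_def using bdd that by (rule cINF_lower)
  have ne: "H \<noteq> {}"
    using S subspace_0 by blast
  have "\<exists>u\<in>H. J u < m + 1 / real (Suc k)" for k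
  proof -
    have "m < m + 1 / real (Suc k)"
      by simp
    then show ?thesis
      unfolding m_def using cINF_less_iff[OF ne bdd] by blast
  qed
  then obtain s where sH: "\<And>k. s k \<in> H" and sJ: "\<And>k. J (s k) < m + 1 / real (Suc k)"
    by metis
  \<comment> \<open>The parallelogram law, with \<open>m\<close> as a lower bound at the midpoint:
    points where \<open>J\<close> is nearly minimal are close to each other.\<close>
  have para: "(norm (u - v))\<^sup>2 \<le> 2 * J u + 2 * J v - 4 * m" if u: "u \<in> H" and v: "v \<in> H" for u v
  proof -
    have "(1/2) *\<^sub>R (u + v) \<in> H"
      using S u v by (simp add: subspace_add subspace_scale)
    then have "m \<le> J ((1/2) *\<^sub>R (u + v))"
      by (rule mle)
    also have "J ((1/2) *\<^sub>R (u + v)) = (norm (u + v))\<^sup>2 / 4 - (f u + f v)"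
    proof -
      have "f ((1/2) *\<^sub>R (u + v)) = (f u + f v) / 2"
        using S u v by (simp add: scale add subspace_add)
      then show ?thesis
        by (simp add: J_def power_divide)
    qed
    finally have "4 * m \<le> (norm (u + v))\<^sup>2 - 4 * (f u + f v)"
      by simp
    moreover have "(norm (u + v))\<^sup>2 + (norm (u - v))\<^sup>2 = 2 * (norm u)\<^sup>2 + 2 * (norm v)\<^sup>2"
      by (simp add: power2_norm_eq_inner algebra_simps inner_commute)
    ultimately show ?thesis
      by (simp add: J_def algebra_simps)
  qed
  have "Cauchy s"
  proof (rule metric_CauchyI)
    fix e :: real
    assume "e > 0"
    then obtain N where N: "inverse (real (Suc N)) < e\<^sup>2 / 4"
      using reals_Archimedean[of "e\<^sup>2 / 4"] by auto
    have "dist (s a) (s b) < e" if "a \<ge> N" "b \<ge> N" for a b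
    proof -
      have *: "1 / real (Suc k) < e\<^sup>2 / 4" if "k \<ge> N" for k
      proof -
        have "1 / real (Suc k) \<le> 1 / real (Suc N)"
          using that by (simp add: field_simps)
        then show ?thesis
          using N by (simp add: inverse_eq_divide)
      qed
      have "(norm (s a - s b))\<^sup>2 < e\<^sup>2"
        using para[OF sH sH, of a b] sJ[of a] sJ[of b] *[OF that(1)] *[OF that(2)] by linarith
      then show ?thesis
        using \<open>e > 0\<close> by (simp add: dist_norm power2_less_imp_less)
    qed
    then show "\<exists>M. \<forall>a\<ge>M. \<forall>b\<ge>M. dist (s a) (s b) < e"
      by blast
  qed
  then obtain x where xH: "x \<in> H" and lim: "s \<longlonglongrightarrow> x"
    using K sH unfolding complete_def by blast
  have fdiff: "f (u - v) = f u - f v" if "u \<in> H" "v \<in> H" for u v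
    using add[of u "(-1) *\<^sub>R v"] scale[of v "-1"] that S by (simp add: subspace_neg)
  have flim: "(\<lambda>k. f (s k)) \<longlonglongrightarrow> f x"
  proof (rule Lim_null_comparison[where g = "\<lambda>k. C * norm (s k - x)", THEN LIM_zero_cancel])
    show "\<forall>\<^sub>F k in sequentially. norm (f (s k) - f x) \<le> C * norm (s k - x)"
      using bound[of "s k - x" for k] sH xH S by (simp add: fdiff[symmetric] subspace_diff)
    have "(\<lambda>k. norm (s k - x)) \<longlonglongrightarrow> 0"
      using lim by (simp add: LIM_zero tendsto_norm_zero)
    then show "(\<lambda>k. C * norm (s k - x)) \<longlonglongrightarrow> 0"
      by (rule tendsto_mult_right_zero)
  qed
  have "J x \<le> m"
  proof (rule LIMSEQ_le)
    show "(\<lambda>k. J (s k)) \<longlonglongrightarrow> J x"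
      unfolding J_def by (intro tendsto_intros lim flim)
    show "(\<lambda>k. m + 1 / real (Suc k)) \<longlonglongrightarrow> m"
      using tendsto_add[OF tendsto_const LIMSEQ_inverse_real_of_nat, of m]
      by (simp add: inverse_eq_divide)
    show "\<exists>N. \<forall>k\<ge>N. J (s k) \<le> m + 1 / real (Suc k)"
      using sJ less_imp_le by blast
  qed
  have "u \<bullet> x = f u" if u: "u \<in> H" for u
  proof -
    \<comment> \<open>\<open>2 * b\<close> is the derivative of \<open>J\<close> at the minimiser
      \<open>x\<close> in direction \<open>u\<close>.\<close>
    define b where "b = u \<bullet> x - f u"
    have ineq: "0 \<le> t\<^sup>2 * (norm u)\<^sup>2 + 2 * t * b" for t
    proof -
      have "m \<le> J (x + t *\<^sub>R u)"
        using S u xH by (simp add: mle subspace_add subspace_scale)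
      moreover have "J (x + t *\<^sub>R u) = J x + (t\<^sup>2 * (norm u)\<^sup>2 + 2 * t * b)"
      proof -
        have "(norm (x + t *\<^sub>R u))\<^sup>2 = (norm x)\<^sup>2 + 2 * t * (u \<bullet> x) + t\<^sup>2 * (norm u)\<^sup>2"
          unfolding power2_norm_eq_inner by (simp add: algebra_simps inner_commute power2_eq_square)
        moreover have "f (x + t *\<^sub>R u) = f x + t * f u"
          using u xH S by (simp add: add scale subspace_scale)
        ultimately show ?thesis
          by (simp add: J_def b_def algebra_simps)
      qed
      ultimately show ?thesis
        using \<open>J x \<le> m\<close> by linarith
    qed
    \<comment> \<open>The added 1 keeps the trial step \<open>t = - b / N\<close> meaningful for
      \<open>u = 0\<close>.\<close>
    define N where "N = (norm u)\<^sup>2 + 1"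
    have "N > 0"
      by (simp add: N_def add_nonneg_pos)
    have "0 \<le> (- b / N)\<^sup>2 * (norm u)\<^sup>2 + 2 * (- b / N) * b"
      by (rule ineq)
    also have "\<dots> \<le> (- b / N)\<^sup>2 * N + 2 * (- b / N) * b"
      by (intro add_right_mono mult_left_mono) (auto simp: N_def)
    also have "\<dots> = - (b\<^sup>2 / N)"
      using \<open>N > 0\<close> by (simp add: field_simps power2_eq_square)
    finally have "b\<^sup>2 \<le> 0"
      using \<open>N > 0\<close> by (simp add: divide_le_0_iff)
    then show ?thesis
      by (simp add: b_def)
  qed
  with xH show ?thesis
    by (rule that)
qed

lemma eq_of_inner_eq:
  fixes x y :: "'a::real_inner"
  assumes "subspace H" "x \<in> H" "y \<in> H" "\<And>u. u \<in> H \<Longrightarrow> u \<bullet> x = u \<bullet> y"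
  shows "x = y"
proof -
  have "(x - y) \<bullet> (x - y) = 0"
    using assms by (simp add: inner_diff_right subspace_diff)
  then show ?thesis
    by simp
qed

subsection \<open>Adjoints\<close>

lemma bounded_linear_on_diff:
  assumes "bounded_linear_on X Y f" "subspace X" "u \<in> X" "v \<in> X"
  shows "f (u - v) = f u - f v"
proof -
  have "f (u + (-1) *\<^sub>R v) = f u + (-1) *\<^sub>R f v"
    using assms unfolding bounded_linear_on_def by (metis subspace_scale)
  then show ?thesis
    by simp
qed

lemma bounded_linear_on_bound:
  assumes "bounded_linear_on X Y f"
  obtains K where "K \<ge> 0" "\<And>u. u \<in> X \<Longrightarrow> norm (f u) \<le> K * norm u"
proof -
  obtain K where K: "\<And>u. u \<in> X \<Longrightarrow> norm (f u) \<le> norm u * K"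
    using assms unfolding bounded_linear_on_def by blast
  \<comment> \<open>For a trivial \<open>X\<close> the constant in \<open>bounded_linear_on\<close>
    may be negative.\<close>
  have "norm (f u) \<le> max 0 K * norm u" if "u \<in> X" for u
    using K[OF that] by (smt (verit) mult.commute mult_left_mono norm_ge_zero)
  then show ?thesis
    using that[of "max 0 K"] by auto
qed

text \<open>Riesz supplies a representing vector. Two of them both lie in \<open>X\<close> and can
  be tested against their difference, so the definite description denotes it.\<close>

lemma
  assumes f: "bounded_linear_on X Y f" and X: "hilbert_subspace X"
  shows adjoint_on_in: "adjoint_on X f y \<in> X"
    and adjoint_on_inner: "u \<in> X \<Longrightarrow> u \<bullet> adjoint_on X f y = f u \<bullet> y"
proof -
  obtain K where K: "\<And>u. u \<in> X \<Longrightarrow> norm (f u) \<le> K * norm u"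
    using bounded_linear_on_bound[OF f] by metis
  have b: "\<bar>f u \<bullet> y\<bar> \<le> (K * norm y) * norm u" if "u \<in> X" for u
  proof -
    have "\<bar>f u \<bullet> y\<bar> \<le> norm (f u) * norm y"
      by (rule Cauchy_Schwarz_ineq2)
    also have "\<dots> \<le> (K * norm u) * norm y"
      by (intro mult_right_mono K that) simp
    finally show ?thesis
      by (simp add: mult_ac)
  qed
  obtain x where x: "x \<in> X" "\<And>u. u \<in> X \<Longrightarrow> u \<bullet> x = f u \<bullet> y"
  proof (rule riesz_on[OF X, of "\<lambda>u. f u \<bullet> y" "K * norm y"])
    show "f (u + v) \<bullet> y = f u \<bullet> y + f v \<bullet> y" if "u \<in> X" "v \<in> X" for u v
      using f that by (simp add: bounded_linear_on_def inner_add_left)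
    show "f (c *\<^sub>R u) \<bullet> y = c * (f u \<bullet> y)" if "u \<in> X" for c u
      using f that by (simp add: bounded_linear_on_def)
  qed (use b in auto)
  have "adjoint_on X f y \<in> X \<and> (\<forall>u\<in>X. u \<bullet> adjoint_on X f y = f u \<bullet> y)"
    unfolding adjoint_on_def
  proof (rule theI)
    show "x \<in> X \<and> (\<forall>u\<in>X. u \<bullet> x = f u \<bullet> y)"
      using x by blast
    show "x' = x" if "x' \<in> X \<and> (\<forall>u\<in>X. u \<bullet> x' = f u \<bullet> y)" for x'
      using that x X by (intro eq_of_inner_eq[of X]) (auto simp: hilbert_subspace_def)
  qed
  then show "adjoint_on X f y \<in> X" "u \<in> X \<Longrightarrow> u \<bullet> adjoint_on X f y = f u \<bullet> y"
    by auto
qed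

lemma adjoint_on_diff:
  assumes f: "bounded_linear_on X Y f" and X: "hilbert_subspace X"
  shows "adjoint_on X f (y - y') = adjoint_on X f y - adjoint_on X f y'"
  using X by (intro eq_of_inner_eq[of X])
    (auto simp: hilbert_subspace_def subspace_diff adjoint_on_in[OF f X]
      adjoint_on_inner[OF f X] inner_diff_right)

text \<open>The adjoint inherits the bound of \<open>f\<close>: test the defining identity at the
  adjoint vector itself and cancel one factor of its norm.\<close>

lemma adjoint_on_bound:
  assumes f: "bounded_linear_on X Y f" and X: "hilbert_subspace X"
  obtains K where "K \<ge> 0" "\<And>y. norm (adjoint_on X f y) \<le> K * norm y"
proof -
  obtain K where K: "K \<ge> 0" "\<And>u. u \<in> X \<Longrightarrow> norm (f u) \<le> K * norm u"
    using bounded_linear_on_bound[OF f] by metis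
  have "norm (adjoint_on X f y) \<le> K * norm y" for y
  proof -
    let ?a = "adjoint_on X f y"
    have a: "?a \<in> X"
      by (rule adjoint_on_in[OF f X])
    have "norm ?a * norm ?a = f ?a \<bullet> y"
      using adjoint_on_inner[OF f X a, of y] by (simp add: power2_norm_eq_inner flip: power2_eq_square)
    also have "\<dots> \<le> norm (f ?a) * norm y"
      by (rule norm_cauchy_schwarz)
    also have "\<dots> \<le> (K * norm ?a) * norm y"
      by (intro mult_right_mono K a) simp
    finally have "norm ?a * norm ?a \<le> norm ?a * (K * norm y)"
      by (simp add: mult_ac)
    then show ?thesis
      using K(1) by (cases "norm ?a = 0") (auto simp: mult_le_cancel_left)
  qed
  with K(1) show ?thesis
    by (rule that)
qed

subsection \<open>Weak cluster points\<close>

text \<open>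
  Weak sequential compactness without subsequences: the filter is refined until all inner products
  converge, which Tychonoff's theorem allows, and the limit functional is represented by Riesz.
\<close>

lemma compact_pointwise_bounded:
  fixes c :: "'a \<Rightarrow> real"
  shows "compact {f. \<forall>u. \<bar>f u\<bar> \<le> c u}"
proof -
  have "compactin (product_topology (\<lambda>u. euclidean) UNIV) (PiE UNIV (\<lambda>u. {- c u..c u}))"
    by (simp add: compactin_PiE)
  moreover have "PiE UNIV (\<lambda>u. {- c u..c u}) = {f. \<forall>u. \<bar>f u\<bar> \<le> c u}"
    by (auto simp: PiE_iff abs_le_iff; metis minus_le_iff)
  ultimately show ?thesis
    by (simp add: euclidean_product_topology)
qed

lemma weak_cluster:
  fixes f :: "'b \<Rightarrow> 'a::real_inner"
  assumes H: "hilbert_subspace H" and F: "F \<noteq> bot"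
    and bound: "eventually (\<lambda>k. norm (f k) \<le> C) F"
  obtains F' x where "F' \<le> F" "F' \<noteq> bot" "x \<in> H"
    "\<And>u. u \<in> H \<Longrightarrow> ((\<lambda>k. f k \<bullet> u) \<longlongrightarrow> x \<bullet> u) F'"
proof -
  \<comment> \<open>A vector is replaced by the function of its inner products, which lives in a
    compact product of intervals.\<close>
  define \<Phi> where "\<Phi> k = (\<lambda>u. f k \<bullet> u)" for k
  let ?U = "{g. \<forall>u. \<bar>g u\<bar> \<le> C * norm u} :: ('a \<Rightarrow> real) set"
  have in_U: "eventually (\<lambda>g. g \<in> ?U) (filtermap \<Phi> F)"
    unfolding eventually_filtermap using bound
  proof eventually_elim
    case (elim k)
    have "\<bar>f k \<bullet> u\<bar> \<le> C * norm u" for u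
      using Cauchy_Schwarz_ineq2[of "f k" u] mult_right_mono[OF elim norm_ge_zero[of u]] by linarith
    then show ?case
      by (simp add: \<Phi>_def)
  qed
  have "filtermap \<Phi> F \<noteq> bot"
    using F by (simp add: filtermap_bot_iff)
  then obtain \<phi> where \<phi>U: "\<phi> \<in> ?U" and \<phi>: "inf (nhds \<phi>) (filtermap \<Phi> F) \<noteq> bot"
    using compact_pointwise_bounded[of "\<lambda>u. C * norm u"] in_U unfolding compact_filter by blast
  \<comment> \<open>The trace of \<open>F\<close> on the preimages of neighbourhoods of the cluster
    point \<open>\<phi>\<close>. It is proper because the image filter meets every such
    neighbourhood.\<close>
  define F' where "F' = inf (filtercomap \<Phi> (nhds \<phi>)) F"
  have le: "F' \<le> F"
    by (simp add: F'_def)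
  have nb: "F' \<noteq> bot"
  proof
    assume "F' = bot"
    then have "eventually (\<lambda>_. False) (inf (filtercomap \<Phi> (nhds \<phi>)) F)"
      by (simp add: F'_def)
    then obtain Q R where "eventually Q (filtercomap \<Phi> (nhds \<phi>))" "eventually R F"
      and QR: "\<And>k. Q k \<Longrightarrow> \<not> R k"
      unfolding eventually_inf by blast
    then obtain S where S: "eventually S (nhds \<phi>)" "\<And>k. S (\<Phi> k) \<Longrightarrow> Q k"
      unfolding eventually_filtercomap by blast
    have "eventually (\<lambda>g. \<not> S g) (filtermap \<Phi> F)"
      unfolding eventually_filtermap using \<open>eventually R F\<close>
      by eventually_elim (use S QR in blast)
    then have "eventually (\<lambda>_. False) (inf (nhds \<phi>) (filtermap \<Phi> F))"
      using S(1) unfolding eventually_inf by blast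
    then show False
      using \<phi> by (simp add: trivial_limit_def)
  qed
  have "filterlim \<Phi> (nhds \<phi>) F'"
    unfolding F'_def by (rule filterlim_mono[OF filterlim_filtercomap]) auto
  then have lim: "((\<lambda>k. f k \<bullet> u) \<longlongrightarrow> \<phi> u) F'" for u
    using continuous_on_tendsto_compose[OF continuous_on_product_coordinates, of \<Phi> \<phi> F' u]
    by (simp add: \<Phi>_def)
  have uniq: "a = b" if "(h \<longlongrightarrow> a) F'" "(h \<longlongrightarrow> b) F'" for h and a b :: real
    using tendsto_unique[OF nb] that by blast
  have "\<phi> (u + v) = \<phi> u + \<phi> v" for u v
    using uniq[OF lim[of "u + v"]] tendsto_add[OF lim[of u] lim[of v]] by (simp add: inner_add_right)
  moreover have "\<phi> (c *\<^sub>R u) = c * \<phi> u" for c u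
    using uniq[OF lim[of "c *\<^sub>R u"]] tendsto_mult_left[OF lim[of u], of c] by simp
  \<comment> \<open>Only the restriction of \<open>\<phi>\<close> to \<open>H\<close> is
    represented, which suffices as weak limits are tested against \<open>H\<close> alone.\<close>
  ultimately obtain x where x: "x \<in> H" "\<And>u. u \<in> H \<Longrightarrow> u \<bullet> x = \<phi> u"
    using riesz_on[OF H, of \<phi> C] \<phi>U by blast
  show ?thesis
    using that[OF le nb x(1)] lim x(2) by (simp add: inner_commute)
qed

text \<open>The filter is refined for one component at a time; limits already obtained survive under
  a finer filter.\<close>

lemma weak_cluster_family:
  fixes f :: "'b \<Rightarrow> 'i \<Rightarrow> 'a::real_inner"
  assumes "finite I" "\<And>i. i \<in> I \<Longrightarrow> hilbert_subspace (H i)" "F \<noteq> bot"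
    and "\<And>i. i \<in> I \<Longrightarrow> eventually (\<lambda>k. norm (f k i) \<le> C i) F"
  shows "\<exists>F' x. F' \<le> F \<and> F' \<noteq> bot \<and>
    (\<forall>i\<in>I. x i \<in> H i \<and> (\<forall>u\<in>H i. ((\<lambda>k. f k i \<bullet> u) \<longlongrightarrow> x i \<bullet> u) F'))"
  using assms
proof (induction I)
  case empty
  then show ?case
    by auto
next
  case (insert j I)
  obtain F1 x where F1: "F1 \<le> F" "F1 \<noteq> bot"
    and x: "\<forall>i\<in>I. x i \<in> H i \<and> (\<forall>u\<in>H i. ((\<lambda>k. f k i \<bullet> u) \<longlongrightarrow> x i \<bullet> u) F1)"
    using insert by blast
  obtain F2 y where F2: "F2 \<le> F1" "F2 \<noteq> bot" and y: "y \<in> H j"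
    "\<And>u. u \<in> H j \<Longrightarrow> ((\<lambda>k. f k j \<bullet> u) \<longlongrightarrow> y \<bullet> u) F2"
    using weak_cluster[of "H j" F1 "\<lambda>k. f k j" "C j"] insert.prems F1
    by (metis filter_leD insertI1)
  have "F2 \<le> F"
    using F1 F2 by simp
  moreover have "\<forall>i\<in>insert j I. (x(j := y)) i \<in> H i \<and>
      (\<forall>u\<in>H i. ((\<lambda>k. f k i \<bullet> u) \<longlongrightarrow> (x(j := y)) i \<bullet> u) F2)"
    using x y insert.hyps by (auto intro: tendsto_mono[OF F2(1)])
  ultimately show ?case
    using F2(2) by blast
qed

text \<open>The distance to every point of \<open>S\<close> converges, so for two cluster points the
  difference of their squared distances has the same limit along both filters, which forces them to
  coincide. The weights \<open>g\<close> make room for the factor \<open>\<gamma>\<close> on the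
  primal component.\<close>

lemma opial:
  fixes q :: "nat \<Rightarrow> 'i \<Rightarrow> 'a::real_inner" and g :: "'i \<Rightarrow> real"
  assumes fin: "finite I" and H: "\<And>i. i \<in> I \<Longrightarrow> hilbert_subspace (H i)"
    and g: "\<And>i. i \<in> I \<Longrightarrow> g i > 0"
    and ne: "p0 \<in> S"
    and fejer: "\<And>p k. p \<in> S \<Longrightarrow> k \<ge> K \<Longrightarrow>
      (\<Sum>i\<in>I. g i * (norm (q (Suc k) i - p i))\<^sup>2) \<le> (\<Sum>i\<in>I. g i * (norm (q k i - p i))\<^sup>2)"
    and cluster: "\<And>F p. F \<le> sequentially \<Longrightarrow> F \<noteq> bot \<Longrightarrow> (\<And>i. i \<in> I \<Longrightarrow> p i \<in> H i) \<Longrightarrow>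
      (\<And>i u. i \<in> I \<Longrightarrow> u \<in> H i \<Longrightarrow> ((\<lambda>k. q k i \<bullet> u) \<longlongrightarrow> p i \<bullet> u) F) \<Longrightarrow> p \<in> S"
  obtains p where "p \<in> S" "\<And>i. i \<in> I \<Longrightarrow> p i \<in> H i"
    "\<And>i u. i \<in> I \<Longrightarrow> u \<in> H i \<Longrightarrow> (\<lambda>k. q k i \<bullet> u) \<longlonglongrightarrow> p i \<bullet> u"
proof -
  define D where "D p k = (\<Sum>i\<in>I. g i * (norm (q k i - p i))\<^sup>2)" for p k
  have Dnn: "D p k \<ge> 0" for p k
    unfolding D_def by (intro sum_nonneg) (simp add: g less_imp_le)
  have dec: "decseq (\<lambda>k. D p (k + K))" if "p \<in> S" for p
    using fejer[OF that] by (intro decseq_SucI) (simp add: D_def)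
  have Dconv: "\<exists>l. D p \<longlonglongrightarrow> l" if "p \<in> S" for p
    using decseq_convergent[OF dec[OF that], of 0] Dnn LIMSEQ_offset by metis
  have bnd: "norm (q k i) \<le> sqrt (D p0 K / g i) + norm (p0 i)" if "i \<in> I" "k \<ge> K" for i k
  proof -
    have "D p0 k \<le> D p0 K"
      using decseqD[OF dec[OF ne], of 0 "k - K"] that by simp
    moreover have "g i * (norm (q k i - p0 i))\<^sup>2 \<le> D p0 k"
      unfolding D_def by (rule member_le_sum) (use fin g that in \<open>auto simp: less_imp_le\<close>)
    ultimately have "(norm (q k i - p0 i))\<^sup>2 \<le> D p0 K / g i"
      using g[OF that(1)] by (simp add: field_simps)
    then have "norm (q k i - p0 i) \<le> sqrt (D p0 K / g i)"
      by (rule real_le_rsqrt)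
    then show ?thesis
      using norm_triangle_sub[of "q k i" "p0 i"] by linarith
  qed
  have get: "\<exists>F' p. F' \<le> F \<and> F' \<noteq> bot \<and> p \<in> S \<and>
      (\<forall>i\<in>I. p i \<in> H i \<and> (\<forall>u\<in>H i. ((\<lambda>k. q k i \<bullet> u) \<longlongrightarrow> p i \<bullet> u) F'))"
    if F: "F \<le> sequentially" "F \<noteq> bot" for F
  proof -
    have "eventually (\<lambda>k. norm (q k i) \<le> sqrt (D p0 K / g i) + norm (p0 i)) F" if "i \<in> I" for i
      using bnd[OF that] F(1) by (meson eventually_sequentially filter_leD)
    then obtain F' p where F': "F' \<le> F" "F' \<noteq> bot"
      and p: "\<forall>i\<in>I. p i \<in> H i \<and> (\<forall>u\<in>H i. ((\<lambda>k. q k i \<bullet> u) \<longlongrightarrow> p i \<bullet> u) F')"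
      using weak_cluster_family[where f = q and F = F and H = H and C = "\<lambda>i. sqrt (D p0 K / g i) + norm (p0 i)", OF fin H F(2)]
      by blast
    have "p \<in> S"
      using cluster[of F' p] F' F(1) p by (meson order_trans)
    then show ?thesis
      using F' p by blast
  qed
  obtain F p where F: "F \<le> sequentially" "F \<noteq> bot" and pS: "p \<in> S"
    and p: "\<forall>i\<in>I. p i \<in> H i \<and> (\<forall>u\<in>H i. ((\<lambda>k. q k i \<bullet> u) \<longlongrightarrow> p i \<bullet> u) F)"
    using get[OF order_refl sequentially_bot] by blast
  have "(\<lambda>k. q k j \<bullet> u) \<longlonglongrightarrow> p j \<bullet> u" if j: "j \<in> I" and u: "u \<in> H j" for j u
  proof (rule ccontr)
    assume "\<not> (\<lambda>k. q k j \<bullet> u) \<longlonglongrightarrow> p j \<bullet> u"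
    then obtain e where e: "e > 0" "\<not> eventually (\<lambda>k. dist (q k j \<bullet> u) (p j \<bullet> u) < e) sequentially"
      unfolding tendsto_iff by blast
    \<comment> \<open>Failure of convergence leaves infinitely many indices in \<open>A\<close>. A
      second cluster point extracted along \<open>A\<close> must equal \<open>p\<close>, which
      contradicts the distance kept at \<open>u\<close>.\<close>
    define A where "A = {k. \<not> dist (q k j \<bullet> u) (p j \<bullet> u) < e}"
    have "inf sequentially (principal A) \<noteq> bot"
      using e(2) by (simp add: trivial_limit_def eventually_inf_principal A_def)
    then obtain F' p' where F': "F' \<le> inf sequentially (principal A)" "F' \<noteq> bot" and pS': "p' \<in> S"
      and p': "\<forall>i\<in>I. p' i \<in> H i \<and> (\<forall>u\<in>H i. ((\<lambda>k. q k i \<bullet> u) \<longlongrightarrow> p' i \<bullet> u) F')"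
      using get[of "inf sequentially (principal A)"] by auto
    obtain l l' where l: "D p \<longlonglongrightarrow> l" "D p' \<longlonglongrightarrow> l'"
      using Dconv pS pS' by blast
    \<comment> \<open>The terms quadratic in \<open>q k\<close> cancel in the difference; what
      remains is affine and hence passes to weak limits.\<close>
    have diff: "((\<lambda>k. D p k - D p' k) \<longlongrightarrow>
        (\<Sum>i\<in>I. g i * (2 * (r i \<bullet> (p' i - p i)) + (norm (p i))\<^sup>2 - (norm (p' i))\<^sup>2))) G"
      if r: "\<forall>i\<in>I. r i \<in> H i \<and> (\<forall>u\<in>H i. ((\<lambda>k. q k i \<bullet> u) \<longlongrightarrow> r i \<bullet> u) G)" for r G
    proof -
      have "p' i - p i \<in> H i" if "i \<in> I" for i
        using p p' H[OF that] that by (simp add: hilbert_subspace_def subspace_diff)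
      then have "((\<lambda>k. \<Sum>i\<in>I. g i * (2 * (q k i \<bullet> (p' i - p i)) + (norm (p i))\<^sup>2 - (norm (p' i))\<^sup>2))
          \<longlongrightarrow> (\<Sum>i\<in>I. g i * (2 * (r i \<bullet> (p' i - p i)) + (norm (p i))\<^sup>2 - (norm (p' i))\<^sup>2))) G"
        using r by (intro tendsto_sum tendsto_mult_left tendsto_diff tendsto_add tendsto_const) auto
      moreover have "D p k - D p' k =
          (\<Sum>i\<in>I. g i * (2 * (q k i \<bullet> (p' i - p i)) + (norm (p i))\<^sup>2 - (norm (p' i))\<^sup>2))" for k
        unfolding D_def sum_subtractf[symmetric]
        by (intro sum.cong refl) (simp add: power2_norm_eq_inner algebra_simps inner_commute)
      ultimately show ?thesis
        by simp
    qed
    have dl: "(\<lambda>k. D p k - D p' k) \<longlonglongrightarrow> l - l'"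
      by (intro tendsto_diff l)
    have F'seq: "F' \<le> sequentially"
      using F'(1) by simp
    have "(\<Sum>i\<in>I. g i * (2 * (p i \<bullet> (p' i - p i)) + (norm (p i))\<^sup>2 - (norm (p' i))\<^sup>2)) =
        (\<Sum>i\<in>I. g i * (2 * (p' i \<bullet> (p' i - p i)) + (norm (p i))\<^sup>2 - (norm (p' i))\<^sup>2))"
      using tendsto_unique[OF F(2) diff[OF p] tendsto_mono[OF F(1) dl]]
        tendsto_unique[OF F'(2) diff[OF p'] tendsto_mono[OF F'seq dl]] by simp
    then have "(\<Sum>i\<in>I. g i * (2 * (p' i \<bullet> (p' i - p i)) + (norm (p i))\<^sup>2 - (norm (p' i))\<^sup>2) -
        g i * (2 * (p i \<bullet> (p' i - p i)) + (norm (p i))\<^sup>2 - (norm (p' i))\<^sup>2)) = 0"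
      by (simp add: sum_subtractf)
    also have "(\<Sum>i\<in>I. g i * (2 * (p' i \<bullet> (p' i - p i)) + (norm (p i))\<^sup>2 - (norm (p' i))\<^sup>2) -
        g i * (2 * (p i \<bullet> (p' i - p i)) + (norm (p i))\<^sup>2 - (norm (p' i))\<^sup>2)) =
        (\<Sum>i\<in>I. 2 * g i * (norm (p' i - p i))\<^sup>2)"
      by (intro sum.cong refl) (simp add: power2_norm_eq_inner algebra_simps inner_commute)
    finally have "\<forall>i\<in>I. 2 * g i * (norm (p' i - p i))\<^sup>2 = 0"
      using fin g by (subst (asm) sum_nonneg_eq_0_iff) (auto simp: less_imp_le)
    then have "p' j = p j"
      using g j by fastforce
    then have "eventually (\<lambda>k. dist (q k j \<bullet> u) (p j \<bullet> u) < e) F'"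
      using p' j u e(1) unfolding tendsto_iff by auto
    moreover have "eventually (\<lambda>k. k \<in> A) F'"
      using F'(1) by (simp add: le_principal)
    ultimately have "eventually (\<lambda>_. False) F'"
      by eventually_elim (simp add: A_def)
    then show False
      using F'(2) by (simp add: trivial_limit_def)
  qed
  with pS p show ?thesis
    using that by blast
qed

section \<open>Minty's theorem\<close>

text \<open>
  A finite monotone set, shifted so that the resolvent is sought at \<open>0\<close>: maximizing a concave
  function over the convex hull of the triples \<open>(a, b, a \<bullet> b)\<close> gives the solution \<open>(a - b) / 2\<close>.
  Monotonicity of pairs of points is affine in each of the two triples and so passes to the hull.
\<close>

lemma finite_monotone_solution:
  fixes J :: "('a::real_inner \<times> 'a) set"
  assumes H: "subspace H" and fin: "finite J" and J: "J \<subseteq> H \<times> H"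
    and mono: "\<And>a b a' b'. (a, b) \<in> J \<Longrightarrow> (a', b') \<in> J \<Longrightarrow> (a - a') \<bullet> (b - b') \<ge> 0"
  shows "\<exists>x\<in>H. \<forall>(a, b)\<in>J. (x - a) \<bullet> (x + b) \<le> 0"
proof (cases "J = {}")
  case True
  then show ?thesis
    using subspace_0[OF H] by blast
next
  case False
  define trip where "trip = (\<lambda>(a::'a, b::'a). (a, b, a \<bullet> b))"
  define K where "K = convex hull (trip ` J)"
  have K: "compact K" "K \<noteq> {}"
    using fin False by (auto simp: K_def finite_imp_compact_convex_hull)
  \<comment> \<open>For averages \<open>A\<close>, \<open>B\<close>, \<open>Q\<close> of the
    triples, this is the minimum over \<open>x\<close> of the average of
    \<open>(x - a) \<bullet> (x + b)\<close>, attained at \<open>(A - B) / 2\<close>: the dual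
    function of a minimax problem.\<close>
  define h where "h = (\<lambda>(a::'a, b::'a, r::real). - (norm ((1/2) *\<^sub>R (a - b)))\<^sup>2 - r)"
  have "continuous_on K h"
    unfolding h_def case_prod_beta by (intro continuous_intros)
  then obtain s where sK: "s \<in> K" and smax: "\<And>t. t \<in> K \<Longrightarrow> h t \<le> h s"
    using continuous_attains_sup[OF K] by blast
  obtain A B Q where s: "s = (A, B, Q)"
    by (cases s)
  \<comment> \<open>This is \<open>(a - a') \<bullet> (b - b')\<close> with the products
    \<open>a \<bullet> b\<close> and \<open>a' \<bullet> b'\<close> replaced by the third components
    of the triples.\<close>
  let ?pair = "\<lambda>t t'. snd (snd t) + snd (snd t') - fst t \<bullet> fst (snd t') - fst t' \<bullet> fst (snd t)"
  have conv: "convex {t :: 'a \<times> 'a \<times> real. 0 \<le> ?pair t t'}" for t'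
    unfolding convex_alt
  proof (intro ballI allI impI, elim conjE)
    fix x y :: "'a \<times> 'a \<times> real" and c :: real
    assume xy: "x \<in> {t. 0 \<le> ?pair t t'}" "y \<in> {t. 0 \<le> ?pair t t'}" and c: "0 \<le> c" "c \<le> 1"
    have "?pair ((1 - c) *\<^sub>R x + c *\<^sub>R y) t' = (1 - c) * ?pair x t' + c * ?pair y t'"
      by (simp add: algebra_simps inner_add_left inner_add_right)
    moreover have "0 \<le> (1 - c) * ?pair x t' + c * ?pair y t'"
      using xy c by (intro add_nonneg_nonneg mult_nonneg_nonneg) auto
    ultimately show "(1 - c) *\<^sub>R x + c *\<^sub>R y \<in> {t. 0 \<le> ?pair t t'}"
      by (simp only: mem_Collect_eq)
  qed
  have "0 \<le> ?pair t t'" if "t \<in> trip ` J" "t' \<in> trip ` J" for t t'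
    using that mono by (fastforce simp: trip_def algebra_simps inner_commute)
  then have "K \<subseteq> {t. 0 \<le> ?pair t t'}" if "t' \<in> trip ` J" for t'
    unfolding K_def using that by (intro hull_minimal conv) auto
  moreover have "?pair t t' = ?pair t' t" for t t' :: "'a \<times> 'a \<times> real"
    by simp
  ultimately have "trip ` J \<subseteq> {t'. 0 \<le> ?pair t' s}"
    using sK by (smt (verit) mem_Collect_eq subset_iff)
  then have "K \<subseteq> {t'. 0 \<le> ?pair t' s}"
    unfolding K_def by (intro hull_minimal conv)
  \<comment> \<open>Paired with itself, \<open>s\<close> gives
    \<open>2 * (Q - A \<bullet> B)\<close>.\<close>
  then have Q: "Q \<ge> A \<bullet> B"
    using sK by (auto simp: s)
  define x where "x = (1/2) *\<^sub>R (A - B)"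
  have hs: "h s \<le> 0"
  proof -
    have "h s = - (norm x)\<^sup>2 - Q"
      by (simp add: h_def s x_def)
    also have "\<dots> \<le> - (norm x)\<^sup>2 - A \<bullet> B"
      using Q by simp
    also have "\<dots> = - (norm ((1/2) *\<^sub>R (A + B)))\<^sup>2"
      by (simp add: x_def power2_norm_eq_inner algebra_simps inner_commute)
    finally show ?thesis
      by (smt (verit) zero_le_power2)
  qed
  have "K \<subseteq> H \<times> H \<times> UNIV"
    unfolding K_def
  proof (rule hull_minimal)
    show "trip ` J \<subseteq> H \<times> H \<times> UNIV"
      using J by (auto simp: trip_def)
    show "convex (H \<times> H \<times> (UNIV :: real set))"
      by (intro convex_Times subspace_imp_convex H convex_UNIV)
  qed
  then have xH: "x \<in> H"
    using sK H by (auto simp: s x_def subspace_diff subspace_scale)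
  have "(x - a) \<bullet> (x + b) \<le> 0" if ab: "(a, b) \<in> J" for a b
  proof -
    define y where "y = (1/2) *\<^sub>R (a - b)"
    \<comment> \<open>First-order optimality of \<open>s\<close> towards the triple of
      \<open>(a, b)\<close>, already divided by \<open>t\<close>. The limit
      \<open>t \<rightarrow> 0\<close> and \<open>h s \<le> 0\<close> add up to the claim.\<close>
    have "2 * (norm x)\<^sup>2 + Q - 2 * (x \<bullet> y) - a \<bullet> b \<le> t * (norm (y - x))\<^sup>2"
      if t: "0 < t" "t \<le> 1" for t
    proof -
      have "trip (a, b) \<in> K"
        using ab by (auto simp: K_def intro: hull_inc)
      then have "(1 - t) *\<^sub>R s + t *\<^sub>R trip (a, b) \<in> K"
        using sK t convex_convex_hull[of "trip ` J"] unfolding K_def[symmetric] convex_alt by auto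
      then have "h ((1 - t) *\<^sub>R s + t *\<^sub>R trip (a, b)) \<le> h s"
        by (rule smax)
      moreover have "h ((1 - t) *\<^sub>R s + t *\<^sub>R trip (a, b)) =
          - (norm (x + t *\<^sub>R (y - x)))\<^sup>2 - ((1 - t) * Q + t * (a \<bullet> b))"
        by (simp add: h_def s trip_def x_def y_def algebra_simps)
      moreover have "h s = - (norm x)\<^sup>2 - Q"
        by (simp add: h_def s x_def)
      moreover have "(norm (x + t *\<^sub>R (y - x)))\<^sup>2 =
          (norm x)\<^sup>2 + 2 * t * (x \<bullet> y - (norm x)\<^sup>2) + t\<^sup>2 * (norm (y - x))\<^sup>2"
        by (simp only: power2_norm_eq_inner)
          (simp add: algebra_simps inner_commute power2_eq_square)
      ultimately have "t * (2 * (norm x)\<^sup>2 + Q - 2 * (x \<bullet> y) - a \<bullet> b) \<le> t * (t * (norm (y - x))\<^sup>2)"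
        by (simp add: algebra_simps power2_eq_square)
      then show ?thesis
        using t by simp
    qed
    then have ev: "eventually (\<lambda>t. 2 * (norm x)\<^sup>2 + Q - 2 * (x \<bullet> y) - a \<bullet> b \<le> t * (norm (y - x))\<^sup>2)
        (at_right 0)"
      using eventually_at_right_real[of 0 1] by (auto elim: eventually_mono)
    have "((\<lambda>t. t * (norm (y - x))\<^sup>2) \<longlongrightarrow> 0 * (norm (y - x))\<^sup>2) (at_right (0::real))"
      by (intro tendsto_intros)
    then have "2 * (norm x)\<^sup>2 + Q - 2 * (x \<bullet> y) - a \<bullet> b \<le> 0 * (norm (y - x))\<^sup>2"
      by (rule tendsto_lowerbound[OF _ ev]) simp
    moreover have "- (norm x)\<^sup>2 - Q \<le> 0"
      using hs by (simp add: h_def s x_def)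
    moreover have "(x - a) \<bullet> (x + b) = (norm x)\<^sup>2 - 2 * (x \<bullet> y) - a \<bullet> b"
      by (simp add: y_def power2_norm_eq_inner algebra_simps inner_commute)
    ultimately show ?thesis
      by linarith
  qed
  with xH show ?thesis
    by blast
qed

text \<open>Each pair confines \<open>x\<close> to a ball centred at \<open>(a - b) / 2\<close>, and
  finitely many of these balls meet inside \<open>H\<close>. A weak cluster point of the filter they
  generate lies in all of them.\<close>

lemma monotone_solution:
  fixes J :: "('a::real_inner \<times> 'a) set"
  assumes H: "hilbert_subspace H" and J: "J \<subseteq> H \<times> H"
    and mono: "\<And>a b a' b'. (a, b) \<in> J \<Longrightarrow> (a', b') \<in> J \<Longrightarrow> (a - a') \<bullet> (b - b') \<ge> 0"
  shows "\<exists>x\<in>H. \<forall>(a, b)\<in>J. (x - a) \<bullet> (x + b) \<le> 0"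
proof (cases "J = {}")
  case True
  then show ?thesis
    using H subspace_0[of H] by (auto simp: hilbert_subspace_def)
next
  case False
  define C where "C = (\<lambda>(a, b). {x\<in>H. (x - a) \<bullet> (x + b) \<le> 0})"
  define F where "F = (INF j\<in>J. principal (C j))"
  have "F \<noteq> bot"
    unfolding F_def
  proof (rule INF_filter_not_bot)
    fix X
    assume X: "X \<subseteq> J" "finite X"
    obtain x where "x \<in> H" "\<forall>(a, b)\<in>X. (x - a) \<bullet> (x + b) \<le> 0"
      using finite_monotone_solution[of H X] H X J mono
      by (meson hilbert_subspace_def in_mono subset_trans)
    then have "(\<Inter>j\<in>X. C j) \<noteq> {}"
      by (fastforce simp: C_def)
    then show "(INF j\<in>X. principal (C j)) \<noteq> bot"
      using X by (simp add: INF_principal_finite principal_eq_bot_iff)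
  qed
  have inC: "eventually (\<lambda>x. x \<in> C j) F" if "j \<in> J" for j
    unfolding F_def using that by (auto intro: eventually_INF1 simp: eventually_principal)
  obtain a0 b0 where 0: "(a0, b0) \<in> J"
    using False by auto
  have "eventually (\<lambda>x. norm x \<le> 1 + norm (b0 - a0) + \<bar>a0 \<bullet> b0\<bar>) F"
    using inC[OF 0]
  proof eventually_elim
    case (elim x)
    then have le: "(norm x)\<^sup>2 \<le> a0 \<bullet> b0 - x \<bullet> (b0 - a0)"
      by (simp add: C_def power2_norm_eq_inner algebra_simps inner_commute)
    have "- (x \<bullet> (b0 - a0)) \<le> norm x * norm (b0 - a0)"
      using Cauchy_Schwarz_ineq2[of x "b0 - a0"] by linarith
    with le have *: "(norm x)\<^sup>2 \<le> \<bar>a0 \<bullet> b0\<bar> + norm x * norm (b0 - a0)"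
      by linarith
    show ?case
    proof (rule ccontr)
      assume "\<not> ?thesis"
      then have big: "norm x > 1 + norm (b0 - a0) + \<bar>a0 \<bullet> b0\<bar>"
        by simp
      then have "norm x * (1 + norm (b0 - a0) + \<bar>a0 \<bullet> b0\<bar>) < norm x * norm x"
        using norm_ge_zero[of "b0 - a0"] by (intro mult_strict_left_mono) linarith+
      moreover have "1 * \<bar>a0 \<bullet> b0\<bar> \<le> norm x * \<bar>a0 \<bullet> b0\<bar>"
        using big norm_ge_zero[of "b0 - a0"] by (intro mult_right_mono) linarith+
      ultimately show False
        using * norm_ge_zero[of x] by (simp add: power2_eq_square algebra_simps)
    qed
  qed
  then obtain F' x where F': "F' \<le> F" "F' \<noteq> bot" and xH: "x \<in> H"
    and lim: "\<And>u. u \<in> H \<Longrightarrow> ((\<lambda>k. k \<bullet> u) \<longlongrightarrow> x \<bullet> u) F'"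
    using weak_cluster[OF H \<open>F \<noteq> bot\<close>, of "\<lambda>x. x"] by metis
  have "(x - a) \<bullet> (x + b) \<le> 0" if ab: "(a, b) \<in> J" for a b
  proof -
    \<comment> \<open>The square of the norm of \<open>k\<close> is replaced by its affine minorant
      at \<open>x\<close>, since only affine expressions are known to converge along
      \<open>F'\<close>.\<close>
    have "eventually (\<lambda>k. 2 * (k \<bullet> x) - (norm x)\<^sup>2 + k \<bullet> (b - a) - a \<bullet> b \<le> 0) F'"
      using filter_leD[OF F'(1) inC[OF ab]]
    proof eventually_elim
      case (elim k)
      have "0 \<le> (norm (k - x))\<^sup>2"
        by simp
      then show ?case
        using elim by (simp add: C_def power2_norm_eq_inner algebra_simps inner_commute)
    qed
    moreover have "((\<lambda>k. 2 * (k \<bullet> x) - (norm x)\<^sup>2 + k \<bullet> (b - a) - a \<bullet> b) \<longlongrightarrow>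
        2 * (x \<bullet> x) - (norm x)\<^sup>2 + x \<bullet> (b - a) - a \<bullet> b) F'"
      using ab J H xH by (intro tendsto_intros lim) (auto simp: hilbert_subspace_def subspace_diff)
    ultimately have "2 * (x \<bullet> x) - (norm x)\<^sup>2 + x \<bullet> (b - a) - a \<bullet> b \<le> 0"
      using tendsto_upperbound[OF _ _ F'(2)] by blast
    then show ?thesis
      by (simp add: power2_norm_eq_inner algebra_simps inner_commute)
  qed
  with xH show ?thesis
    by blast
qed

text \<open>Adding the single pair \<open>(x, y)\<close> to the graph keeps the operator monotone,
  so maximality says that the pair was there already.\<close>

lemma maximal_monotone_mem:
  assumes A: "maximal_monotone_op H A" and x: "x \<in> H" and y: "y \<in> H"
    and mono: "\<And>a b. a \<in> H \<Longrightarrow> b \<in> A a \<Longrightarrow> (x - a) \<bullet> (y - b) \<ge> 0"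
  shows "y \<in> A x"
proof -
  define B where "B = (\<lambda>u. if u = x then insert y (A u) else A u)"
  have A': "monotone_op H A"
    using A by (simp add: maximal_monotone_op_def)
  have mono': "(a - x) \<bullet> (b - y) \<ge> 0" if "a \<in> H" "b \<in> A a" for a b
    using mono[OF that] by (metis inner_minus_left inner_minus_right minus_diff_eq minus_minus)
  have "monotone_op H B"
    using A' y mono mono' by (auto simp: monotone_op_def B_def)
  moreover have "\<forall>u\<in>H. A u \<subseteq> B u"
    by (auto simp: B_def)
  ultimately have "B x = A x"
    using A x unfolding maximal_monotone_op_def by blast
  then show ?thesis
    by (auto simp: B_def)
qed

theorem minty:
  fixes A :: "'a::real_inner \<Rightarrow> 'a set"
  assumes H: "hilbert_subspace H" and A: "maximal_monotone_op H A" and \<rho>: "\<rho> > 0" and t: "t \<in> H"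
  shows "\<exists>x\<in>H. \<exists>y\<in>A x. t = x + \<rho> *\<^sub>R y"
proof -
  have S: "subspace H"
    using H by (simp add: hilbert_subspace_def)
  have mono: "(a - a') \<bullet> (b - b') \<ge> 0" if "a \<in> H" "a' \<in> H" "b \<in> A a" "b' \<in> A a'" for a a' b b'
    using A that by (auto simp: maximal_monotone_op_def monotone_op_def)
  have sub: "b \<in> H" if "a \<in> H" "b \<in> A a" for a b
    using A that by (auto simp: maximal_monotone_op_def monotone_op_def)
  \<comment> \<open>With these shifted pairs, the inequality of \<open>monotone_solution\<close>
    says that \<open>(x, (t - x) / \<rho>)\<close> is monotonically related to every point of the
    graph of \<open>A\<close>.\<close>
  define J where "J = {(a, \<rho> *\<^sub>R b - t) |a b. a \<in> H \<and> b \<in> A a}"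
  have "\<exists>x\<in>H. \<forall>(a, b)\<in>J. (x - a) \<bullet> (x + b) \<le> 0"
  proof (rule monotone_solution[OF H])
    show "J \<subseteq> H \<times> H"
      using S t sub by (auto simp: J_def subspace_diff subspace_scale)
    fix a b a' b'
    assume "(a, b) \<in> J" "(a', b') \<in> J"
    then obtain c c' where c: "b = \<rho> *\<^sub>R c - t" "b' = \<rho> *\<^sub>R c' - t" "a \<in> H" "a' \<in> H" "c \<in> A a" "c' \<in> A a'"
      by (auto simp: J_def)
    have "(a - a') \<bullet> (b - b') = \<rho> * ((a - a') \<bullet> (c - c'))"
      by (simp add: c algebra_simps)
    then show "(a - a') \<bullet> (b - b') \<ge> 0"
      using mono c \<rho> by simp
  qed
  then obtain x where xH: "x \<in> H" and x: "\<And>a b. a \<in> H \<Longrightarrow> b \<in> A a \<Longrightarrow> (x - a) \<bullet> (x + (\<rho> *\<^sub>R b - t)) \<le> 0"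
    by (fastforce simp: J_def)
  define y where "y = inverse \<rho> *\<^sub>R (t - x)"
  have \<rho>y: "\<rho> *\<^sub>R y = t - x"
    using \<rho> by (simp add: y_def)
  have "y \<in> A x"
  proof (rule maximal_monotone_mem[OF A xH])
    show "y \<in> H"
      using S xH t by (simp add: y_def subspace_diff subspace_scale)
    fix a b
    assume ab: "a \<in> H" "b \<in> A a"
    have "\<rho> * ((x - a) \<bullet> (y - b)) = (x - a) \<bullet> (\<rho> *\<^sub>R y - \<rho> *\<^sub>R b)"
      by (simp add: algebra_simps)
    also have "\<dots> = - ((x - a) \<bullet> (x + (\<rho> *\<^sub>R b - t)))"
      unfolding \<rho>y by (simp add: algebra_simps)
    finally have "\<rho> * ((x - a) \<bullet> (y - b)) \<ge> 0"
      using x[OF ab] by simp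
    then show "(x - a) \<bullet> (y - b) \<ge> 0"
      using \<rho> by (simp add: zero_le_mult_iff)
  qed
  then show ?thesis
    using xH \<rho>y by (intro bexI[of _ x] bexI[of _ y]) auto
qed

text \<open>Minty's theorem gives existence. For two solutions the differences of \<open>x\<close>
  and of \<open>y\<close> are opposite up to the factor \<open>\<rho>\<close>, so monotonicity
  forces both to vanish. The second conclusion has the form in which the algorithm computes
  \<open>y\<close>.\<close>

lemma prox_mem:
  fixes A :: "'a::real_inner \<Rightarrow> 'a set"
  assumes H: "hilbert_subspace H" and A: "maximal_monotone_op H A" and \<rho>: "\<rho> > 0" and t: "t \<in> H"
  shows "prox H \<rho> A t \<in> H" "inverse \<rho> *\<^sub>R (t - prox H \<rho> A t) \<in> A (prox H \<rho> A t)"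
proof -
  obtain x y where x: "x \<in> H" "y \<in> A x" "t = x + \<rho> *\<^sub>R y"
    using minty[OF assms] by blast
  have "prox H \<rho> A t \<in> H \<and> (\<exists>y\<in>A (prox H \<rho> A t). t = prox H \<rho> A t + \<rho> *\<^sub>R y)"
    unfolding prox_def
  proof (rule theI)
    show "x \<in> H \<and> (\<exists>y\<in>A x. t = x + \<rho> *\<^sub>R y)"
      using x by blast
    fix x'
    assume "x' \<in> H \<and> (\<exists>y\<in>A x'. t = x' + \<rho> *\<^sub>R y)"
    then obtain y' where x': "x' \<in> H" "y' \<in> A x'" "t = x' + \<rho> *\<^sub>R y'"
      by blast
    have "(x' - x) \<bullet> (y' - y) \<ge> 0"
      using A x x' by (auto simp: maximal_monotone_op_def monotone_op_def)
    moreover have "x' - x = - \<rho> *\<^sub>R (y' - y)"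
      using x(3) x'(3) by (simp add: algebra_simps)
    ultimately have "\<rho> * ((y' - y) \<bullet> (y' - y)) \<le> 0"
      by simp
    then have "(y' - y) \<bullet> (y' - y) \<le> 0"
      using \<rho> by (simp add: mult_le_0_iff)
    then have "y' = y"
      by (metis eq_iff_diff_eq_0 inner_ge_zero inner_eq_zero_iff order_antisym)
    then show "x' = x"
      using x(3) x'(3) by simp
  qed
  then obtain y where p: "prox H \<rho> A t \<in> H" "y \<in> A (prox H \<rho> A t)" "t = prox H \<rho> A t + \<rho> *\<^sub>R y"
    by blast
  have "t - prox H \<rho> A t = \<rho> *\<^sub>R y"
    using p(3) by (metis add_diff_cancel_left')
  then have "inverse \<rho> *\<^sub>R (t - prox H \<rho> A t) = y"
    using \<rho> by simp
  with p show "prox H \<rho> A t \<in> H" "inverse \<rho> *\<^sub>R (t - prox H \<rho> A t) \<in> A (prox H \<rho> A t)"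
    by simp_all
qed

section \<open>The problem\<close>

lemma sum_split_last:
  fixes f :: "nat \<Rightarrow> 'a::comm_monoid_add"
  assumes "n \<ge> 1"
  shows "sum f {1..n} = sum f {1..<n} + f n"
proof -
  have "{1..n} = insert n {1..<n}"
    using assms by auto
  then show ?thesis
    by (simp add: add.commute)
qed

locale ps_problem_loc =
  fixes P :: "'a::real_inner ps_problem"
  assumes problem: "problem_assumptions P"
begin

abbreviation "n \<equiv> num P"
abbreviation "H \<equiv> sp P"
abbreviation "T \<equiv> op P"
abbreviation "G \<equiv> lin P"

lemma n_ge_1: "n \<ge> 1"
  using problem by (simp add: problem_assumptions_def)

lemma H_last: "H n = H 0"
  using problem by (simp add: problem_assumptions_def)

lemma hilbert_H: "i \<le> n \<Longrightarrow> hilbert_subspace (H i)"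
  using problem n_ge_1 by (cases "i = n") (auto simp: problem_assumptions_def)

lemma subspace_H: "i \<le> n \<Longrightarrow> subspace (H i)"
  using hilbert_H by (simp add: hilbert_subspace_def)

lemma T_subset: "i \<in> {1..n} \<Longrightarrow> x \<in> H i \<Longrightarrow> y \<in> T i x \<Longrightarrow> y \<in> H i"
  using problem by (fastforce simp: problem_assumptions_def monotone_op_def)

lemma T_mono:
  assumes "i \<in> {1..n}" "x \<in> H i" "x' \<in> H i" "y \<in> T i x" "y' \<in> T i x'"
  shows "(x - x') \<bullet> (y - y') \<ge> 0"
  using problem assms by (simp add: problem_assumptions_def monotone_op_def)

lemma fwd_bwd: "i \<in> {1..n} \<longleftrightarrow> i \<in> fwd P \<or> i \<in> bwd P"
  using problem by (auto simp: problem_assumptions_def)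

lemma T_fwd:
  assumes "i \<in> fwd P" "x \<in> H i"
  shows "T i x = {op1 P i x}" "op1 P i x \<in> H i"
proof -
  show "T i x = {op1 P i x}"
    using problem assms by (fastforce simp: problem_assumptions_def is_singleton_def)
  then show "op1 P i x \<in> H i"
    using T_subset[of i x] assms fwd_bwd by blast
qed

lemma lip_nonneg: "i \<in> fwd P \<Longrightarrow> lip P i \<ge> 0"
  using problem by (auto simp: problem_assumptions_def dest: lipschitz_on_nonneg)

lemma T_lipschitz:
  assumes "i \<in> fwd P" "x \<in> H i" "x' \<in> H i"
  shows "norm (op1 P i x - op1 P i x') \<le> lip P i * norm (x - x')"
  using problem assms by (simp add: problem_assumptions_def lipschitz_on_def dist_norm)

text \<open>A monotone Lipschitz operator with full domain behaves as a maximal one: testing at a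
  point moved from \<open>x\<close> slightly in the direction \<open>v = y - T x\<close> yields
  \<open>v = 0\<close>.\<close>

lemma T_maximal:
  assumes i: "i \<in> {1..n}" and x: "x \<in> H i" and y: "y \<in> H i"
    and mono: "\<And>a b. a \<in> H i \<Longrightarrow> b \<in> T i a \<Longrightarrow> (x - a) \<bullet> (y - b) \<ge> 0"
  shows "y \<in> T i x"
proof (cases "i \<in> fwd P")
  case False
  then have "i \<in> bwd P"
    using i fwd_bwd by blast
  then have "maximal_monotone_op (H i) (T i)"
    using problem by (simp add: problem_assumptions_def)
  then show ?thesis
    using x y mono by (rule maximal_monotone_mem)
next
  case True
  define L where "L = lip P i"
  define v where "v = y - op1 P i x"
  \<comment> \<open>Chosen so that \<open>L * t \<le> 1/2\<close> and the Lipschitz error absorbs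
    only half of \<open>(norm v)^2\<close>; the summand 1 covers \<open>L = 0\<close>.\<close>
  define t where "t = 1 / (2 * (L + 1))"
  define a where "a = x + t *\<^sub>R v"
  have L: "L \<ge> 0"
    using lip_nonneg[OF True] by (simp add: L_def)
  have t: "t > 0"
    using L by (simp add: t_def)
  have v: "v \<in> H i"
    using T_fwd[OF True x] y subspace_H i by (simp add: v_def subspace_diff)
  then have a: "a \<in> H i"
    using x subspace_H i by (simp add: a_def subspace_add subspace_scale)
  have "0 \<le> (x - a) \<bullet> (y - op1 P i a)"
    using mono[OF a, of "op1 P i a"] T_fwd(1)[OF True a] by blast
  then have "0 \<le> t * - (v \<bullet> (y - op1 P i a))"
    by (simp add: a_def)
  then have "v \<bullet> (y - op1 P i a) \<le> 0"
    using t by (simp add: mult_le_0_iff)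
  moreover have "v \<bullet> (op1 P i a - op1 P i x) \<le> norm v * (L * (t * norm v))"
  proof -
    have "v \<bullet> (op1 P i a - op1 P i x) \<le> norm v * norm (op1 P i a - op1 P i x)"
      by (rule norm_cauchy_schwarz)
    also have "\<dots> \<le> norm v * (L * norm (a - x))"
      unfolding L_def by (intro mult_left_mono T_lipschitz True a x) simp
    finally show ?thesis
      using t by (simp add: a_def)
  qed
  moreover have "v \<bullet> v = v \<bullet> (y - op1 P i a) + v \<bullet> (op1 P i a - op1 P i x)"
    by (simp add: v_def inner_diff_right)
  ultimately have "(norm v)\<^sup>2 \<le> (L * t) * (norm v)\<^sup>2"
    by (simp add: power2_norm_eq_inner[symmetric] power2_eq_square mult_ac)
  moreover have "L * t \<le> 1/2"
    using L by (simp add: t_def field_simps)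
  ultimately have "(norm v)\<^sup>2 \<le> (1/2) * (norm v)\<^sup>2"
    by (meson mult_right_mono order_trans zero_le_power2)
  then have "y = op1 P i x"
    by (simp add: v_def)
  then show ?thesis
    using T_fwd(1)[OF True x] by blast
qed

lemma G_last: "u \<in> H 0 \<Longrightarrow> G n u = u"
  using problem by (simp add: problem_assumptions_def)

lemma G_bounded_linear: "i \<in> {1..n} \<Longrightarrow> bounded_linear_on (H 0) (H i) (G i)"
proof (cases "i = n")
  case True
  then show ?thesis
    using G_last H_last subspace_H[of 0]
    by (auto simp: bounded_linear_on_def subspace_add subspace_scale intro!: exI[of _ 1])
next
  case False
  then show "i \<in> {1..n} \<Longrightarrow> ?thesis"
    using problem by (simp add: problem_assumptions_def)
qed

lemma G_in: "i \<in> {1..n} \<Longrightarrow> u \<in> H 0 \<Longrightarrow> G i u \<in> H i"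
  using G_bounded_linear by (auto simp: bounded_linear_on_def)

lemma G_diff: "i \<in> {1..n} \<Longrightarrow> u \<in> H 0 \<Longrightarrow> v \<in> H 0 \<Longrightarrow> G i (u - v) = G i u - G i v"
  using G_bounded_linear subspace_H[of 0] bounded_linear_on_diff by blast

lemma adj_in: "i \<in> {1..n} \<Longrightarrow> lin_adj P i v \<in> H 0"
  using G_bounded_linear hilbert_H adjoint_on_in by blast

lemma adj_inner: "i \<in> {1..n} \<Longrightarrow> u \<in> H 0 \<Longrightarrow> u \<bullet> lin_adj P i v = G i u \<bullet> v"
  using G_bounded_linear hilbert_H adjoint_on_inner by blast

lemma sum_adj_in: "(\<Sum>i\<in>{1..<n}. lin_adj P i (v i)) \<in> H 0"
  using subspace_H by (intro subspace_sum adj_in) auto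

lemma inner_sum_adj:
  "u \<in> H 0 \<Longrightarrow> u \<bullet> (\<Sum>i\<in>{1..<n}. lin_adj P i (v i)) = (\<Sum>i\<in>{1..<n}. G i u \<bullet> v i)"
  by (simp add: inner_sum_right adj_inner)

text \<open>The free dual components are completed by the dependent last one, so that the
  Kuhn-Tucker conditions take the same form for every index up to \<open>n\<close>.\<close>

definition dual_ok :: "(nat \<Rightarrow> 'a) \<Rightarrow> bool" where
  "dual_ok w \<longleftrightarrow> (\<forall>i\<in>{1..n}. w i \<in> H i) \<and> w n = - (\<Sum>i\<in>{1..<n}. lin_adj P i (w i))"

lemma dual_okI:
  assumes "\<And>i. i \<in> {1..<n} \<Longrightarrow> w i \<in> H i" "w n = - (\<Sum>i\<in>{1..<n}. lin_adj P i (w i))"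
  shows "dual_ok w"
proof -
  have "w n \<in> H n"
    using assms(2) sum_adj_in subspace_H[of 0] by (simp add: H_last subspace_neg)
  then have "w i \<in> H i" if "i \<in> {1..n}" for i
    using assms(1)[of i] that by (cases "i = n") auto
  with assms(2) show ?thesis
    by (simp add: dual_ok_def)
qed

lemma dual_ok_mem: "dual_ok w \<Longrightarrow> i \<in> {1..n} \<Longrightarrow> w i \<in> H i"
  by (simp add: dual_ok_def)

text \<open>The last component is minus the adjoint sum and \<open>G n\<close> is the identity. Dual
  tuples are thus orthogonal to all tuples \<open>(G 1 u, ..., G n u)\<close>, which removes the
  coupling terms from sums of inner products.\<close>

lemma dual_ok_orthogonal:
  assumes "dual_ok w" "u \<in> H 0"
  shows "(\<Sum>i\<in>{1..n}. G i u \<bullet> w i) = 0"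
  unfolding sum_split_last[OF n_ge_1]
  using assms inner_sum_adj[OF assms(2), of w] by (simp add: dual_ok_def G_last)

text \<open>A member of \<open>kuhn_tucker_set\<close> may carry any value at index
  \<open>n\<close>, hence a separate tuple \<open>w'\<close> that agrees with \<open>w\<close> below
  \<open>n\<close> only.\<close>

lemma kuhn_tucker_iff:
  "(u, w) \<in> kuhn_tucker_set P \<longleftrightarrow>
    u \<in> H 0 \<and> (\<exists>w'. dual_ok w' \<and> (\<forall>i\<in>{1..<n}. w' i = w i) \<and> (\<forall>i\<in>{1..n}. w' i \<in> T i (G i u)))"
proof
  assume kt: "(u, w) \<in> kuhn_tucker_set P"
  define w' where "w' = w(n := - (\<Sum>i\<in>{1..<n}. lin_adj P i (w i)))"
  have eq: "(\<Sum>i\<in>{1..<n}. lin_adj P i (w' i)) = (\<Sum>i\<in>{1..<n}. lin_adj P i (w i))"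
    by (intro sum.cong) (auto simp: w'_def)
  have u: "u \<in> H 0"
    using kt by (simp add: kuhn_tucker_set_def)
  have "dual_ok w'"
    using kt eq by (intro dual_okI) (auto simp: kuhn_tucker_set_def w'_def)
  moreover have "\<forall>i\<in>{1..<n}. w' i = w i"
    by (simp add: w'_def)
  moreover have "w' i \<in> T i (G i u)" if "i \<in> {1..n}" for i
    using kt u that G_last by (cases "i = n") (auto simp: kuhn_tucker_set_def w'_def)
  ultimately show "u \<in> H 0 \<and> (\<exists>w'. dual_ok w' \<and> (\<forall>i\<in>{1..<n}. w' i = w i) \<and>
      (\<forall>i\<in>{1..n}. w' i \<in> T i (G i u)))"
    using u by blast
next
  assume "u \<in> H 0 \<and> (\<exists>w'. dual_ok w' \<and> (\<forall>i\<in>{1..<n}. w' i = w i) \<and>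
      (\<forall>i\<in>{1..n}. w' i \<in> T i (G i u)))"
  then obtain w' where u: "u \<in> H 0" and w': "dual_ok w'" "\<forall>i\<in>{1..<n}. w' i = w i"
    "\<forall>i\<in>{1..n}. w' i \<in> T i (G i u)"
    by blast
  have "w' n \<in> T n u"
    using w'(3)[rule_format, of n] n_ge_1 G_last[OF u] by simp
  moreover have "(\<Sum>i\<in>{1..<n}. lin_adj P i (w' i)) = (\<Sum>i\<in>{1..<n}. lin_adj P i (w i))"
    using w'(2) by (intro sum.cong) auto
  ultimately have "- (\<Sum>i\<in>{1..<n}. lin_adj P i (w i)) \<in> T n u"
    using w'(1) by (simp add: dual_ok_def)
  moreover have "w i \<in> H i \<and> w i \<in> T i (G i u)" if "i \<in> {1..<n}" for i
    using w' that by (metis atLeastLessThan_iff atLeastAtMost_iff dual_ok_mem less_imp_le)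
  ultimately show "(u, w) \<in> kuhn_tucker_set P"
    using u by (simp add: kuhn_tucker_set_def)
qed

end

section \<open>Runs\<close>

locale ps_run_loc = ps_problem_loc P for P :: "'a::real_inner ps_problem" +
  fixes R :: "'a ps_run"
  assumes run: "algorithm_run P R"
begin

abbreviation "z \<equiv> zit R"
abbreviation "w \<equiv> wit R"
abbreviation "x \<equiv> xit R"
abbreviation "y \<equiv> yit R"

lemma params: "parameters_ok P R"
  using run by (simp add: algorithm_run_def)

lemma del_range: "i \<in> {1..n} \<Longrightarrow> k \<ge> 1 \<Longrightarrow> del R i k \<in> {1..k}"
  using params by (simp add: parameters_ok_def)

lemma rho_pos: "i \<in> {1..n} \<Longrightarrow> k \<ge> 1 \<Longrightarrow> rho R i k > 0"
  using params by (simp add: parameters_ok_def)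

lemma Delta_pos: "Delta R > 0" and gamma_pos: "gamma R > 0"
  using params by (auto simp: parameters_ok_def)

lemma blk_subset: "k \<ge> 1 \<Longrightarrow> i \<in> blk R k \<Longrightarrow> i \<in> {1..n}"
  using params unfolding parameters_ok_def by blast

lemma reached_mono: "reached P R k \<Longrightarrow> k' \<le> k \<Longrightarrow> reached P R k'"
  by (auto simp: reached_def)

lemma iteration_reached: "k \<ge> 1 \<Longrightarrow> reached P R k \<Longrightarrow> iteration P R k"
  using run by (simp add: algorithm_run_def)

definition state_ok :: "nat \<Rightarrow> bool" where
  "state_ok k \<longleftrightarrow> z k \<in> H 0 \<and> dual_ok (\<lambda>i. w i k)"

lemma state_ok_del:
  assumes "i \<in> {1..n}" "k \<ge> 1" "\<And>j. j \<in> {1..k} \<Longrightarrow> state_ok j"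
  shows "z (del R i k) \<in> H 0" "w i (del R i k) \<in> H i" "G i (z (del R i k)) \<in> H i"
  using assms(3)[OF del_range[OF assms(1,2)]] assms(1) dual_ok_mem G_in
  by (auto simp: state_ok_def)

subsection \<open>Backtracking\<close>

lemma bt_rho_pos: "i \<in> {1..n} \<Longrightarrow> k \<ge> 1 \<Longrightarrow> bt_rho R i k j > 0"
  using rho_pos[of i "del R i k"] del_range[of i k] by (simp add: bt_rho_def)

lemma bt_x_in:
  assumes "i \<in> fwd P" "G i (z (del R i k)) \<in> H i" "w i (del R i k) \<in> H i"
  shows "bt_x P R i k j \<in> H i"
proof -
  have "subspace (H i)"
    using assms(1) fwd_bwd[of i] subspace_H by simp
  then show ?thesis
    using assms T_fwd(2) unfolding bt_x_def bt_zeta_def bt_theta_def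
    by (intro subspace_diff subspace_scale) auto
qed

text \<open>The step from \<open>\<theta>\<close> to \<open>x\<close> is \<open>r\<close> times
  \<open>\<zeta> - w\<close>, so pairing it with \<open>\<zeta> - w\<close> gives its squared length
  divided by \<open>r\<close>. Replacing \<open>\<zeta>\<close> by \<open>T x\<close> costs at most
  \<open>L\<close> times that squared length, and the test holds once
  \<open>1 / r \<ge> L + Delta\<close>.\<close>

lemma bt_accept_small:
  assumes i: "i \<in> fwd P" and k: "k \<ge> 1"
    and th: "G i (z (del R i k)) \<in> H i" and wd: "w i (del R i k) \<in> H i"
    and small: "bt_rho R i k j * (lip P i + Delta R) \<le> 1"
  shows "bt_accept P R i k j"
proof -
  define r where "r = bt_rho R i k j"
  define L where "L = lip P i"
  let ?th = "bt_theta P R i k" and ?x = "bt_x P R i k j" and ?W = "w i (del R i k)"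
  have r: "r > 0"
    using bt_rho_pos i k fwd_bwd by (simp add: r_def)
  have thH: "?th \<in> H i" and xH: "?x \<in> H i"
    using th bt_x_in[OF i th wd] by (auto simp: bt_theta_def)
  have step: "?th - ?x = r *\<^sub>R (bt_zeta P R i k - ?W)"
    by (simp add: bt_x_def r_def)
  have "r * ((?th - ?x) \<bullet> (bt_zeta P R i k - ?W)) = (norm (?th - ?x))\<^sup>2"
    unfolding power2_norm_eq_inner by (simp add: step)
  moreover have "(?th - ?x) \<bullet> (bt_zeta P R i k - bt_y P R i k j) \<le> L * (norm (?th - ?x))\<^sup>2"
  proof -
    have "(?th - ?x) \<bullet> (bt_zeta P R i k - bt_y P R i k j)
        \<le> norm (?th - ?x) * norm (bt_zeta P R i k - bt_y P R i k j)"
      by (rule norm_cauchy_schwarz)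
    also have "\<dots> \<le> norm (?th - ?x) * (L * norm (?th - ?x))"
      unfolding L_def bt_zeta_def bt_y_def
      by (intro mult_left_mono T_lipschitz i thH xH) simp
    finally show ?thesis
      by (simp add: power2_eq_square mult_ac)
  qed
  then have "r * ((?th - ?x) \<bullet> (bt_zeta P R i k - bt_y P R i k j)) \<le> r * (L * (norm (?th - ?x))\<^sup>2)"
    using r by simp
  moreover have "r * (L + Delta R) * (norm (?th - ?x))\<^sup>2 \<le> 1 * (norm (?th - ?x))\<^sup>2"
    using small by (intro mult_right_mono) (auto simp: r_def L_def)
  ultimately have "r * (Delta R * (norm (?th - ?x))\<^sup>2 - (?th - ?x) \<bullet> (bt_y P R i k j - ?W)) \<le> 0"
    by (simp add: algebra_simps)
  then show ?thesis
    using r by (simp add: bt_accept_def mult_le_0_iff)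
qed

text \<open>Repeated halving reaches the range of \<open>bt_accept_small\<close>. Unless the first
  trial is accepted, the one before the accepted trial was rejected and so lay outside that range;
  the factor 2 in the bound is this last halving.\<close>

lemma bt_terminates:
  assumes i: "i \<in> fwd P" and k: "k \<ge> 1"
    and th: "G i (z (del R i k)) \<in> H i" and wd: "w i (del R i k) \<in> H i"
  shows "bt_stops P R i k" "bt_accept P R i k (bt_index P R i k)"
    "min (rho R i (del R i k)) (1 / (2 * (lip P i + Delta R))) \<le> bt_rho R i k (bt_index P R i k)"
proof -
  let ?c = "lip P i + Delta R"
  have c: "?c > 0"
    using lip_nonneg[OF i] Delta_pos by simp
  obtain m where m: "rho R i (del R i k) * ?c < 2 ^ m"
    using real_arch_pow[of 2] by auto
  \<comment> \<open>Trial \<open>Suc m\<close> uses the initial stepsize divided by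
    \<open>2 ^ m\<close>, because the first trial is not halved.\<close>
  have "bt_accept P R i k (Suc m)"
    using m by (intro bt_accept_small assms) (simp add: bt_rho_def field_simps)
  then show stops: "bt_stops P R i k"
    unfolding bt_stops_def by (intro exI[of _ "Suc m"]) simp
  let ?j = "bt_index P R i k"
  have j: "?j \<ge> 1 \<and> bt_accept P R i k ?j"
    using stops unfolding bt_stops_def bt_index_def by (rule LeastI_ex)
  then show "bt_accept P R i k ?j"
    by blast
  show "min (rho R i (del R i k)) (1 / (2 * ?c)) \<le> bt_rho R i k ?j"
  proof (cases "?j = 1")
    case True
    then show ?thesis
      by (simp add: bt_rho_def)
  next
    case False
    with j have j2: "?j - 1 \<ge> 1"
      by linarith
    have "\<not> (?j - 1 \<ge> 1 \<and> bt_accept P R i k (?j - 1))"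
      using j unfolding bt_index_def by (intro not_less_Least) (simp add: bt_index_def)
    with j2 have "\<not> bt_rho R i k (?j - 1) * ?c \<le> 1"
      using bt_accept_small[OF assms] by blast
    moreover have "bt_rho R i k (?j - 1) = 2 * bt_rho R i k ?j"
    proof -
      obtain l where "?j = Suc (Suc l)"
        using j2 by (metis Suc_diff_1 Suc_le_D diff_Suc_1 j less_eq_Suc_le One_nat_def)
      then show ?thesis
        by (simp add: bt_rho_def)
    qed
    ultimately have "1 / (2 * ?c) < bt_rho R i k ?j"
      using c by (simp add: field_simps)
    then show ?thesis
      by simp
  qed
qed

subsection \<open>Invariants\<close>

text \<open>An infinite line search would leave \<open>x\<close> and \<open>y\<close> unconstrained,
  hence the appeal to its termination. In a backward step \<open>y\<close> is by construction the
  element that \<open>prox_mem\<close> places in the graph.\<close>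

lemma processed_graph:
  assumes k: "k \<ge> 1" "reached P R k" and ok: "\<And>j. j \<in> {1..k} \<Longrightarrow> state_ok j" and i: "i \<in> blk R k"
  shows "x i k \<in> H i" "y i k \<in> T i (x i k)"
proof -
  have i1: "i \<in> {1..n}"
    using blk_subset k(1) i by blast
  note del = state_ok_del[OF i1 k(1) ok]
  have it: "iteration P R k"
    using iteration_reached k by blast
  have "x i k \<in> H i \<and> y i k \<in> T i (x i k)"
  proof (cases "i \<in> fwd P")
    case True
    have "x i k = bt_x P R i k (bt_index P R i k)" "y i k = bt_y P R i k (bt_index P R i k)"
      using it i True bt_terminates(1)[OF True k(1) del(3,2)]
      by (auto simp: iteration_def forward_step_def)
    then show ?thesis
      using bt_x_in[OF True del(3,2)] T_fwd(1)[OF True] by (auto simp: bt_y_def)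
  next
    case False
    then have bwd: "i \<in> bwd P"
      using i1 fwd_bwd by blast
    let ?r = "rho R i (del R i k)"
    let ?a = "G i (z (del R i k)) + ?r *\<^sub>R w i (del R i k) + err R i k"
    have xy: "x i k = prox (H i) ?r (T i) ?a" "y i k = inverse ?r *\<^sub>R (?a - x i k)"
      using it i bwd by (auto simp: iteration_def backward_step_def Let_def)
    have "err R i k \<in> H i"
      using params bwd k(1) by (simp add: parameters_ok_def)
    then have "?a \<in> H i"
      using del subspace_H i1 by (intro subspace_add subspace_scale) auto
    moreover have "maximal_monotone_op (H i) (T i)"
      using problem bwd by (simp add: problem_assumptions_def)
    ultimately show ?thesis
      using prox_mem[of "H i" "T i" ?r ?a] hilbert_H i1 rho_pos[OF i1] del_range[OF i1 k(1)]
      unfolding xy(2) unfolding xy(1) by simp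
  qed
  then show "x i k \<in> H i" "y i k \<in> T i (x i k)"
    by auto
qed

text \<open>Membership of the states is a hypothesis here because this lemma is used inside the
  induction that establishes it.\<close>

lemma xy_in:
  assumes "reached P R k" "\<And>j. j \<in> {1..k} \<Longrightarrow> state_ok j" "i \<in> {1..n}"
  shows "x i k \<in> H i \<and> y i k \<in> H i"
  using assms
proof (induction k)
  case 0
  then show ?case
    using run by (simp add: algorithm_run_def initial_ok_def)
next
  case (Suc k)
  show ?case
  proof (cases "i \<in> blk R (Suc k)")
    case True
    then show ?thesis
      using processed_graph[OF _ Suc.prems(1,2) True] T_subset Suc.prems(3) by auto
  next
    case False
    have "x i k \<in> H i \<and> y i k \<in> H i"
      using Suc.prems reached_mono by (intro Suc.IH) auto
    moreover have "x i (Suc k) = x i k \<and> y i (Suc k) = y i k"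
      using iteration_reached[OF _ Suc.prems(1)] False Suc.prems(3) by (auto simp: iteration_def)
    ultimately show ?thesis
      by simp
  qed
qed

lemma u_v_in:
  assumes "\<And>i. i \<in> {1..n} \<Longrightarrow> x i k \<in> H i \<and> y i k \<in> H i"
  shows "i \<in> {1..<n} \<Longrightarrow> u_vec P R i k \<in> H i" "v_vec P R k \<in> H 0"
proof -
  have xn: "x n k \<in> H 0" "y n k \<in> H 0"
    using assms[of n] n_ge_1 H_last by auto
  show "u_vec P R i k \<in> H i" if "i \<in> {1..<n}"
    unfolding u_vec_def using that assms[of i] subspace_H[of i] G_in[of i, OF _ xn(1)]
    by (auto simp: subspace_diff)
  show "v_vec P R k \<in> H 0"
    unfolding v_vec_def using sum_adj_in xn(2) subspace_H[of 0] by (simp add: subspace_add)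
qed

text \<open>The induction is strong because a step may draw on delayed points of any earlier
  iteration.\<close>

lemma state_ok_reached: "k \<ge> 1 \<Longrightarrow> reached P R k \<Longrightarrow> state_ok k"
proof (induction k rule: less_induct)
  case (less k)
  show ?case
  proof (cases "k = 1")
    case True
    have "z 1 \<in> H 0" "dual_ok (\<lambda>i. w i 1)"
      using run by (auto simp: algorithm_run_def initial_ok_def intro!: dual_okI)
    then show ?thesis
      by (simp add: state_ok_def True)
  next
    case False
    with less.prems obtain m where m: "k = Suc m" "m \<ge> 1"
      by (metis One_nat_def Suc_le_D Suc_le_mono le0 le_SucE nat.inject not_less_eq_eq)
    have rm: "reached P R m"
      using less.prems m reached_mono by auto
    have ok: "state_ok j" if "j \<in> {1..m}" for j
      using less.IH[of j] that m rm reached_mono by auto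
    \<comment> \<open>Being reached at \<open>Suc m\<close> records that iteration \<open>m\<close>
      finished without returning, so that it performed an update.\<close>
    have "searches_stop P R m" "\<not> return_test P R m"
      using less.prems m by (auto simp: reached_def)
    then have upd: "update_step P R m"
      using iteration_reached[OF m(2) rm] by (simp add: iteration_def)
    note uv = u_v_in[OF xy_in[OF rm ok]]
    have okm: "z m \<in> H 0" "dual_ok (\<lambda>i. w i m)"
      using ok[of m] m(2) by (auto simp: state_ok_def)
    have "z k \<in> H 0"
      using upd okm uv(2) subspace_H[of 0] by (simp add: update_step_def m subspace_diff subspace_scale)
    moreover have "dual_ok (\<lambda>i. w i k)"
    proof (rule dual_okI)
      show "w i k \<in> H i" if "i \<in> {1..<n}" for i
        using upd dual_ok_mem[OF okm(2), of i] uv(1)[OF _ _ that] that subspace_H[of i]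
        by (simp add: update_step_def m subspace_diff subspace_scale)
      show "w n k = - (\<Sum>i = 1..<n. lin_adj P i (w i k))"
        using upd by (simp add: update_step_def m)
    qed
    ultimately show ?thesis
      by (simp add: state_ok_def)
  qed
qed

lemma state_ok_upto: "reached P R k \<Longrightarrow> j \<in> {1..k} \<Longrightarrow> state_ok j"
  using state_ok_reached reached_mono by auto

lemma searches_stop_reached: "k \<ge> 1 \<Longrightarrow> reached P R k \<Longrightarrow> searches_stop P R k"
  unfolding searches_stop_def
proof
  fix i
  assume k: "k \<ge> 1" "reached P R k" and i: "i \<in> blk R k \<inter> fwd P"
  then have "i \<in> {1..n}"
    using blk_subset by blast
  note del = state_ok_del[OF this k(1) state_ok_upto[OF k(2)]]
  show "bt_stops P R i k"
    using i k(1) by (intro bt_terminates(1) del) auto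
qed

lemma reached_Suc:
  assumes "k \<ge> 1" "reached P R k" "\<not> return_test P R k"
  shows "reached P R (Suc k)"
  unfolding reached_def
proof
  fix j
  assume "j \<in> {1..<Suc k}"
  then consider "j \<in> {1..<k}" | "j = k"
    by force
  then show "searches_stop P R j \<and> \<not> return_test P R j"
  proof cases
    case 1
    then show ?thesis
      using assms(2) unfolding reached_def by blast
  next
    case 2
    then show ?thesis
      using searches_stop_reached[OF assms(1,2)] assms(3) by simp
  qed
qed

subsection \<open>Most recent processing\<close>

lemma last_processed_Suc:
  "last_processed R i (Suc k) = (if i \<in> blk R (Suc k) then Suc k else last_processed R i k)"
proof -
  have "{j \<in> {1..Suc k}. i \<in> blk R j} =
      (if i \<in> blk R (Suc k) then insert (Suc k) {j \<in> {1..k}. i \<in> blk R j} else {j \<in> {1..k}. i \<in> blk R j})"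
    by (auto simp: le_Suc_eq)
  moreover have "Max (insert 0 (insert (Suc k) {j \<in> {1..k}. i \<in> blk R j})) = Suc k"
    by (rule Max_eqI) auto
  ultimately show ?thesis
    by (simp add: last_processed_def)
qed

lemma last_processed_mem:
  "last_processed R i k \<ge> 1 \<Longrightarrow> i \<in> blk R (last_processed R i k)"
  "last_processed R i k \<le> k"
proof -
  let ?A = "{j \<in> {1..k}. i \<in> blk R j}"
  have "last_processed R i k \<in> insert 0 ?A"
    unfolding last_processed_def by (rule Max_in) auto
  then show "last_processed R i k \<ge> 1 \<Longrightarrow> i \<in> blk R (last_processed R i k)"
    "last_processed R i k \<le> k"
    by auto
qed

lemma last_processed_ge: "j \<in> {1..k} \<Longrightarrow> i \<in> blk R j \<Longrightarrow> j \<le> last_processed R i k"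
  unfolding last_processed_def by (rule Max_ge) auto

lemma xy_last_processed:
  "reached P R k \<Longrightarrow> i \<in> {1..n} \<Longrightarrow>
    x i k = x i (last_processed R i k) \<and> y i k = y i (last_processed R i k)"
proof (induction k)
  case 0
  have "last_processed R i 0 = 0"
    using last_processed_mem(2)[of i 0] by simp
  then show ?case
    by simp
next
  case (Suc k)
  then show ?case
    using reached_mono[OF Suc.prems(1), of k] iteration_reached[OF _ Suc.prems(1)]
    by (auto simp: last_processed_Suc iteration_def)
qed

lemma graph_reached:
  assumes "reached P R k" "i \<in> {1..n}" "last_processed R i k \<ge> 1"
  shows "x i k \<in> H i" "y i k \<in> H i" "y i k \<in> T i (x i k)"
proof -
  let ?s = "last_processed R i k"
  have "reached P R ?s"
    using assms(1) last_processed_mem(2) reached_mono by blast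
  then show "x i k \<in> H i" "y i k \<in> T i (x i k)"
    using processed_graph[OF assms(3) _ state_ok_upto last_processed_mem(1)[OF assms(3)]]
      xy_last_processed[OF assms(1,2)] by auto
  then show "y i k \<in> H i"
    using T_subset assms(2) by blast
qed

text \<open>The return test guarantees that every index was processed, so all pairs are graph
  points. A vanishing \<open>pi_val\<close> then says that each \<open>x i k\<close> is the image of
  the one primal point \<open>x n k\<close> and that the \<open>y i k\<close> form a dual
  tuple.\<close>

lemma returns_in_kuhn_tucker:
  assumes "returns_at P R k"
  shows "(z (Suc k), \<lambda>i. w i (Suc k)) \<in> kuhn_tucker_set P"
proof -
  have k: "k \<ge> 1" "reached P R k" "searches_stop P R k" and ret: "return_test P R k"
    using assms by (auto simp: returns_at_def)
  have "return_step P R k"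
    using iteration_reached[OF k(1,2)] k(3) ret by (simp add: iteration_def)
  then have zk: "z (Suc k) = x n k" and wk: "\<And>i. i \<in> {1..<n} \<Longrightarrow> w i (Suc k) = y i k"
    by (auto simp: return_step_def)
  have proc: "last_processed R i k \<ge> 1" if i: "i \<in> {1..n}" for i
  proof -
    have "i \<in> (\<Union>j\<in>{1..k}. blk R j)"
      using i ret by (simp add: return_test_def)
    then show ?thesis
      using last_processed_ge by fastforce
  qed
  note gr = graph_reached[OF k(2) _ proc]
  have xn: "x n k \<in> H 0"
    using gr(1)[of n] n_ge_1 H_last by simp
  have "(\<Sum>i\<in>{1..<n}. (norm (u_vec P R i k))\<^sup>2) + inverse (gamma R) * (norm (v_vec P R k))\<^sup>2 = 0"
    using ret by (simp add: return_test_def pi_val_def)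
  moreover have "0 \<le> (\<Sum>i\<in>{1..<n}. (norm (u_vec P R i k))\<^sup>2)"
    "0 \<le> inverse (gamma R) * (norm (v_vec P R k))\<^sup>2"
    using gamma_pos by (auto intro: sum_nonneg)
  ultimately have "(\<Sum>i\<in>{1..<n}. (norm (u_vec P R i k))\<^sup>2) = 0"
    "inverse (gamma R) * (norm (v_vec P R k))\<^sup>2 = 0"
    by linarith+
  then have u: "\<And>i. i \<in> {1..<n} \<Longrightarrow> u_vec P R i k = 0" and v: "v_vec P R k = 0"
    using gamma_pos by (auto simp: sum_nonneg_eq_0_iff)
  have xi: "x i k = G i (x n k)" if "i \<in> {1..n}" for i
    using u[of i] that G_last[OF xn] by (cases "i = n") (auto simp: u_vec_def)
  have "y n k = - (\<Sum>i\<in>{1..<n}. lin_adj P i (y i k))"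
    using v by (simp add: v_vec_def eq_neg_iff_add_eq_0 add.commute)
  then have "dual_ok (\<lambda>i. y i k)"
    using gr(2) by (intro dual_okI) auto
  then show ?thesis
    unfolding kuhn_tucker_iff zk
  proof (intro conjI exI[of _ "\<lambda>i. y i k"] ballI)
    show "y i k = w i (Suc k)" if "i \<in> {1..<n}" for i
      using wk[OF that] by simp
    show "y i k \<in> T i (G i (x n k))" if "i \<in> {1..n}" for i
      using gr(3)[OF that that] xi[OF that] by simp
  qed (use xn in auto)
qed

end

section \<open>Convergence\<close>

lemma sum_split_first:
  fixes f :: "nat \<Rightarrow> 'a::comm_monoid_add"
  assumes "n \<ge> 1"
  shows "sum f {..<n} = f 0 + sum f {1..<n}"
proof -
  have "{..<n} = insert 0 {1..<n}"
    using assms by auto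
  then show ?thesis
    by simp
qed

lemma eventually_le_sequentially:
  assumes "F \<le> sequentially" "\<And>k. k \<ge> N \<Longrightarrow> Q k"
  shows "eventually Q F"
  using assms eventually_sequentially[of Q] by (blast intro: filter_leD)

lemma tendsto_inner_bounded_0:
  fixes f g :: "'b \<Rightarrow> 'a::real_inner"
  assumes f: "(f \<longlongrightarrow> 0) F" and g: "eventually (\<lambda>k. norm (g k) \<le> C) F"
  shows "((\<lambda>k. f k \<bullet> g k) \<longlongrightarrow> 0) F"
proof (rule Lim_null_comparison)
  show "eventually (\<lambda>k. norm (f k \<bullet> g k) \<le> norm (f k) * C) F"
    using g
  proof eventually_elim
    case (elim k)
    show ?case
      using Cauchy_Schwarz_ineq2[of "f k" "g k"] mult_left_mono[OF elim norm_ge_zero[of "f k"]]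
      by simp
  qed
  show "((\<lambda>k. norm (f k) * C) \<longlongrightarrow> 0) F"
    using tendsto_mult_left_zero[OF tendsto_norm_zero[OF f]] .
qed

lemma tendsto_0_of_sqnorm:
  fixes f :: "'b \<Rightarrow> 'a::real_normed_vector"
  assumes "((\<lambda>k. (norm (f k))\<^sup>2) \<longlongrightarrow> 0) F"
  shows "(f \<longlongrightarrow> 0) F"
proof -
  have "((\<lambda>k. sqrt ((norm (f k))\<^sup>2)) \<longlongrightarrow> sqrt 0) F"
    using assms by (rule tendsto_real_sqrt)
  then show ?thesis
    by (simp add: tendsto_norm_zero_iff)
qed

text \<open>A delay of at most \<open>N\<close> is a sum of at most \<open>N\<close> consecutive
  steps, each of which vanishes; the induction on \<open>N\<close> spends half of \<open>e\<close>
  on the last of them.\<close>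

lemma tendsto_delay_diff_0:
  fixes f :: "nat \<Rightarrow> 'a::real_normed_vector"
  assumes f: "(\<lambda>k. f (Suc k) - f k) \<longlonglongrightarrow> 0"
    and d: "\<forall>\<^sub>F k in sequentially. d k \<le> k \<and> k \<le> d k + N"
  shows "(\<lambda>k. f k - f (d k)) \<longlonglongrightarrow> 0"
proof -
  have "\<exists>K. \<forall>k\<ge>K. \<forall>m\<le>N. norm (f (k + m) - f k) < e" if "e > 0" for e
    using that
  proof (induction N arbitrary: e)
    case 0
    then show ?case
      by simp
  next
    case (Suc N)
    obtain K1 where K1: "\<And>k m. k \<ge> K1 \<Longrightarrow> m \<le> N \<Longrightarrow> norm (f (k + m) - f k) < e / 2"
      using Suc.IH[of "e / 2"] Suc.prems by auto
    obtain K2 where K2: "\<And>k. k \<ge> K2 \<Longrightarrow> norm (f (Suc k) - f k) < e / 2"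
      using LIMSEQ_D[OF f, of "e / 2"] Suc.prems by auto
    have "norm (f (k + m) - f k) < e" if "k \<ge> max K1 K2" "m \<le> Suc N" for k m
    proof (cases m)
      case 0
      then show ?thesis
        using Suc.prems by simp
    next
      case (Suc m')
      have "norm (f (k + m') - f k) < e / 2"
        using that Suc by (intro K1) auto
      moreover have "norm (f (Suc (k + m')) - f (k + m')) < e / 2"
        using that by (intro K2) auto
      moreover have "f (k + m) - f k = (f (Suc (k + m')) - f (k + m')) + (f (k + m') - f k)"
        using Suc by simp
      ultimately show ?thesis
        by (smt (verit) field_sum_of_halves norm_triangle_ineq)
    qed
    then show ?case
      by blast
  qed
  note near = this
  show ?thesis
  proof (rule LIMSEQ_I)
    fix e :: real
    assume "e > 0"
    then obtain K where K: "\<And>k m. k \<ge> K \<Longrightarrow> m \<le> N \<Longrightarrow> norm (f (k + m) - f k) < e"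
      using near by blast
    obtain K' where K': "\<And>k. k \<ge> K' \<Longrightarrow> d k \<le> k \<and> k \<le> d k + N"
      using d unfolding eventually_sequentially by blast
    have "norm (f k - f (d k) - 0) < e" if "k \<ge> K' + K + N" for k
      using K'[of k] K[of "d k" "k - d k"] that by auto
    then show "\<exists>no. \<forall>k\<ge>no. norm (f k - f (d k) - 0) < e"
      by blast
  qed
qed

text \<open>
  Coercivity bounds the residuals \<open>a\<close>, \<open>b\<close> below; monotonicity against a fixed solution lets their
  inner product grow at most linearly.
\<close>

lemma coercive_monotone_bound:
  fixes a b r s :: "'a::real_inner"
  assumes c: "c > 0" "a \<bullet> b \<ge> c * (norm a)\<^sup>2" "a \<bullet> b \<ge> c * (norm b)\<^sup>2"
    and mono: "(r - a) \<bullet> (s + b) \<ge> 0"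
    and K: "norm r \<le> K" "norm s \<le> K"
  shows "norm a \<le> K + 3 * K / c" "norm b \<le> K + 3 * K / c"
proof -
  have K0: "K \<ge> 0"
    using K(1) norm_ge_zero order_trans by blast
  have "a \<bullet> b \<le> r \<bullet> s + r \<bullet> b - a \<bullet> s"
    using mono by (simp add: algebra_simps)
  also have "\<dots> \<le> norm r * norm s + norm r * norm b + norm a * norm s"
    using norm_cauchy_schwarz[of r s] norm_cauchy_schwarz[of r b] Cauchy_Schwarz_ineq2[of a s]
    by linarith
  also have "\<dots> \<le> K * K + K * norm b + norm a * K"
    using K K0 by (intro add_mono mult_mono) auto
  finally have ub: "a \<bullet> b \<le> K * K + K * norm b + norm a * K" .
  define m where "m = max (norm a) (norm b)"
  have m: "norm a \<le> m" "norm b \<le> m" "m \<ge> 0"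
    by (auto simp: m_def le_max_iff_disj)
  have "c * m\<^sup>2 \<le> a \<bullet> b"
    using c(2,3) by (auto simp: m_def max_def)
  also have "\<dots> \<le> K * K + K * m + m * K"
    using ub m K0 by (smt (verit) mult_left_mono mult_right_mono)
  finally have cm: "c * m\<^sup>2 \<le> K * K + 2 * K * m"
    by simp
  \<comment> \<open>For \<open>m > K\<close> the constant term \<open>K * K\<close> is at most
    \<open>K * m\<close>; together with \<open>2 * K * m\<close> this gives the 3, and one factor
    \<open>m\<close> cancels.\<close>
  have "m \<le> K + 3 * K / c"
  proof (cases "m \<le> K")
    case True
    then show ?thesis
      using K0 c(1) by (simp add: add_increasing2)
  next
    case False
    then have "K * K \<le> K * m"
      using K0 by (intro mult_left_mono) auto
    with cm have "m * (c * m) \<le> m * (3 * K)"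
      by (simp add: power2_eq_square algebra_simps)
    moreover have "m > 0"
      using False K0 by linarith
    ultimately have "c * m \<le> 3 * K"
      by simp
    then have "m \<le> 3 * K / c"
      using c(1) by (simp add: field_simps)
    then show ?thesis
      using K0 by linarith
  qed
  then show "norm a \<le> K + 3 * K / c" "norm b \<le> K + 3 * K / c"
    using m by linarith+
qed

text \<open>The witnesses of the existential assumptions are fixed once. The assumption
  \<open>no_return\<close> selects the second alternative of the theorem; as line searches stop, all
  iterations are then reached.\<close>

locale ps_conv_loc = ps_run_loc P R for P :: "'a::real_inner ps_problem" and R +
  fixes M Dl :: nat and \<sigma> :: real
  assumes M: "M \<ge> 1" "\<And>j. j \<ge> 1 \<Longrightarrow> (\<Union>k\<in>{j..j + M - 1}. blk R k) = {1..n}"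
    and Dl: "\<And>k i. k \<ge> 1 \<Longrightarrow> i \<in> blk R k \<Longrightarrow> k - del R i k \<le> Dl"
    and \<sigma>: "\<sigma> < 1"
    and err: "\<And>i k. i \<in> bwd P \<Longrightarrow> k \<ge> 1 \<Longrightarrow> reached P R k \<Longrightarrow> last_processed R i k \<ge> 1 \<Longrightarrow>
       (let l = last_info R i k; e = err R i (last_processed R i k) in
          (G i (z l) - x i k) \<bullet> e \<ge> - \<sigma> * (norm (G i (z l) - x i k))\<^sup>2 \<and>
          e \<bullet> (y i k - w i l) \<le> rho R i l * \<sigma> * (norm (y i k - w i l))\<^sup>2)"
    and stepsizes: "stepsize_assumptions P R"
    and no_return: "\<And>k. \<not> returns_at P R k"
begin

lemma all_reached: "reached P R k"
proof (induction k)
  case 0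
  show ?case
    by (simp add: reached_def)
next
  case (Suc k)
  show ?case
  proof (cases "k \<ge> 1")
    case True
    then have "\<not> return_test P R k"
      using no_return[of k] Suc searches_stop_reached by (auto simp: returns_at_def)
    then show ?thesis
      using reached_Suc True Suc by blast
  next
    case False
    then show ?thesis
      by (simp add: reached_def)
  qed
qed

lemma states: "k \<ge> 1 \<Longrightarrow> z k \<in> H 0" "k \<ge> 1 \<Longrightarrow> dual_ok (\<lambda>i. w i k)"
  using state_ok_reached all_reached by (auto simp: state_ok_def)

lemma delayed_in:
  assumes "i \<in> {1..n}" "k \<ge> 1"
  shows "G i (z (del R i k)) \<in> H i" "w i (del R i k) \<in> H i"
  using state_ok_del(2,3)[OF assms state_ok_upto[OF all_reached[of k]]] by auto

lemma last_processed_recent: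
  assumes "k \<ge> M" "i \<in> {1..n}"
  shows "last_processed R i k \<ge> 1" "k < last_processed R i k + M"
proof -
  \<comment> \<open>The window of \<open>M\<close> consecutive iterations that ends exactly at
    \<open>k\<close>.\<close>
  define j where "j = k + 1 - M"
  have "j \<ge> 1"
    using assms(1) by (simp add: j_def)
  then have "i \<in> (\<Union>m\<in>{j..j + M - 1}. blk R m)"
    using M(2)[of j] assms(2) by simp
  then obtain m where m: "m \<ge> j" "m \<le> k" "i \<in> blk R m"
    using assms(1) by (auto simp: j_def)
  have "m \<le> last_processed R i k"
    using m \<open>j \<ge> 1\<close> by (intro last_processed_ge) auto
  then show "last_processed R i k \<ge> 1" "k < last_processed R i k + M"
    using m(1) \<open>j \<ge> 1\<close> assms(1) by (auto simp: j_def)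
qed

lemma graph:
  assumes "k \<ge> M" "i \<in> {1..n}"
  shows "x i k \<in> H i" "y i k \<in> H i" "y i k \<in> T i (x i k)"
  using graph_reached[OF all_reached assms(2) last_processed_recent(1)[OF assms]] .

text \<open>The age of the information in use is the time since the last processing plus the delay
  at that processing.\<close>

lemma last_info_recent:
  assumes "k \<ge> M" "i \<in> {1..n}"
  shows "last_info R i k \<ge> 1" "last_info R i k \<le> k" "k \<le> last_info R i k + (M + Dl)"
proof -
  let ?s = "last_processed R i k"
  note s = last_processed_recent[OF assms]
  have sk: "?s \<le> k"
    by (rule last_processed_mem(2))
  have l: "last_info R i k = del R i ?s"
    using s by (simp add: last_info_def)
  have "del R i ?s \<in> {1..?s}"
    using del_range assms(2) s(1) .
  moreover have "?s - del R i ?s \<le> Dl"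
    using Dl s(1) last_processed_mem(1)[OF s(1)] .
  ultimately show "last_info R i k \<ge> 1" "last_info R i k \<le> k" "k \<le> last_info R i k + (M + Dl)"
    using s sk by (auto simp: l)
qed

subsection \<open>Coercivity of the residuals\<close>

lemma rho_upper: "i \<in> {1..n} \<Longrightarrow> \<exists>h>0. \<forall>k\<ge>1. rho R i k \<le> h"
proof -
  assume i: "i \<in> {1..n}"
  then obtain h where h: "\<And>k. k \<ge> 1 \<Longrightarrow> rho R i k \<le> h"
    using stepsizes unfolding stepsize_assumptions_def bdd_above_def by (meson atLeast_iff imageI)
  moreover have "h > 0"
    using h[of 1] rho_pos[OF i, of 1] by simp
  ultimately show ?thesis
    by blast
qed

lemma rho_INF_lower:
  assumes "i \<in> {1..n}" "(INF k\<in>{1..}. rho R i k) > 0" "k \<ge> 1"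
  shows "(INF k\<in>{1..}. rho R i k) \<le> rho R i k"
proof (rule cINF_lower)
  show "bdd_below (rho R i ` {1..})"
    using rho_pos[OF assms(1)] by (auto simp: bdd_below_def intro!: exI[of _ 0] less_imp_le)
qed (use assms in auto)

lemma rho_bwd_lower: "i \<in> bwd P \<Longrightarrow> \<exists>r>0. \<forall>k\<ge>1. r \<le> rho R i k"
  using stepsizes rho_INF_lower fwd_bwd[of i] unfolding stepsize_assumptions_def by blast

text \<open>A search either keeps its trial stepsize or ends above \<open>?b\<close>. Under the
  initialization rule trials do not start below what was used before, so halvings cannot accumulate
  over the iterations.\<close>

lemma rho_hat_lower:
  assumes i: "i \<in> fwd P"
  shows "\<exists>r>0. \<forall>k\<ge>1. i \<in> blk R k \<longrightarrow> r \<le> bt_rho R i k (bt_index P R i k)"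
proof -
  let ?b = "1 / (2 * (lip P i + Delta R))"
  have i1: "i \<in> {1..n}"
    using i fwd_bwd by blast
  have b: "?b > 0"
    using lip_nonneg[OF i] Delta_pos by simp
  have bt: "min (rho R i (del R i k)) ?b \<le> bt_rho R i k (bt_index P R i k)" if k: "k \<ge> 1" for k
    by (intro bt_terminates(3) i k delayed_in i1)
  from stepsizes consider
    (inf) "(INF k\<in>{1..}. rho R i k) > 0"
    | (init) "\<And>k. k \<ge> 2 \<Longrightarrow> rho R i (del R i k) \<ge> rho_hat P R i (k - 1)"
    using i i1 all_reached unfolding stepsize_assumptions_def by blast
  then show ?thesis
  proof cases
    case inf
    let ?r = "min (INF k\<in>{1..}. rho R i k) ?b"
    have "?r \<le> bt_rho R i k (bt_index P R i k)" if k: "k \<ge> 1" for k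
      using bt[OF k] rho_INF_lower[OF i1 inf, of "del R i k"] del_range[OF i1 k] by auto
    then show ?thesis
      using inf b by (intro exI[of _ ?r]) auto
  next
    case init
    let ?r = "min (rho R i (del R i 1)) ?b"
    \<comment> \<open>Both bounds are carried along: the stepsize used at \<open>k\<close>, which is
      the trial stepsize itself if \<open>i\<close> is not processed, bounds the next trial.\<close>
    have "?r \<le> rho R i (del R i k) \<and> ?r \<le> rho_hat P R i k" if "k \<ge> 1" for k
      using that
    proof (induction k rule: dec_induct)
      case base
      show ?case
        using bt[of 1] by (auto simp: rho_hat_def)
    next
      case (step k)
      have "?r \<le> rho R i (del R i (Suc k))"
        using init[of "Suc k"] step by simp
      then show ?case
        using bt[of "Suc k"] by (auto simp: rho_hat_def)
    qed
    then have "\<forall>k\<ge>1. i \<in> blk R k \<longrightarrow> ?r \<le> bt_rho R i k (bt_index P R i k)"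
      unfolding rho_hat_def by presburger
    moreover have "?r > 0"
      using b rho_pos[OF i1] del_range[OF i1, of 1] by simp
    ultimately show ?thesis
      by blast
  qed
qed

text \<open>Here and in \<open>resy\<close> the reference is the delayed point from which
  \<open>x i k\<close> and \<open>y i k\<close> were actually computed.\<close>

definition resx :: "nat \<Rightarrow> nat \<Rightarrow> 'a" where
  "resx i k = G i (z (last_info R i k)) - x i k"

definition resy :: "nat \<Rightarrow> nat \<Rightarrow> 'a" where
  "resy i k = y i k - w i (last_info R i k)"

text \<open>The resolvent equation reads \<open>\<rho> resy = resx + e\<close>. Eliminating
  \<open>resy\<close> from the product calls for the first error tolerance and eliminating
  \<open>resx\<close> for the second; either leaves a factor \<open>1 - \<sigma>\<close>.\<close>

lemma coercive_bwd:
  assumes i: "i \<in> bwd P"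
  shows "\<exists>c>0. \<forall>k\<ge>M. resx i k \<bullet> resy i k \<ge> c * (norm (resx i k))\<^sup>2 \<and>
    resx i k \<bullet> resy i k \<ge> c * (norm (resy i k))\<^sup>2"
proof -
  have i1: "i \<in> {1..n}"
    using i fwd_bwd by blast
  obtain lo hi where lo: "lo > 0" "\<And>k. k \<ge> 1 \<Longrightarrow> lo \<le> rho R i k"
    and hi: "hi > 0" "\<And>k. k \<ge> 1 \<Longrightarrow> rho R i k \<le> hi"
    using rho_upper[OF i1] rho_bwd_lower[OF i] by metis
  \<comment> \<open>\<open>1 / hi\<close> serves the bound by \<open>resx\<close>, and
    \<open>lo\<close> the bound by \<open>resy\<close>.\<close>
  define c where "c = (1 - \<sigma>) * min (1 / hi) lo"
  have "c > 0"
    using \<sigma> lo hi by (simp add: c_def)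
  have "resx i k \<bullet> resy i k \<ge> c * (norm (resx i k))\<^sup>2 \<and>
    resx i k \<bullet> resy i k \<ge> c * (norm (resy i k))\<^sup>2" if k: "k \<ge> M" for k
  proof -
    let ?s = "last_processed R i k" and ?l = "last_info R i k"
    let ?A = "resx i k" and ?B = "resy i k" and ?e = "err R i ?s" and ?r = "rho R i ?l"
    note s = last_processed_recent[OF k i1]
    have l: "?l = del R i ?s"
      using s by (simp add: last_info_def)
    have r: "?r \<ge> lo" "?r \<le> hi" "?r > 0"
      using lo hi last_info_recent(1)[OF k i1] rho_pos[OF i1] by auto
    have "backward_step P R i ?s"
      using iteration_reached[OF s(1) all_reached] last_processed_mem(1)[OF s(1)] i
      by (auto simp: iteration_def)
    then have "y i ?s = inverse ?r *\<^sub>R (G i (z ?l) + ?r *\<^sub>R w i ?l + ?e - x i ?s)"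
      by (simp add: backward_step_def Let_def l)
    then have "?r *\<^sub>R y i k = G i (z ?l) + ?r *\<^sub>R w i ?l + ?e - x i k"
      using r xy_last_processed[OF all_reached i1, of k] by simp
    then have rB: "?r *\<^sub>R ?B = ?A + ?e"
      by (simp add: resx_def resy_def algebra_simps)
    have e: "?A \<bullet> ?e \<ge> - \<sigma> * (norm ?A)\<^sup>2" "?e \<bullet> ?B \<le> ?r * \<sigma> * (norm ?B)\<^sup>2"
      using err[OF i _ all_reached s(1)] k M(1) by (auto simp: Let_def resx_def resy_def)
    have "?r * (?A \<bullet> ?B) = ?A \<bullet> (?r *\<^sub>R ?B)"
      by simp
    also have "\<dots> = (norm ?A)\<^sup>2 + ?A \<bullet> ?e"
      unfolding rB by (simp add: inner_add_right power2_norm_eq_inner)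
    finally have 1: "?r * (?A \<bullet> ?B) \<ge> (1 - \<sigma>) * (norm ?A)\<^sup>2"
      using e(1) by (simp add: algebra_simps)
    \<comment> \<open>The sign is what allows \<open>?r\<close> to be enlarged to \<open>hi\<close>
      in the estimate just obtained.\<close>
    then have "?A \<bullet> ?B \<ge> 0"
      using r(3) \<sigma> by (smt (verit) mult_nonneg_nonneg mult_pos_neg zero_le_power2)
    then have "hi * (?A \<bullet> ?B) \<ge> (1 - \<sigma>) * (norm ?A)\<^sup>2"
      using 1 r(2) by (meson mult_right_mono order_trans)
    then have "?A \<bullet> ?B \<ge> ((1 - \<sigma>) * (1 / hi)) * (norm ?A)\<^sup>2"
      using hi(1) by (simp add: field_simps)
    moreover have "c * (norm ?A)\<^sup>2 \<le> ((1 - \<sigma>) * (1 / hi)) * (norm ?A)\<^sup>2"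
      unfolding c_def using \<sigma> by (intro mult_right_mono mult_left_mono) auto
    moreover have "?A \<bullet> ?B \<ge> (1 - \<sigma>) * ?r * (norm ?B)\<^sup>2"
    proof -
      have "?A = ?r *\<^sub>R ?B - ?e"
        using rB by simp
      then have "?A \<bullet> ?B = ?r * (norm ?B)\<^sup>2 - ?e \<bullet> ?B"
        by (simp add: inner_diff_left power2_norm_eq_inner)
      then show ?thesis
        using e(2) by (simp add: algebra_simps)
    qed
    moreover have "c * (norm ?B)\<^sup>2 \<le> (1 - \<sigma>) * ?r * (norm ?B)\<^sup>2"
      unfolding c_def using \<sigma> r(1) by (intro mult_right_mono mult_left_mono) auto
    ultimately show ?thesis
      by linarith
  qed
  with \<open>c > 0\<close> show ?thesis
    by blast
qed

text \<open>The acceptance test is already the bound by \<open>resx\<close>. The forward step makes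
  \<open>T \<theta> - w\<close> equal to \<open>resx / r\<close>, and moving from
  \<open>\<theta>\<close> to \<open>x\<close> costs \<open>L\<close>, so the norm of
  \<open>resy\<close> is at most \<open>q = L + 1 / r0\<close> times that of
  \<open>resx\<close>.\<close>

lemma coercive_fwd:
  assumes i: "i \<in> fwd P"
  shows "\<exists>c>0. \<forall>k\<ge>M. resx i k \<bullet> resy i k \<ge> c * (norm (resx i k))\<^sup>2 \<and>
    resx i k \<bullet> resy i k \<ge> c * (norm (resy i k))\<^sup>2"
proof -
  have i1: "i \<in> {1..n}"
    using i fwd_bwd by blast
  define L where "L = lip P i"
  obtain r0 where r0: "r0 > 0" "\<And>k. k \<ge> 1 \<Longrightarrow> i \<in> blk R k \<Longrightarrow> r0 \<le> bt_rho R i k (bt_index P R i k)"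
    using rho_hat_lower[OF i] by metis
  define q where "q = L + 1 / r0"
  have q: "q > 0"
    using lip_nonneg[OF i] r0 by (simp add: q_def L_def add_nonneg_pos)
  define c where "c = min (Delta R) (Delta R / q\<^sup>2)"
  have "c > 0"
    using Delta_pos q by (simp add: c_def)
  have "resx i k \<bullet> resy i k \<ge> c * (norm (resx i k))\<^sup>2 \<and>
    resx i k \<bullet> resy i k \<ge> c * (norm (resy i k))\<^sup>2" if k: "k \<ge> M" for k
  proof -
    let ?s = "last_processed R i k" and ?l = "last_info R i k"
    let ?A = "resx i k" and ?B = "resy i k"
    let ?j = "bt_index P R i ?s"
    define r where "r = bt_rho R i ?s ?j"
    define \<theta> where "\<theta> = G i (z ?l)"
    note s = last_processed_recent[OF k i1]
    have sb: "i \<in> blk R ?s"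
      by (rule last_processed_mem(1)[OF s(1)])
    have l: "?l = del R i ?s"
      using s by (simp add: last_info_def)
    have r: "r \<ge> r0" "r > 0"
      using r0(2)[OF s(1) sb] r0(1) by (auto simp: r_def)
    note dl = delayed_in[OF i1 s(1)]
    have stops: "bt_stops P R i ?s" and acc: "bt_accept P R i ?s ?j"
      using bt_terminates(1,2)[OF i s(1) dl] by auto
    have "forward_step P R i ?s"
      using iteration_reached[OF s(1) all_reached] sb i by (auto simp: iteration_def)
    then have xy: "x i k = bt_x P R i ?s ?j" "y i k = bt_y P R i ?s ?j"
      using stops xy_last_processed[OF all_reached i1, of k] by (auto simp: forward_step_def)
    have AB: "Delta R * (norm ?A)\<^sup>2 \<le> ?A \<bullet> ?B"
      using acc unfolding resx_def resy_def by (simp add: bt_accept_def xy l bt_theta_def)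
    have A: "?A = r *\<^sub>R (op1 P i \<theta> - w i ?l)"
      unfolding resx_def xy by (simp add: bt_x_def r_def l bt_theta_def bt_zeta_def \<theta>_def)
    have yk: "y i k = op1 P i (x i k)"
      by (simp add: xy bt_y_def)
    have "norm (y i k - op1 P i \<theta>) \<le> L * norm ?A"
      unfolding yk L_def resx_def \<theta>_def[symmetric]
      using T_lipschitz[OF i graph(1)[OF k i1], of \<theta>] dl(1) by (simp add: \<theta>_def l norm_minus_commute)
    moreover have "norm (op1 P i \<theta> - w i ?l) \<le> 1 / r0 * norm ?A"
    proof -
      have "norm ?A = r * norm (op1 P i \<theta> - w i ?l)"
        using r(2) by (simp add: A)
      then have "r0 * norm (op1 P i \<theta> - w i ?l) \<le> norm ?A"
        using r(1) by (simp add: mult_right_mono)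
      then show ?thesis
        using r0(1) by (simp add: field_simps)
    qed
    moreover have "norm ?B \<le> norm (y i k - op1 P i \<theta>) + norm (op1 P i \<theta> - w i ?l)"
      unfolding resy_def using norm_triangle_ineq[of "y i k - op1 P i \<theta>" "op1 P i \<theta> - w i ?l"] by simp
    ultimately have "norm ?B \<le> q * norm ?A"
      by (simp add: q_def algebra_simps)
    then have "(norm ?B)\<^sup>2 \<le> (q * norm ?A)\<^sup>2"
      by (intro power_mono) auto
    then have "Delta R / q\<^sup>2 * (norm ?B)\<^sup>2 \<le> Delta R / q\<^sup>2 * (q\<^sup>2 * (norm ?A)\<^sup>2)"
      using Delta_pos by (intro mult_left_mono) (auto simp: power_mult_distrib)
    also have "\<dots> = Delta R * (norm ?A)\<^sup>2"
      using q by simp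
    finally have "Delta R / q\<^sup>2 * (norm ?B)\<^sup>2 \<le> ?A \<bullet> ?B"
      using AB by linarith
    moreover have "c * (norm ?A)\<^sup>2 \<le> Delta R * (norm ?A)\<^sup>2"
      "c * (norm ?B)\<^sup>2 \<le> Delta R / q\<^sup>2 * (norm ?B)\<^sup>2"
      by (intro mult_right_mono; simp add: c_def)+
    ultimately show ?thesis
      using AB by linarith
  qed
  with \<open>c > 0\<close> show ?thesis
    by blast
qed

lemma coercive:
  assumes "i \<in> {1..n}"
  obtains c where "c > 0" "\<And>k. k \<ge> M \<Longrightarrow> resx i k \<bullet> resy i k \<ge> c * (norm (resx i k))\<^sup>2"
    "\<And>k. k \<ge> M \<Longrightarrow> resx i k \<bullet> resy i k \<ge> c * (norm (resy i k))\<^sup>2"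
  using assms coercive_bwd coercive_fwd fwd_bwd by metis

subsection \<open>Fejer monotonicity\<close>

text \<open>The terms \<open>G i a \<bullet> b i\<close> and
  \<open>G i (x n k) \<bullet> b i\<close> sum to zero by orthogonality, which splits the affine
  function into one product per operator. The identity serves the iterates as well as the
  solutions.\<close>

lemma hyperplane_eq:
  assumes k: "k \<ge> M" and a: "a \<in> H 0" and b: "dual_ok b"
  shows "a \<bullet> v_vec P R k + (\<Sum>i\<in>{1..<n}. b i \<bullet> u_vec P R i k) - (\<Sum>i\<in>{1..n}. x i k \<bullet> y i k) =
    (\<Sum>i\<in>{1..n}. (G i a - x i k) \<bullet> (y i k - b i))"
proof -
  have xn: "x n k \<in> H 0"
    using graph(1)[OF k, of n] n_ge_1 H_last by simp
  have "a \<bullet> v_vec P R k = (\<Sum>i\<in>{1..n}. G i a \<bullet> y i k)"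
    unfolding sum_split_last[OF n_ge_1] v_vec_def
    by (simp only: inner_add_right inner_sum_adj[OF a] G_last[OF a])
  moreover have "(\<Sum>i\<in>{1..<n}. b i \<bullet> u_vec P R i k) = (\<Sum>i\<in>{1..n}. x i k \<bullet> b i)"
    using dual_ok_orthogonal[OF b xn] unfolding sum_split_last[OF n_ge_1] u_vec_def G_last[OF xn]
    by (simp add: inner_diff_right sum_subtractf inner_commute algebra_simps)
  ultimately show ?thesis
    using dual_ok_orthogonal[OF b a]
    by (simp add: inner_diff_left inner_diff_right sum_subtractf)
qed

lemma phi_eq:
  assumes "k \<ge> M"
  shows "phi_val P R k = (\<Sum>i\<in>{1..n}. (G i (z k) - x i k) \<bullet> (y i k - w i k))"
  unfolding phi_val_def using assms M(1) states by (intro hyperplane_eq) auto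

text \<open>From iteration \<open>M\<close> on every index has been processed, so a vanishing
  \<open>pi_val\<close> would make the algorithm return.\<close>

lemma pi_pos:
  assumes k: "k \<ge> M"
  shows "pi_val P R k > 0"
proof -
  have "pi_val P R k \<ge> 0"
    unfolding pi_val_def using gamma_pos by (intro add_nonneg_nonneg sum_nonneg) auto
  moreover have "pi_val P R k \<noteq> 0"
  proof
    assume "pi_val P R k = 0"
    moreover have "(\<Union>j\<in>{1..k}. blk R j) = {1..n}"
    proof
      show "(\<Union>j\<in>{1..k}. blk R j) \<subseteq> {1..n}"
        using blk_subset by auto
      show "{1..n} \<subseteq> (\<Union>j\<in>{1..k}. blk R j)"
      proof
        fix i
        assume i: "i \<in> {1..n}"
        show "i \<in> (\<Union>j\<in>{1..k}. blk R j)"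
          using last_processed_mem[of i k] last_processed_recent(1)[OF k i]
          by (intro UN_I[of "last_processed R i k"]) auto
      qed
    qed
    ultimately have "returns_at P R k"
      using k M(1) all_reached searches_stop_reached by (simp add: returns_at_def return_test_def)
    then show False
      using no_return by blast
  qed
  ultimately show ?thesis
    by simp
qed

text \<open>
  The primal and dual variables are treated alike: component \<open>0\<close> is \<open>z\<close>, with weight \<open>\<gamma>\<close> in the norm.
\<close>

definition pt :: "nat \<Rightarrow> nat \<Rightarrow> 'a" where
  "pt k i = (if i = 0 then z k else w i k)"

text \<open>The gradient of the affine function in the inner product weighted by \<open>wt\<close>;
  this accounts for the factor \<open>inverse (gamma R)\<close> in component 0.\<close>

definition dir :: "nat \<Rightarrow> nat \<Rightarrow> 'a" where
  "dir k i = (if i = 0 then inverse (gamma R) *\<^sub>R v_vec P R k else u_vec P R i k)"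

definition wt :: "nat \<Rightarrow> real" where
  "wt i = (if i = 0 then gamma R else 1)"

text \<open>One function holds the primal point at 0 and the dual components above it, which is
  harmless since \<open>kuhn_tucker_set\<close> reads the second entry only at indices from 1 to
  \<open>n - 1\<close>.\<close>

definition sols :: "(nat \<Rightarrow> 'a) set" where
  "sols = {p. (p 0, p) \<in> kuhn_tucker_set P}"

definition dst :: "(nat \<Rightarrow> 'a) \<Rightarrow> nat \<Rightarrow> real" where
  "dst p k = (\<Sum>i<n. wt i * (norm (pt k i - p i))\<^sup>2)"

text \<open>With \<open>pi_val\<close> as the squared norm of the gradient, this is the squared
  distance of the current point to the half-space where the affine function is nonpositive.\<close>

definition gain :: "nat \<Rightarrow> real" where
  "gain k = (max 0 (phi_val P R k))\<^sup>2 / pi_val P R k"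

lemma wt_pos: "wt i > 0"
  using gamma_pos by (simp add: wt_def)

lemma pi_dir: "pi_val P R k = (\<Sum>i<n. wt i * (norm (dir k i))\<^sup>2)"
  unfolding sum_split_first[OF n_ge_1] pi_val_def dir_def wt_def using gamma_pos
  by (simp add: power_mult_distrib power2_eq_square)

lemma hyperplane_dir:
  "(\<Sum>i<n. wt i * (p i \<bullet> dir k i)) = p 0 \<bullet> v_vec P R k + (\<Sum>i\<in>{1..<n}. p i \<bullet> u_vec P R i k)"
  unfolding sum_split_first[OF n_ge_1] dir_def wt_def using gamma_pos by simp

lemma pt_Suc:
  assumes "k \<ge> 1" "i < n"
  shows "pt (Suc k) i = pt k i - alpha_val P R k *\<^sub>R dir k i"
proof -
  have "iteration P R k" "searches_stop P R k" "\<not> return_test P R k"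
    using assms(1) iteration_reached all_reached searches_stop_reached no_return[of k]
    by (auto simp: returns_at_def)
  then have "update_step P R k"
    by (simp add: iteration_def)
  then show ?thesis
    using assms(2) by (simp add: update_step_def pt_def dir_def mult.commute)
qed

text \<open>Solution components and pairs \<open>(x i k, y i k)\<close> are points of the same
  graphs, so monotonicity makes every summand of \<open>hyperplane_eq\<close> nonpositive at a
  solution.\<close>

lemma sols_separated:
  assumes p: "p \<in> sols" and k: "k \<ge> M"
  shows "(\<Sum>i<n. wt i * (p i \<bullet> dir k i)) \<le> (\<Sum>i\<in>{1..n}. x i k \<bullet> y i k)"
proof -
  obtain b where a: "p 0 \<in> H 0" and b: "dual_ok b" "\<forall>i\<in>{1..<n}. b i = p i"
    "\<forall>i\<in>{1..n}. b i \<in> T i (G i (p 0))"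
    using p unfolding sols_def by (auto simp: kuhn_tucker_iff)
  have "(\<Sum>i\<in>{1..n}. (G i (p 0) - x i k) \<bullet> (y i k - b i)) \<le> 0"
  proof (rule sum_nonpos)
    fix i
    assume i: "i \<in> {1..n}"
    have "(G i (p 0) - x i k) \<bullet> (b i - y i k) \<ge> 0"
      using graph[OF k i] b(3) i a by (intro T_mono[OF i]) (auto simp: G_in)
    then show "(G i (p 0) - x i k) \<bullet> (y i k - b i) \<le> 0"
      by (simp add: inner_diff_right)
  qed
  moreover have "(\<Sum>i\<in>{1..<n}. p i \<bullet> u_vec P R i k) = (\<Sum>i\<in>{1..<n}. b i \<bullet> u_vec P R i k)"
    using b(2) by (intro sum.cong) auto
  ultimately show ?thesis
    using hyperplane_eq[OF k a b(1)] by (simp add: hyperplane_dir)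
qed

lemma beta_bounds: "k \<ge> 1 \<Longrightarrow> beta R k > 0" "k \<ge> 1 \<Longrightarrow> beta R k < 2"
  using params by (force simp: parameters_ok_def)+

text \<open>A bound from below, uniform in \<open>k\<close>, for the factor
  \<open>\<beta> (2 - \<beta>)\<close> of a relaxed projection.\<close>

definition \<kappa> :: real where
  "\<kappa> = beta_lo R * (2 - beta_hi R)"

lemma \<kappa>_pos: "\<kappa> > 0"
  using params by (auto simp: parameters_ok_def \<kappa>_def)

lemma gain_nonneg: "k \<ge> M \<Longrightarrow> gain k \<ge> 0"
  using pi_pos by (simp add: gain_def less_imp_le)

text \<open>These are the linear and the quadratic term that a step contributes to the squared
  distance. Both reduce to \<open>gain\<close>, also when \<open>phi_val\<close> is negative,
  because then \<open>\<alpha>\<close> is 0.\<close>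

lemma alpha_eq:
  assumes "k \<ge> M"
  shows "alpha_val P R k * phi_val P R k = beta R k * gain k"
    "(alpha_val P R k)\<^sup>2 * pi_val P R k = (beta R k)\<^sup>2 * gain k"
    "alpha_val P R k \<ge> 0"
proof -
  have pos: "pi_val P R k > 0" and k1: "k \<ge> 1"
    using pi_pos assms M(1) by auto
  show "alpha_val P R k * phi_val P R k = beta R k * gain k"
    using pos by (simp add: alpha_val_def gain_def power2_eq_square max_def)
  show "(alpha_val P R k)\<^sup>2 * pi_val P R k = (beta R k)\<^sup>2 * gain k"
    using pos by (simp add: alpha_val_def gain_def power2_eq_square)
  show "alpha_val P R k \<ge> 0"
    using pos beta_bounds(1)[OF k1] by (simp add: alpha_val_def)
qed

text \<open>In the expanded square the linear term compares the current point with the solution,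
  where the affine function is nonpositive; the comparison is therefore at least
  \<open>phi_val\<close>. As \<open>\<alpha>\<close> is nonnegative, what is left is a decrease by
  \<open>\<beta> (2 - \<beta>)\<close> times \<open>gain\<close>.\<close>

lemma fejer:
  assumes p: "p \<in> sols" and k: "k \<ge> M"
  shows "dst p (Suc k) + \<kappa> * gain k \<le> dst p k"
proof -
  let ?\<alpha> = "alpha_val P R k"
  have k1: "k \<ge> 1"
    using k M(1) by simp
  have "dst p (Suc k) = (\<Sum>i<n. wt i * (norm (pt k i - p i))\<^sup>2
      - 2 * ?\<alpha> * (wt i * (pt k i \<bullet> dir k i) - wt i * (p i \<bullet> dir k i)) + ?\<alpha>\<^sup>2 * (wt i * (norm (dir k i))\<^sup>2))"
    unfolding dst_def
  proof (intro sum.cong refl)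
    fix i
    assume "i \<in> {..<n}"
    then have "pt (Suc k) i - p i = (pt k i - p i) - ?\<alpha> *\<^sub>R dir k i"
      using pt_Suc[OF k1, of i] by simp
    then have sq: "(norm (pt (Suc k) i - p i))\<^sup>2 =
        (norm (pt k i - p i))\<^sup>2 - 2 * ?\<alpha> * ((pt k i - p i) \<bullet> dir k i) + ?\<alpha>\<^sup>2 * (norm (dir k i))\<^sup>2"
      unfolding power2_norm_eq_inner
      by (simp only: inner_diff_left[of "pt k i - p i"] inner_diff_right[of _ "pt k i - p i"])
        (simp add: inner_commute power2_eq_square)
    show "wt i * (norm (pt (Suc k) i - p i))\<^sup>2 = wt i * (norm (pt k i - p i))\<^sup>2
      - 2 * ?\<alpha> * (wt i * (pt k i \<bullet> dir k i) - wt i * (p i \<bullet> dir k i)) + ?\<alpha>\<^sup>2 * (wt i * (norm (dir k i))\<^sup>2)"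
      unfolding sq by (simp add: inner_diff_left algebra_simps)
  qed
  also have "\<dots> = dst p k - 2 * ?\<alpha> * ((\<Sum>i<n. wt i * (pt k i \<bullet> dir k i)) - (\<Sum>i<n. wt i * (p i \<bullet> dir k i)))
      + ?\<alpha>\<^sup>2 * pi_val P R k"
    by (simp add: dst_def pi_dir sum.distrib sum_subtractf flip: sum_distrib_left)
  also have "\<dots> \<le> dst p k - 2 * ?\<alpha> * phi_val P R k + ?\<alpha>\<^sup>2 * pi_val P R k"
  proof -
    have "(\<Sum>i<n. wt i * (pt k i \<bullet> dir k i)) = z k \<bullet> v_vec P R k + (\<Sum>i\<in>{1..<n}. w i k \<bullet> u_vec P R i k)"
      unfolding hyperplane_dir by (simp add: pt_def)
    then have "phi_val P R k \<le> (\<Sum>i<n. wt i * (pt k i \<bullet> dir k i)) - (\<Sum>i<n. wt i * (p i \<bullet> dir k i))"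
      using sols_separated[OF p k] by (simp add: phi_val_def)
    then have "2 * ?\<alpha> * phi_val P R k \<le>
        2 * ?\<alpha> * ((\<Sum>i<n. wt i * (pt k i \<bullet> dir k i)) - (\<Sum>i<n. wt i * (p i \<bullet> dir k i)))"
      using alpha_eq(3)[OF k] by (intro mult_left_mono) auto
    then show ?thesis
      by linarith
  qed
  also have "\<dots> = dst p k - beta R k * (2 - beta R k) * gain k"
    using alpha_eq(1,2)[OF k] by (simp add: algebra_simps power2_eq_square)
  also have "\<dots> \<le> dst p k - \<kappa> * gain k"
  proof -
    have "beta_lo R * (2 - beta_hi R) \<le> beta R k * (2 - beta R k)"
      using params k1 by (intro mult_mono) (auto simp: parameters_ok_def)
    then show ?thesis
      using gain_nonneg[OF k] by (simp add: \<kappa>_def mult_right_mono)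
  qed
  finally show ?thesis
    by simp
qed

lemma dst_nonneg: "dst p k \<ge> 0"
  unfolding dst_def using wt_pos by (intro sum_nonneg mult_nonneg_nonneg) (auto simp: less_imp_le)

lemma sols_nonempty: "\<exists>p. p \<in> sols"
proof -
  obtain a b where ab: "(a, b) \<in> kuhn_tucker_set P"
    using problem by (auto simp: problem_assumptions_def)
  have "(\<Sum>i\<in>{1..<n}. lin_adj P i ((b(0 := a)) i)) = (\<Sum>i\<in>{1..<n}. lin_adj P i (b i))"
    by (intro sum.cong) auto
  then have "b(0 := a) \<in> sols"
    using ab unfolding sols_def kuhn_tucker_set_def by auto
  then show ?thesis
    by blast
qed

lemma dst_decreasing:
  assumes "p \<in> sols" "k \<ge> M"
  shows "dst p (Suc k) \<le> dst p k"
proof -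
  have "\<kappa> * gain k \<ge> 0"
    using \<kappa>_pos gain_nonneg[OF assms(2)] by simp
  then show ?thesis
    using fejer[OF assms] by linarith
qed

lemma gain_tendsto_0: "gain \<longlonglongrightarrow> 0"
proof -
  obtain p where p: "p \<in> sols"
    using sols_nonempty by blast
  have "decseq (\<lambda>k. dst p (k + M))"
    using dst_decreasing[OF p] by (intro decseq_SucI) simp
  then obtain d where "(\<lambda>k. dst p (k + M)) \<longlonglongrightarrow> d"
    using decseq_convergent[of "\<lambda>k. dst p (k + M)" 0] dst_nonneg by metis
  then have lim: "dst p \<longlonglongrightarrow> d"
    by (rule LIMSEQ_offset)
  have "(\<lambda>k. (dst p k - dst p (Suc k)) / \<kappa>) \<longlonglongrightarrow> (d - d) / \<kappa>"
    using \<kappa>_pos by (intro tendsto_intros lim LIMSEQ_Suc) auto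
  then have lim0: "(\<lambda>k. (dst p k - dst p (Suc k)) / \<kappa>) \<longlonglongrightarrow> 0"
    by simp
  show ?thesis
  proof (rule tendsto_sandwich[OF _ _ tendsto_const lim0])
    show "\<forall>\<^sub>F k in sequentially. 0 \<le> gain k"
      using gain_nonneg unfolding eventually_sequentially by blast
    have "gain k \<le> (dst p k - dst p (Suc k)) / \<kappa>" if "k \<ge> M" for k
      using fejer[OF p that] \<kappa>_pos by (simp add: field_simps)
    then show "\<forall>\<^sub>F k in sequentially. gain k \<le> (dst p k - dst p (Suc k)) / \<kappa>"
      unfolding eventually_sequentially by blast
  qed
qed

text \<open>The weighted squared length of a step is \<open>\<beta>^2\<close> times
  \<open>gain\<close>, and \<open>\<beta> < 2\<close> gives the factor 4.\<close>

lemma pt_step_tendsto_0: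
  assumes i: "i < n"
  shows "(\<lambda>k. pt (Suc k) i - pt k i) \<longlonglongrightarrow> 0"
proof (rule tendsto_0_of_sqnorm)
  have lim0: "(\<lambda>k. 4 * gain k / wt i) \<longlonglongrightarrow> 0"
    using tendsto_mult_left_zero[OF gain_tendsto_0, of "4 / wt i"] by (simp add: mult.commute)
  show "(\<lambda>k. (norm (pt (Suc k) i - pt k i))\<^sup>2) \<longlonglongrightarrow> 0"
  proof (rule tendsto_sandwich[OF _ _ tendsto_const lim0])
    have "(norm (pt (Suc k) i - pt k i))\<^sup>2 \<le> 4 * gain k / wt i" if k: "k \<ge> M" for k
    proof -
      have k1: "k \<ge> 1"
        using k M(1) by simp
      have "wt i * (norm (dir k i))\<^sup>2 \<le> pi_val P R k"
        unfolding pi_dir by (rule member_le_sum) (use i wt_pos in \<open>auto simp: less_imp_le\<close>)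
      then have "(alpha_val P R k)\<^sup>2 * (wt i * (norm (dir k i))\<^sup>2) \<le> (beta R k)\<^sup>2 * gain k"
        unfolding alpha_eq(2)[OF k, symmetric] by (intro mult_left_mono) auto
      also have "\<dots> \<le> 2\<^sup>2 * gain k"
        using beta_bounds[OF k1] gain_nonneg[OF k] by (intro mult_right_mono power_mono) auto
      finally have "wt i * (norm (pt (Suc k) i - pt k i))\<^sup>2 \<le> 4 * gain k"
        using pt_Suc[OF k1 i] by (simp add: power_mult_distrib mult.left_commute)
      then show ?thesis
        using wt_pos[of i] by (simp add: field_simps)
    qed
    then show "\<forall>\<^sub>F k in sequentially. (norm (pt (Suc k) i - pt k i))\<^sup>2 \<le> 4 * gain k / wt i"
      unfolding eventually_sequentially by blast
  qed auto
qed

section \<open>Boundedness of the iterates and vanishing of their increments\<close>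

lemma pt_bounded:
  assumes i: "i < n"
  shows "\<exists>C. \<forall>k\<ge>M. norm (pt k i) \<le> C"
proof -
  obtain p where p: "p \<in> sols"
    using sols_nonempty by blast
  have "norm (pt k i) \<le> sqrt (dst p M / wt i) + norm (p i)" if k: "k \<ge> M" for k
  proof -
    have "dst p k \<le> dst p M"
      using k dst_decreasing[OF p] by (induction k rule: dec_induct) force+
    moreover have "wt i * (norm (pt k i - p i))\<^sup>2 \<le> dst p k"
      unfolding dst_def by (rule member_le_sum) (use i wt_pos in \<open>auto simp: less_imp_le\<close>)
    ultimately have "(norm (pt k i - p i))\<^sup>2 \<le> dst p M / wt i"
      using wt_pos[of i] by (simp add: field_simps)
    then have "norm (pt k i - p i) \<le> sqrt (dst p M / wt i)"
      by (rule real_le_rsqrt)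
    then show ?thesis
      using norm_triangle_sub[of "pt k i" "p i"] by linarith
  qed
  then show ?thesis
    by blast
qed

lemma z_bounded: "\<exists>C. \<forall>k\<ge>M. norm (z k) \<le> C"
  using pt_bounded[of 0] n_ge_1 by (simp add: pt_def)

lemma z_step_tendsto_0: "(\<lambda>k. z (Suc k) - z k) \<longlonglongrightarrow> 0"
  using pt_step_tendsto_0[of 0] n_ge_1 by (simp add: pt_def)

lemma G_z_bounded:
  assumes "i \<in> {1..n}"
  shows "\<exists>C. \<forall>k\<ge>M. norm (G i (z k)) \<le> C"
proof -
  obtain K where K: "K \<ge> 0" "\<And>u. u \<in> H 0 \<Longrightarrow> norm (G i u) \<le> K * norm u"
    using bounded_linear_on_bound[OF G_bounded_linear[OF assms]] by metis
  obtain C where C: "\<And>k. k \<ge> M \<Longrightarrow> norm (z k) \<le> C"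
    using z_bounded by blast
  have "norm (G i (z k)) \<le> K * C" if "k \<ge> M" for k
    using K(2)[OF states(1)[of k]] mult_left_mono[OF C[OF that] K(1)] that M(1) by linarith
  then show ?thesis
    by blast
qed

lemma G_tendsto_0:
  assumes i: "i \<in> {1..n}" and f: "(f \<longlongrightarrow> 0) F" and F: "eventually (\<lambda>k. f k \<in> H 0) F"
  shows "((\<lambda>k. G i (f k)) \<longlongrightarrow> 0) F"
proof -
  obtain K where K: "\<And>u. u \<in> H 0 \<Longrightarrow> norm (G i u) \<le> K * norm u"
    using bounded_linear_on_bound[OF G_bounded_linear[OF i]] by metis
  show ?thesis
  proof (rule Lim_null_comparison)
    show "eventually (\<lambda>k. norm (G i (f k)) \<le> K * norm (f k)) F"
      using F by eventually_elim (rule K)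
    show "((\<lambda>k. K * norm (f k)) \<longlongrightarrow> 0) F"
      using f by (intro tendsto_mult_right_zero tendsto_norm_zero)
  qed
qed

lemma adj_tendsto_0:
  assumes i: "i \<in> {1..n}" and f: "(f \<longlongrightarrow> 0) F"
  shows "((\<lambda>k. lin_adj P i (f k)) \<longlongrightarrow> 0) F"
proof -
  obtain K where K: "\<And>v. norm (lin_adj P i v) \<le> K * norm v"
    using adjoint_on_bound[OF G_bounded_linear[OF i] hilbert_H] by (metis le0)
  show ?thesis
  proof (rule Lim_null_comparison)
    show "eventually (\<lambda>k. norm (lin_adj P i (f k)) \<le> K * norm (f k)) F"
      by (simp add: K)
    show "((\<lambda>k. K * norm (f k)) \<longlongrightarrow> 0) F"
      using f by (intro tendsto_mult_right_zero tendsto_norm_zero)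
  qed
qed

lemma adj_diff: "i \<in> {1..n} \<Longrightarrow> lin_adj P i (a - b) = lin_adj P i a - lin_adj P i b"
  using adjoint_on_diff[OF G_bounded_linear hilbert_H] by blast

lemma w_last: "k \<ge> 1 \<Longrightarrow> w n k = - (\<Sum>i\<in>{1..<n}. lin_adj P i (w i k))"
  using states(2) by (auto simp: dual_ok_def)

lemma w_bounded:
  assumes "i \<in> {1..n}"
  shows "\<exists>C. \<forall>k\<ge>M. norm (w i k) \<le> C"
proof (cases "i = n")
  case False
  then show ?thesis
    using pt_bounded[of i] assms by (simp add: pt_def)
next
  case True
  have "\<exists>C. \<forall>k\<ge>M. norm (lin_adj P j (w j k)) \<le> C" if "j \<in> {1..<n}" for j
  proof -
    have j: "j \<in> {1..n}"
      using that by simp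
    have "pt k j = w j k" for k
      using that by (simp add: pt_def)
    then have "\<exists>C. \<forall>k\<ge>M. norm (w j k) \<le> C"
      using pt_bounded[of j] that by simp
    then obtain C where C: "\<And>k. k \<ge> M \<Longrightarrow> norm (w j k) \<le> C"
      by blast
    obtain K where K: "K \<ge> 0" "\<And>v. norm (lin_adj P j v) \<le> K * norm v"
      using adjoint_on_bound[OF G_bounded_linear[OF j] hilbert_H] by (metis le0)
    have "norm (lin_adj P j (w j k)) \<le> K * C" if "k \<ge> M" for k
      using K(2)[of "w j k"] mult_left_mono[OF C[OF that] K(1)] by linarith
    then show ?thesis
      by blast
  qed
  then obtain C where C: "\<And>j k. j \<in> {1..<n} \<Longrightarrow> k \<ge> M \<Longrightarrow> norm (lin_adj P j (w j k)) \<le> C j"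
    by metis
  have "norm (w i k) \<le> (\<Sum>j\<in>{1..<n}. C j)" if "k \<ge> M" for k
  proof -
    have "norm (\<Sum>j\<in>{1..<n}. lin_adj P j (w j k)) \<le> (\<Sum>j\<in>{1..<n}. C j)"
      using C that by (intro sum_norm_le) auto
    then show ?thesis
      unfolding True using w_last[of k] that M(1) by simp
  qed
  then show ?thesis
    by blast
qed

lemma w_step_tendsto_0:
  assumes "i \<in> {1..n}"
  shows "(\<lambda>k. w i (Suc k) - w i k) \<longlonglongrightarrow> 0"
proof (cases "i = n")
  case False
  then show ?thesis
    using pt_step_tendsto_0[of i] assms by (simp add: pt_def)
next
  case True
  have "(\<lambda>k. w j (Suc k) - w j k) \<longlonglongrightarrow> 0" if "j \<in> {1..<n}" for j
    using pt_step_tendsto_0[of j] that by (simp add: pt_def)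
  then have "(\<lambda>k. - (\<Sum>j\<in>{1..<n}. lin_adj P j (w j (Suc k) - w j k))) \<longlonglongrightarrow> - (\<Sum>j\<in>{1..<n}. 0)"
    by (intro tendsto_minus tendsto_sum adj_tendsto_0) auto
  moreover have "- (\<Sum>j\<in>{1..<n}. lin_adj P j (w j (Suc k) - w j k)) = w n (Suc k) - w n k"
    if "k \<ge> 1" for k
  proof -
    have "(\<Sum>j\<in>{1..<n}. lin_adj P j (w j (Suc k) - w j k)) =
        (\<Sum>j\<in>{1..<n}. lin_adj P j (w j (Suc k)) - lin_adj P j (w j k))"
      by (intro sum.cong) (auto intro!: adj_diff)
    then show ?thesis
      using w_last[OF that] w_last[of "Suc k"] that by (simp add: sum_subtractf)
  qed
  then have "\<forall>\<^sub>F k in sequentially.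
      - (\<Sum>j\<in>{1..<n}. lin_adj P j (w j (Suc k) - w j k)) = w n (Suc k) - w n k"
    unfolding eventually_sequentially by blast
  ultimately show ?thesis
    unfolding True using tendsto_cong by fastforce
qed

lemma G_z_step_tendsto_0:
  assumes i: "i \<in> {1..n}"
  shows "(\<lambda>k. G i (z (Suc k)) - G i (z k)) \<longlonglongrightarrow> 0"
proof -
  have "\<forall>\<^sub>F k in sequentially. z (Suc k) - z k \<in> H 0"
    unfolding eventually_sequentially
    using states(1) subspace_H[of 0] by (intro exI[of _ 1]) (simp add: subspace_diff)
  then have "(\<lambda>k. G i (z (Suc k) - z k)) \<longlonglongrightarrow> 0"
    using G_tendsto_0[OF i z_step_tendsto_0] by blast
  moreover have "G i (z (Suc k) - z k) = G i (z (Suc k)) - G i (z k)" if "k \<ge> 1" for k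
    using G_diff[OF i] states(1) that by simp
  then have "\<forall>\<^sub>F k in sequentially. G i (z (Suc k) - z k) = G i (z (Suc k)) - G i (z k)"
    unfolding eventually_sequentially by blast
  ultimately show ?thesis
    using tendsto_cong by fastforce
qed

text \<open>\<open>coercive_monotone_bound\<close> is applied with a solution as reference point.
  The threshold ensures that the delayed index is at least \<open>M\<close>, where the iterates are
  known to be bounded.\<close>

lemma xy_bounded:
  assumes i: "i \<in> {1..n}"
  obtains C where "\<And>k. k \<ge> M + (M + Dl) \<Longrightarrow> norm (x i k) \<le> C"
    "\<And>k. k \<ge> M + (M + Dl) \<Longrightarrow> norm (y i k) \<le> C"
    "\<And>k. k \<ge> M + (M + Dl) \<Longrightarrow> norm (resx i k) \<le> C"
    "\<And>k. k \<ge> M + (M + Dl) \<Longrightarrow> norm (resy i k) \<le> C"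
proof -
  obtain a b where a: "a \<in> H 0" and b: "dual_ok b" "\<forall>i\<in>{1..n}. b i \<in> T i (G i a)"
    using problem unfolding problem_assumptions_def by (force simp: kuhn_tucker_iff)
  obtain c where c: "c > 0" "\<And>k. k \<ge> M \<Longrightarrow> resx i k \<bullet> resy i k \<ge> c * (norm (resx i k))\<^sup>2"
    "\<And>k. k \<ge> M \<Longrightarrow> resx i k \<bullet> resy i k \<ge> c * (norm (resy i k))\<^sup>2"
    using coercive[OF i] by metis
  obtain C1 C2 where C1: "\<And>k. k \<ge> M \<Longrightarrow> norm (G i (z k)) \<le> C1"
    and C2: "\<And>k. k \<ge> M \<Longrightarrow> norm (w i k) \<le> C2"
    using G_z_bounded[OF i] w_bounded[OF i] by blast
  define K where "K = max (C1 + norm (G i a)) (C2 + norm (b i))"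
  define B where "B = K + 3 * K / c"
  have *: "norm (resx i k) \<le> B \<and> norm (resy i k) \<le> B \<and> norm (x i k) \<le> C1 + B \<and> norm (y i k) \<le> C2 + B"
    if k: "k \<ge> M + (M + Dl)" for k
  proof -
    let ?l = "last_info R i k"
    have kM: "k \<ge> M"
      using k by simp
    have l: "?l \<ge> M"
      using last_info_recent(3)[OF kM i] k by linarith
    have "(x i k - G i a) \<bullet> (y i k - b i) \<ge> 0"
      using graph[OF kM i] b i a by (intro T_mono[OF i]) (auto simp: G_in)
    then have "((G i (z ?l) - G i a) - resx i k) \<bullet> ((w i ?l - b i) + resy i k) \<ge> 0"
      by (simp add: resx_def resy_def)
    moreover have "norm (G i (z ?l) - G i a) \<le> K" "norm (w i ?l - b i) \<le> K"
      unfolding K_def using C1[OF l] C2[OF l] norm_triangle_ineq4[of "G i (z ?l)" "G i a"]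
        norm_triangle_ineq4[of "w i ?l" "b i"] by linarith+
    ultimately have r: "norm (resx i k) \<le> B" "norm (resy i k) \<le> B"
      unfolding B_def using coercive_monotone_bound[OF c(1) c(2,3)[OF kM]] by blast+
    have "x i k = G i (z ?l) - resx i k" "y i k = w i ?l + resy i k"
      by (auto simp: resx_def resy_def)
    then have "norm (x i k) \<le> norm (G i (z ?l)) + norm (resx i k)"
      "norm (y i k) \<le> norm (w i ?l) + norm (resy i k)"
      by (simp_all only: norm_triangle_ineq4 norm_triangle_ineq)
    then show ?thesis
      using r C1[OF l] C2[OF l] by linarith
  qed
  show ?thesis
  proof (rule that[of "max B (max (C1 + B) (C2 + B))"])
  qed (use * in \<open>fastforce simp: le_max_iff_disj\<close>)+
qed

lemma pi_bounded: "\<exists>C\<ge>0. \<forall>k\<ge>M + (M + Dl). pi_val P R k \<le> C"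
proof -
  have "\<exists>C. \<forall>k\<ge>M + (M + Dl). norm (x i k) \<le> C \<and> norm (y i k) \<le> C" if "i \<in> {1..n}" for i
    using xy_bounded[OF that] by metis
  then obtain C where C: "\<And>i k. i \<in> {1..n} \<Longrightarrow> k \<ge> M + (M + Dl) \<Longrightarrow> norm (x i k) \<le> C i"
    "\<And>i k. i \<in> {1..n} \<Longrightarrow> k \<ge> M + (M + Dl) \<Longrightarrow> norm (y i k) \<le> C i"
    by metis
  have "\<exists>K\<ge>0. \<forall>u\<in>H 0. norm (G i u) \<le> K * norm u" if "i \<in> {1..n}" for i
    using bounded_linear_on_bound[OF G_bounded_linear[OF that]] by metis
  then obtain K where K: "\<And>i. i \<in> {1..n} \<Longrightarrow> K i \<ge> 0"
    "\<And>i u. i \<in> {1..n} \<Longrightarrow> u \<in> H 0 \<Longrightarrow> norm (G i u) \<le> K i * norm u"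
    by metis
  have "\<exists>K\<ge>0. \<forall>v. norm (lin_adj P i v) \<le> K * norm v" if "i \<in> {1..n}" for i
    using adjoint_on_bound[OF G_bounded_linear[OF that] hilbert_H] by (metis le0)
  then obtain K' where K': "\<And>i. i \<in> {1..n} \<Longrightarrow> K' i \<ge> 0"
    "\<And>i v. i \<in> {1..n} \<Longrightarrow> norm (lin_adj P i v) \<le> K' i * norm v"
    by metis
  define B where "B = (\<Sum>i\<in>{1..<n}. (C i + K i * C n)\<^sup>2) +
    inverse (gamma R) * ((\<Sum>i\<in>{1..<n}. K' i * C i) + C n)\<^sup>2"
  have n: "n \<in> {1..n}"
    using n_ge_1 by simp
  have "pi_val P R k \<le> B" if k: "k \<ge> M + (M + Dl)" for k
    unfolding pi_val_def B_def
  proof (intro add_mono sum_mono mult_left_mono power_mono norm_ge_zero)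
    fix i
    assume "i \<in> {1..<n}"
    then have i: "i \<in> {1..n}"
      by simp
    have "x n k \<in> H 0"
      using graph(1)[of k n] n k H_last by simp
    then have "norm (G i (x n k)) \<le> K i * norm (x n k)"
      by (rule K(2)[OF i])
    also have "\<dots> \<le> K i * C n"
      using K(1)[OF i] C(1)[OF n k] by (intro mult_left_mono)
    finally show "norm (u_vec P R i k) \<le> C i + K i * C n"
      unfolding u_vec_def using C(1)[OF i k] norm_triangle_ineq4[of "x i k" "G i (x n k)"] by linarith
  next
    have "norm (\<Sum>i\<in>{1..<n}. lin_adj P i (y i k)) \<le> (\<Sum>i\<in>{1..<n}. K' i * C i)"
    proof (rule sum_norm_le)
      fix i
      assume "i \<in> {1..<n}"
      then have i: "i \<in> {1..n}"
        by simp
      show "norm (lin_adj P i (y i k)) \<le> K' i * C i"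
        using K'(2)[OF i, of "y i k"] mult_left_mono[OF C(2)[OF i k] K'(1)[OF i]] by linarith
    qed
    then show "norm (v_vec P R k) \<le> (\<Sum>i\<in>{1..<n}. K' i * C i) + C n"
      unfolding v_vec_def using C(2)[OF n k]
        norm_triangle_ineq[of "\<Sum>i\<in>{1..<n}. lin_adj P i (y i k)" "y n k"] by linarith
  qed (use gamma_pos in auto)
  moreover have "B \<ge> 0"
    unfolding B_def using gamma_pos by (intro add_nonneg_nonneg sum_nonneg) auto
  ultimately show ?thesis
    by blast
qed

lemma phi_pos_part_tendsto_0: "(\<lambda>k. max 0 (phi_val P R k)) \<longlonglongrightarrow> 0"
proof (rule tendsto_0_of_sqnorm)
  obtain C where C: "C \<ge> 0" "\<And>k. k \<ge> M + (M + Dl) \<Longrightarrow> pi_val P R k \<le> C"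
    using pi_bounded by blast
  have lim0: "(\<lambda>k. gain k * C) \<longlonglongrightarrow> 0"
    using gain_tendsto_0 by (rule tendsto_mult_left_zero)
  show "(\<lambda>k. (norm (max 0 (phi_val P R k)))\<^sup>2) \<longlonglongrightarrow> 0"
  proof (rule tendsto_sandwich[OF _ _ tendsto_const lim0])
    have "(norm (max 0 (phi_val P R k)))\<^sup>2 \<le> gain k * C" if k: "k \<ge> M + (M + Dl)" for k
    proof -
      have "k \<ge> M"
        using k by simp
      then have "(norm (max 0 (phi_val P R k)))\<^sup>2 = gain k * pi_val P R k"
        using pi_pos[of k] by (simp add: gain_def)
      also have "\<dots> \<le> gain k * C"
        using C(2)[OF k] gain_nonneg[OF \<open>k \<ge> M\<close>] by (rule mult_left_mono)
      finally show ?thesis .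
    qed
    then show "\<forall>\<^sub>F k in sequentially. (norm (max 0 (phi_val P R k)))\<^sup>2 \<le> gain k * C"
      unfolding eventually_sequentially by blast
  qed auto
qed

subsection \<open>Vanishing residuals\<close>

lemma delay_tendsto_0:
  fixes f :: "nat \<Rightarrow> 'a"
  assumes "i \<in> {1..n}" "(\<lambda>k. f (Suc k) - f k) \<longlonglongrightarrow> 0"
  shows "(\<lambda>k. f k - f (last_info R i k)) \<longlonglongrightarrow> 0"
proof (rule tendsto_delay_diff_0[OF assms(2)])
  show "\<forall>\<^sub>F k in sequentially. last_info R i k \<le> k \<and> k \<le> last_info R i k + (M + Dl)"
    unfolding eventually_sequentially using last_info_recent(2,3)[OF _ assms(1)] by blast
qed

text \<open>Delayed information is replaced by current information in one factor at a time; each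
  correction pairs a vanishing delay difference with a bounded vector.\<close>

lemma residual_product_diff:
  assumes i: "i \<in> {1..n}"
  shows "(\<lambda>k. (G i (z k) - x i k) \<bullet> (y i k - w i k) - resx i k \<bullet> resy i k) \<longlonglongrightarrow> 0"
proof -
  let ?dz = "\<lambda>k. G i (z k) - G i (z (last_info R i k))"
  let ?dw = "\<lambda>k. w i k - w i (last_info R i k)"
  obtain C where C: "\<And>k. k \<ge> M + (M + Dl) \<Longrightarrow> norm (y i k) \<le> C"
    "\<And>k. k \<ge> M + (M + Dl) \<Longrightarrow> norm (resx i k) \<le> C"
    using xy_bounded[OF i] by metis
  obtain C2 where C2: "\<And>k. k \<ge> M \<Longrightarrow> norm (w i k) \<le> C2"
    using w_bounded[OF i] by blast
  have dz: "?dz \<longlonglongrightarrow> 0"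
    by (rule delay_tendsto_0[OF i G_z_step_tendsto_0[OF i]])
  have dw: "?dw \<longlonglongrightarrow> 0"
    by (rule delay_tendsto_0[OF i w_step_tendsto_0[OF i]])
  have "norm (y i k - w i k) \<le> C + C2" if "k \<ge> M + (M + Dl)" for k
    using C(1)[OF that] C2[of k] that norm_triangle_ineq4[of "y i k" "w i k"] by simp
  then have "(\<lambda>k. ?dz k \<bullet> (y i k - w i k)) \<longlonglongrightarrow> 0"
    by (intro tendsto_inner_bounded_0[OF dz]) (auto simp: eventually_sequentially)
  moreover have "(\<lambda>k. ?dw k \<bullet> resx i k) \<longlonglongrightarrow> 0"
    using C(2) by (intro tendsto_inner_bounded_0[OF dw]) (auto simp: eventually_sequentially)
  ultimately have "(\<lambda>k. ?dz k \<bullet> (y i k - w i k) - ?dw k \<bullet> resx i k) \<longlonglongrightarrow> 0 - 0"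
    by (rule tendsto_diff)
  moreover have "?dz k \<bullet> (y i k - w i k) - ?dw k \<bullet> resx i k =
      (G i (z k) - x i k) \<bullet> (y i k - w i k) - resx i k \<bullet> resy i k" for k
    by (simp add: resx_def resy_def inner_diff_left inner_diff_right inner_commute)
  ultimately show ?thesis
    by simp
qed

lemma residual_product_nonneg:
  assumes "i \<in> {1..n}" "k \<ge> M"
  shows "resx i k \<bullet> resy i k \<ge> 0"
proof -
  obtain c where "c > 0" "resx i k \<bullet> resy i k \<ge> c * (norm (resx i k))\<^sup>2"
    using coercive[OF assms(1)] assms(2) by metis
  moreover have "c * (norm (resx i k))\<^sup>2 \<ge> 0"
    using \<open>c > 0\<close> by simp
  ultimately show ?thesis
    by linarith
qed

text \<open>The delayed products are nonnegative, so each is dominated by their sum, which is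
  \<open>phi_val\<close> up to vanishing corrections. The summands of \<open>phi_val\<close> itself
  carry no sign, hence the detour.\<close>

lemma residual_product_tendsto_0:
  assumes i: "i \<in> {1..n}"
  shows "(\<lambda>k. resx i k \<bullet> resy i k) \<longlonglongrightarrow> 0"
proof -
  let ?d = "\<lambda>j k. (G j (z k) - x j k) \<bullet> (y j k - w j k) - resx j k \<bullet> resy j k"
  have "(\<lambda>k. max 0 (phi_val P R k) - (\<Sum>j\<in>{1..n}. ?d j k)) \<longlonglongrightarrow> 0 - (\<Sum>j\<in>{1..n}. 0)"
    by (intro tendsto_diff phi_pos_part_tendsto_0 tendsto_sum residual_product_diff)
  then have lim0: "(\<lambda>k. max 0 (phi_val P R k) - (\<Sum>j\<in>{1..n}. ?d j k)) \<longlonglongrightarrow> 0"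
    by simp
  show ?thesis
  proof (rule tendsto_sandwich[OF _ _ tendsto_const lim0])
    show "\<forall>\<^sub>F k in sequentially. 0 \<le> resx i k \<bullet> resy i k"
      unfolding eventually_sequentially using residual_product_nonneg[OF i] by blast
    have "resx i k \<bullet> resy i k \<le> max 0 (phi_val P R k) - (\<Sum>j\<in>{1..n}. ?d j k)" if k: "k \<ge> M" for k
    proof -
      have "resx i k \<bullet> resy i k \<le> (\<Sum>j\<in>{1..n}. resx j k \<bullet> resy j k)"
        using i residual_product_nonneg k by (intro member_le_sum[of i]) auto
      also have "\<dots> = phi_val P R k - (\<Sum>j\<in>{1..n}. ?d j k)"
        unfolding phi_eq[OF k] by (simp add: sum_subtractf)
      finally show ?thesis
        by linarith
    qed
    then show "\<forall>\<^sub>F k in sequentially.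
        resx i k \<bullet> resy i k \<le> max 0 (phi_val P R k) - (\<Sum>j\<in>{1..n}. ?d j k)"
      unfolding eventually_sequentially by blast
  qed
qed

lemma residuals_tendsto_0:
  assumes i: "i \<in> {1..n}"
  shows "resx i \<longlonglongrightarrow> 0" "resy i \<longlonglongrightarrow> 0"
proof -
  obtain c where c: "c > 0" "\<And>k. k \<ge> M \<Longrightarrow> resx i k \<bullet> resy i k \<ge> c * (norm (resx i k))\<^sup>2"
    "\<And>k. k \<ge> M \<Longrightarrow> resx i k \<bullet> resy i k \<ge> c * (norm (resy i k))\<^sup>2"
    using coercive[OF i] by metis
  have lim0: "(\<lambda>k. resx i k \<bullet> resy i k / c) \<longlonglongrightarrow> 0"
    using tendsto_divide_zero[OF residual_product_tendsto_0[OF i]] .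
  have sq: "f \<longlonglongrightarrow> 0" if f: "\<And>k. k \<ge> M \<Longrightarrow> c * (norm (f k))\<^sup>2 \<le> resx i k \<bullet> resy i k" for f :: "nat \<Rightarrow> 'a"
  proof (rule tendsto_0_of_sqnorm, rule tendsto_sandwich[OF _ _ tendsto_const lim0])
    have "(norm (f k))\<^sup>2 \<le> resx i k \<bullet> resy i k / c" if "k \<ge> M" for k
      using f[OF that] c(1) by (simp add: field_simps)
    then show "\<forall>\<^sub>F k in sequentially. (norm (f k))\<^sup>2 \<le> resx i k \<bullet> resy i k / c"
      unfolding eventually_sequentially by blast
  qed auto
  show "resx i \<longlonglongrightarrow> 0" "resy i \<longlonglongrightarrow> 0"
    using sq c(2,3) by blast+
qed

lemma xy_close:
  assumes i: "i \<in> {1..n}"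
  shows "(\<lambda>k. x i k - G i (z k)) \<longlonglongrightarrow> 0" "(\<lambda>k. y i k - w i k) \<longlonglongrightarrow> 0"
proof -
  have "(\<lambda>k. - (resx i k + (G i (z k) - G i (z (last_info R i k))))) \<longlonglongrightarrow> - (0 + 0)"
    by (intro tendsto_minus tendsto_add residuals_tendsto_0[OF i]
        delay_tendsto_0[OF i G_z_step_tendsto_0[OF i]])
  then show "(\<lambda>k. x i k - G i (z k)) \<longlonglongrightarrow> 0"
    by (simp add: resx_def)
  have "(\<lambda>k. resy i k - (w i k - w i (last_info R i k))) \<longlonglongrightarrow> 0 - 0"
    by (intro tendsto_diff residuals_tendsto_0[OF i] delay_tendsto_0[OF i w_step_tendsto_0[OF i]])
  then show "(\<lambda>k. y i k - w i k) \<longlonglongrightarrow> 0"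
    by (simp add: resy_def)
qed

text \<open>Both \<open>x i k\<close> and \<open>G i (x n k)\<close> follow
  \<open>G i (z k)\<close>, the latter because \<open>x n k\<close> follows \<open>z k\<close> and
  \<open>G i\<close> is bounded.\<close>

lemma u_tendsto_0:
  assumes "i \<in> {1..<n}"
  shows "u_vec P R i \<longlonglongrightarrow> 0"
proof -
  have i: "i \<in> {1..n}" and n: "n \<in> {1..n}"
    using assms n_ge_1 by auto
  have xn: "x n k \<in> H 0" if "k \<ge> M" for k
    using graph(1)[OF that n] H_last by simp
  have "(\<lambda>k. x n k - z k) \<longlonglongrightarrow> 0"
  proof (rule Lim_transform_eventually[OF xy_close(1)[OF n]])
    show "\<forall>\<^sub>F k in sequentially. x n k - G n (z k) = x n k - z k"
      unfolding eventually_sequentially using G_last states(1) by metis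
  qed
  moreover have "\<forall>\<^sub>F k in sequentially. x n k - z k \<in> H 0"
    unfolding eventually_sequentially using xn states(1) M(1) subspace_H[of 0]
    by (intro exI[of _ M]) (simp add: subspace_diff)
  ultimately have "(\<lambda>k. G i (x n k - z k)) \<longlonglongrightarrow> 0"
    by (rule G_tendsto_0[OF i])
  then have "(\<lambda>k. (x i k - G i (z k)) - G i (x n k - z k)) \<longlonglongrightarrow> 0 - 0"
    by (intro tendsto_diff xy_close(1)[OF i])
  then have "(\<lambda>k. (x i k - G i (z k)) - G i (x n k - z k)) \<longlonglongrightarrow> 0"
    by simp
  then show ?thesis
  proof (rule Lim_transform_eventually)
    have "(x i k - G i (z k)) - G i (x n k - z k) = u_vec P R i k" if "k \<ge> M" for k
      using G_diff[OF i xn[OF that] states(1)[of k]] that M(1) by (simp add: u_vec_def)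
    then show "\<forall>\<^sub>F k in sequentially. (x i k - G i (z k)) - G i (x n k - z k) = u_vec P R i k"
      unfolding eventually_sequentially by blast
  qed
qed

text \<open>The adjoint sum of the \<open>w i k\<close> cancels against \<open>w n k\<close>, so
  \<open>v_vec\<close> depends only on the vanishing differences of \<open>y\<close> and
  \<open>w\<close>.\<close>

lemma v_tendsto_0: "v_vec P R \<longlonglongrightarrow> 0"
proof -
  have "(\<lambda>k. (\<Sum>i\<in>{1..<n}. lin_adj P i (y i k - w i k)) + (y n k - w n k)) \<longlonglongrightarrow> (\<Sum>i\<in>{1..<n}. 0) + 0"
    using n_ge_1 by (intro tendsto_add tendsto_sum adj_tendsto_0 xy_close(2)) auto
  then have "(\<lambda>k. (\<Sum>i\<in>{1..<n}. lin_adj P i (y i k - w i k)) + (y n k - w n k)) \<longlonglongrightarrow> 0"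
    by simp
  then show ?thesis
  proof (rule Lim_transform_eventually)
    have "(\<Sum>i\<in>{1..<n}. lin_adj P i (y i k - w i k)) + (y n k - w n k) = v_vec P R k" if "k \<ge> 1" for k
    proof -
      have "(\<Sum>i\<in>{1..<n}. lin_adj P i (y i k - w i k)) =
          (\<Sum>i\<in>{1..<n}. lin_adj P i (y i k) - lin_adj P i (w i k))"
        by (intro sum.cong) (auto intro!: adj_diff)
      then show ?thesis
        using w_last[OF that] by (simp add: v_vec_def sum_subtractf)
    qed
    then show "\<forall>\<^sub>F k in sequentially.
        (\<Sum>i\<in>{1..<n}. lin_adj P i (y i k - w i k)) + (y n k - w n k) = v_vec P R k"
      unfolding eventually_sequentially by blast
  qed
qed

subsection \<open>Weak limits of the iterates\<close>

text \<open>Passes from a point of the product space to a tuple in the sense of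
  \<open>dual_ok\<close>; the primal entry at 0 is carried along unchanged.\<close>

definition complete_dual :: "(nat \<Rightarrow> 'a) \<Rightarrow> nat \<Rightarrow> 'a" where
  "complete_dual p i = (if i = n then - (\<Sum>j\<in>{1..<n}. lin_adj P j (p j)) else p i)"

lemma complete_dual_ok:
  assumes "\<And>i. i < n \<Longrightarrow> p i \<in> H i"
  shows "dual_ok (complete_dual p)"
proof (rule dual_okI)
  show "complete_dual p i \<in> H i" if "i \<in> {1..<n}" for i
    using assms that by (simp add: complete_dual_def)
  have "(\<Sum>i = 1..<n. lin_adj P i (p i)) = (\<Sum>i = 1..<n. lin_adj P i (complete_dual p i))"
    by (intro sum.cong) (auto simp: complete_dual_def)
  then show "complete_dual p n = - (\<Sum>i = 1..<n. lin_adj P i (complete_dual p i))"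
    by (simp add: complete_dual_def)
qed

text \<open>The filter is arbitrary because the lemma serves cluster points as well as the final
  limit. Moving \<open>G i\<close> or its adjoint onto the test vector preserves weak limits, and
  the strongly vanishing differences of \<open>xy_close\<close> transfer them to \<open>x\<close>
  and \<open>y\<close>.\<close>

lemma weak_limits:
  assumes F: "F \<le> sequentially"
    and pH: "\<And>i. i < n \<Longrightarrow> p i \<in> H i"
    and lim: "\<And>i u. i < n \<Longrightarrow> u \<in> H i \<Longrightarrow> ((\<lambda>k. pt k i \<bullet> u) \<longlongrightarrow> p i \<bullet> u) F"
    and i: "i \<in> {1..n}" and u: "u \<in> H i"
  shows "((\<lambda>k. x i k \<bullet> u) \<longlongrightarrow> G i (p 0) \<bullet> u) F" "((\<lambda>k. y i k \<bullet> u) \<longlongrightarrow> complete_dual p i \<bullet> u) F"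
proof -
  have ev: "eventually Q F" if "\<And>k. k \<ge> 1 \<Longrightarrow> Q k" for Q
    using eventually_le_sequentially[OF F] that by blast
  have p0: "p 0 \<in> H 0"
    using pH n_ge_1 by simp
  have "((\<lambda>k. z k \<bullet> lin_adj P i u) \<longlongrightarrow> p 0 \<bullet> lin_adj P i u) F"
    using lim[of 0] adj_in[OF i] n_ge_1 by (simp add: pt_def)
  then have Gz: "((\<lambda>k. G i (z k) \<bullet> u) \<longlongrightarrow> G i (p 0) \<bullet> u) F"
    unfolding adj_inner[OF i p0] using ev[of "\<lambda>k. z k \<bullet> lin_adj P i u = G i (z k) \<bullet> u"]
      adj_inner[OF i] states(1) by (auto elim: Lim_transform_eventually)
  have "((\<lambda>k. (x i k - G i (z k)) \<bullet> u + G i (z k) \<bullet> u) \<longlongrightarrow> 0 \<bullet> u + G i (p 0) \<bullet> u) F"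
    by (intro tendsto_add tendsto_inner tendsto_const Gz tendsto_mono[OF F] xy_close[OF i])
  then show "((\<lambda>k. x i k \<bullet> u) \<longlongrightarrow> G i (p 0) \<bullet> u) F"
    by (simp add: inner_diff_left)
  have w: "((\<lambda>k. w i k \<bullet> u) \<longlongrightarrow> complete_dual p i \<bullet> u) F"
  proof (cases "i = n")
    case False
    then show ?thesis
      using lim[of i u] i u by (simp add: pt_def complete_dual_def)
  next
    case True
    have u0: "u \<in> H 0"
      using u True H_last by simp
    have "((\<lambda>k. - (\<Sum>j\<in>{1..<n}. pt k j \<bullet> G j u)) \<longlongrightarrow> - (\<Sum>j\<in>{1..<n}. p j \<bullet> G j u)) F"
      using u0 by (intro tendsto_minus tendsto_sum lim) (auto intro: G_in)
    moreover have "- (\<Sum>j\<in>{1..<n}. p j \<bullet> G j u) = complete_dual p n \<bullet> u"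
      using inner_sum_adj[OF u0, of p] by (simp add: complete_dual_def inner_commute)
    moreover have "- (\<Sum>j\<in>{1..<n}. pt k j \<bullet> G j u) = w n k \<bullet> u" if "k \<ge> 1" for k
    proof -
      have "(\<Sum>j\<in>{1..<n}. pt k j \<bullet> G j u) = (\<Sum>j\<in>{1..<n}. G j u \<bullet> w j k)"
        by (intro sum.cong) (auto simp: pt_def inner_commute)
      then show ?thesis
        using w_last[OF that] inner_sum_adj[OF u0, of "\<lambda>j. w j k"] by (simp add: inner_commute)
    qed
    ultimately show ?thesis
      unfolding True using ev[of "\<lambda>k. - (\<Sum>j\<in>{1..<n}. pt k j \<bullet> G j u) = w n k \<bullet> u"]
      by (auto elim: Lim_transform_eventually)
  qed
  have "((\<lambda>k. (y i k - w i k) \<bullet> u + w i k \<bullet> u) \<longlongrightarrow> 0 \<bullet> u + complete_dual p i \<bullet> u) F"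
    by (intro tendsto_add tendsto_inner tendsto_const w tendsto_mono[OF F] xy_close[OF i])
  then show "((\<lambda>k. y i k \<bullet> u) \<longlongrightarrow> complete_dual p i \<bullet> u) F"
    by (simp add: inner_diff_left)
qed

text \<open>Both factors converge only weakly, which says nothing about single products. Their sum,
  however, rearranges into \<open>u_vec\<close> paired with \<open>y\<close> plus
  \<open>v_vec\<close> paired with \<open>x n\<close>: strongly vanishing vectors against bounded
  ones.\<close>

lemma sum_inner_xy_tendsto_0: "(\<lambda>k. \<Sum>i\<in>{1..n}. x i k \<bullet> y i k) \<longlonglongrightarrow> 0"
proof -
  have n: "n \<in> {1..n}"
    using n_ge_1 by simp
  have u: "(\<lambda>k. u_vec P R i k \<bullet> y i k) \<longlonglongrightarrow> 0" if i: "i \<in> {1..<n}" for i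
  proof -
    have "i \<in> {1..n}"
      using i by simp
    then obtain C where "\<And>k. k \<ge> M + (M + Dl) \<Longrightarrow> norm (y i k) \<le> C"
      using xy_bounded by metis
    then show ?thesis
      by (intro tendsto_inner_bounded_0[OF u_tendsto_0[OF i]]) (auto simp: eventually_sequentially)
  qed
  obtain C where "\<And>k. k \<ge> M + (M + Dl) \<Longrightarrow> norm (x n k) \<le> C"
    using xy_bounded[OF n] by metis
  then have "(\<lambda>k. v_vec P R k \<bullet> x n k) \<longlonglongrightarrow> 0"
    by (intro tendsto_inner_bounded_0[OF v_tendsto_0]) (auto simp: eventually_sequentially)
  then have "(\<lambda>k. (\<Sum>i\<in>{1..<n}. u_vec P R i k \<bullet> y i k) + v_vec P R k \<bullet> x n k) \<longlonglongrightarrow> (\<Sum>i\<in>{1..<n}. 0) + 0"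
    by (intro tendsto_add tendsto_sum u)
  then have "(\<lambda>k. (\<Sum>i\<in>{1..<n}. u_vec P R i k \<bullet> y i k) + v_vec P R k \<bullet> x n k) \<longlonglongrightarrow> 0"
    by simp
  then show ?thesis
  proof (rule Lim_transform_eventually)
    have "(\<Sum>i\<in>{1..<n}. u_vec P R i k \<bullet> y i k) + v_vec P R k \<bullet> x n k = (\<Sum>i\<in>{1..n}. x i k \<bullet> y i k)"
      if k: "k \<ge> M" for k
    proof -
      have xn: "x n k \<in> H 0"
        using graph(1)[OF k n] H_last by simp
      have "v_vec P R k \<bullet> x n k = (\<Sum>i\<in>{1..<n}. G i (x n k) \<bullet> y i k) + x n k \<bullet> y n k"
        using inner_sum_adj[OF xn, of "\<lambda>i. y i k"]
        by (simp add: v_vec_def inner_add_right inner_commute)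
      then show ?thesis
        unfolding sum_split_last[OF n_ge_1]
        by (simp add: u_vec_def inner_diff_left sum_subtractf)
    qed
    then show "\<forall>\<^sub>F k in sequentially. (\<Sum>i\<in>{1..<n}. u_vec P R i k \<bullet> y i k) + v_vec P R k \<bullet> x n k =
        (\<Sum>i\<in>{1..n}. x i k \<bullet> y i k)"
      unfolding eventually_sequentially by blast
  qed
qed

text \<open>
  Only the sum of the monotonicity inequalities passes to the limit. It suffices, since in each
  component the infimum over the graph is at most \<open>0\<close>, and negative off the graph by maximality.
\<close>

lemma cluster_in_sols:
  assumes F: "F \<le> sequentially" "F \<noteq> bot"
    and pH: "\<And>i. i < n \<Longrightarrow> p i \<in> H i"
    and lim: "\<And>i u. i < n \<Longrightarrow> u \<in> H i \<Longrightarrow> ((\<lambda>k. pt k i \<bullet> u) \<longlongrightarrow> p i \<bullet> u) F"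
  shows "p \<in> sols"
proof -
  let ?b = "complete_dual p"
  have p0: "p 0 \<in> H 0"
    using pH n_ge_1 by simp
  have b: "dual_ok ?b"
    using pH by (rule complete_dual_ok)
  note wl = weak_limits[OF F(1) pH lim]
  have sum_ge: "0 \<le> (\<Sum>i\<in>{1..n}. (G i (p 0) - a i) \<bullet> (?b i - c i))"
    if ac: "\<And>i. i \<in> {1..n} \<Longrightarrow> a i \<in> H i \<and> c i \<in> T i (a i)" for a c
  proof -
    have cH: "c i \<in> H i" if "i \<in> {1..n}" for i
      using ac[OF that] T_subset[OF that] by blast
    \<comment> \<open>The monotonicity products are expanded so that all terms except
      \<open>x i k \<bullet> y i k\<close> are affine in the iterates and have weak limits.\<close>
    have "((\<lambda>k. (\<Sum>i\<in>{1..n}. x i k \<bullet> y i k) + (\<Sum>i\<in>{1..n}. a i \<bullet> c i - x i k \<bullet> c i - y i k \<bullet> a i)) \<longlongrightarrow>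
        0 + (\<Sum>i\<in>{1..n}. a i \<bullet> c i - G i (p 0) \<bullet> c i - ?b i \<bullet> a i)) F"
      using ac cH wl
      by (intro tendsto_add tendsto_sum tendsto_diff tendsto_const
          tendsto_mono[OF F(1) sum_inner_xy_tendsto_0]) auto
    moreover have "\<forall>\<^sub>F k in F. 0 \<le> (\<Sum>i\<in>{1..n}. x i k \<bullet> y i k) +
        (\<Sum>i\<in>{1..n}. a i \<bullet> c i - x i k \<bullet> c i - y i k \<bullet> a i)"
    proof -
      have "0 \<le> (\<Sum>i\<in>{1..n}. x i k \<bullet> y i k) + (\<Sum>i\<in>{1..n}. a i \<bullet> c i - x i k \<bullet> c i - y i k \<bullet> a i)"
        if k: "k \<ge> M" for k
      proof -
        have "0 \<le> (\<Sum>i\<in>{1..n}. (x i k - a i) \<bullet> (y i k - c i))"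
          using ac graph[OF k] T_mono by (intro sum_nonneg) auto
        also have "\<dots> = (\<Sum>i\<in>{1..n}. x i k \<bullet> y i k + (a i \<bullet> c i - x i k \<bullet> c i - y i k \<bullet> a i))"
          by (intro sum.cong refl) (simp add: algebra_simps inner_commute)
        finally show ?thesis
          by (simp add: sum.distrib)
      qed
      then show ?thesis
        by (rule eventually_le_sequentially[OF F(1)])
    qed
    ultimately have "0 \<le> 0 + (\<Sum>i\<in>{1..n}. a i \<bullet> c i - G i (p 0) \<bullet> c i - ?b i \<bullet> a i)"
      using tendsto_lowerbound[OF _ _ F(2)] by blast
    also have "\<dots> = (\<Sum>i\<in>{1..n}. (G i (p 0) - a i) \<bullet> (?b i - c i) - G i (p 0) \<bullet> ?b i)"
      by (simp, intro sum.cong refl) (simp add: algebra_simps inner_commute)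
    finally show ?thesis
      using dual_ok_orthogonal[OF b p0] by (simp add: sum_subtractf)
  qed
  have neg: "\<exists>a\<in>H i. \<exists>c\<in>T i a. (G i (p 0) - a) \<bullet> (?b i - c) < 0"
    if i: "i \<in> {1..n}" and "?b i \<notin> T i (G i (p 0))" for i
    using T_maximal[OF i G_in[OF i p0] dual_ok_mem[OF b i]] that(2) by force
  \<comment> \<open>A component that satisfies its inclusion is tested at that very graph point and
    contributes 0. A single violated inclusion would thus make the whole sum negative.\<close>
  have "\<exists>a c. a \<in> H i \<and> c \<in> T i a \<and> (G i (p 0) - a) \<bullet> (?b i - c) \<le> 0 \<and>
      (?b i \<notin> T i (G i (p 0)) \<longrightarrow> (G i (p 0) - a) \<bullet> (?b i - c) < 0)" if i: "i \<in> {1..n}" for i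
  proof (cases "?b i \<in> T i (G i (p 0))")
    case True
    then show ?thesis
      using G_in[OF i p0] by (intro exI[of _ "G i (p 0)"] exI[of _ "?b i"]) auto
  next
    case False
    then show ?thesis
      using neg[OF i] by (meson less_imp_le)
  qed
  then obtain a c where ac: "\<And>i. i \<in> {1..n} \<Longrightarrow> a i \<in> H i \<and> c i \<in> T i (a i)"
    and le: "\<And>i. i \<in> {1..n} \<Longrightarrow> (G i (p 0) - a i) \<bullet> (?b i - c i) \<le> 0"
    and less: "\<And>i. i \<in> {1..n} \<Longrightarrow> ?b i \<notin> T i (G i (p 0)) \<Longrightarrow> (G i (p 0) - a i) \<bullet> (?b i - c i) < 0"
    by metis
  have "?b i \<in> T i (G i (p 0))" if i: "i \<in> {1..n}" for i
  proof (rule ccontr)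
    assume "?b i \<notin> T i (G i (p 0))"
    then have "(\<Sum>i\<in>{1..n}. (G i (p 0) - a i) \<bullet> (?b i - c i)) < (\<Sum>i\<in>{1..n}. 0)"
      using i less by (intro sum_strict_mono_ex1) (auto intro: le bexI[of _ i])
    then show False
      using sum_ge[of a c] ac by simp
  qed
  then show ?thesis
    unfolding sols_def mem_Collect_eq kuhn_tucker_iff using p0 b
    by (intro conjI exI[of _ ?b]) (auto simp: complete_dual_def)
qed

section \<open>The weak limit as a Kuhn-Tucker point\<close>

lemma weak_convergence:
  obtains zb wb where "(zb, wb) \<in> kuhn_tucker_set P"
    "weakly_converges_prod P (\<lambda>k. (z k, \<lambda>i. w i k)) (zb, wb)"
    "\<And>i. i \<in> {1..<n} \<Longrightarrow> weakly_converges (H i) (x i) (G i zb) \<and> weakly_converges (H i) (y i) (wb i)"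
    "weakly_converges (H n) (x n) zb"
    "weakly_converges (H n) (y n) (- (\<Sum>i\<in>{1..<n}. lin_adj P i (wb i)))"
proof -
  obtain p0 where p0: "p0 \<in> sols"
    using sols_nonempty by blast
  have "\<exists>p\<in>sols. (\<forall>i<n. p i \<in> H i) \<and> (\<forall>i<n. \<forall>u\<in>H i. (\<lambda>k. pt k i \<bullet> u) \<longlonglongrightarrow> p i \<bullet> u)"
  proof (rule opial[of "{..<n}" H wt p0 sols M pt])
    show "(\<Sum>i<n. wt i * (norm (pt (Suc k) i - q i))\<^sup>2) \<le> (\<Sum>i<n. wt i * (norm (pt k i - q i))\<^sup>2)"
      if "q \<in> sols" "k \<ge> M" for q k
      using dst_decreasing[OF that] by (simp add: dst_def)
    show "q \<in> sols" if "F \<le> sequentially" "F \<noteq> bot" "\<And>i. i \<in> {..<n} \<Longrightarrow> q i \<in> H i"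
      "\<And>i u. i \<in> {..<n} \<Longrightarrow> u \<in> H i \<Longrightarrow> ((\<lambda>k. pt k i \<bullet> u) \<longlongrightarrow> q i \<bullet> u) F" for F q
      using that by (intro cluster_in_sols[of F]) auto
    show ?thesis if "p \<in> sols" "\<And>i. i \<in> {..<n} \<Longrightarrow> p i \<in> H i"
      "\<And>i u. i \<in> {..<n} \<Longrightarrow> u \<in> H i \<Longrightarrow> (\<lambda>k. pt k i \<bullet> u) \<longlonglongrightarrow> p i \<bullet> u" for p
      using that by blast
  qed (auto simp: hilbert_H wt_pos p0)
  then obtain p where p: "p \<in> sols" and pH: "\<And>i. i < n \<Longrightarrow> p i \<in> H i"
    and lim: "\<And>i u. i < n \<Longrightarrow> u \<in> H i \<Longrightarrow> (\<lambda>k. pt k i \<bullet> u) \<longlonglongrightarrow> p i \<bullet> u"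
    by blast
  have wl: "(\<lambda>k. x i k \<bullet> u) \<longlonglongrightarrow> G i (p 0) \<bullet> u" "(\<lambda>k. y i k \<bullet> u) \<longlonglongrightarrow> complete_dual p i \<bullet> u"
    if "i \<in> {1..n}" "u \<in> H i" for i u
    using weak_limits[OF order_refl pH lim that] by blast+
  show ?thesis
  proof (rule that[of "p 0" p])
    show "(p 0, p) \<in> kuhn_tucker_set P"
      using p by (simp add: sols_def)
    show "weakly_converges_prod P (\<lambda>k. (z k, \<lambda>i. w i k)) (p 0, p)"
      unfolding weakly_converges_prod_def fst_conv snd_conv
    proof (intro ballI allI impI tendsto_add tendsto_sum)
      show "(\<lambda>k. z k \<bullet> u) \<longlonglongrightarrow> p 0 \<bullet> u" if "u \<in> H 0" for u
        using lim[of 0 u] that n_ge_1 by (simp add: pt_def)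
      show "(\<lambda>k. w i k \<bullet> v i) \<longlonglongrightarrow> p i \<bullet> v i"
        if "\<forall>i\<in>{1..<n}. v i \<in> H i" "i \<in> {1..<n}" for v i
        using lim[of i "v i"] that by (simp add: pt_def)
    qed
    show "weakly_converges (H i) (x i) (G i (p 0)) \<and> weakly_converges (H i) (y i) (p i)"
      if "i \<in> {1..<n}" for i
      using wl[of i] that by (simp add: weakly_converges_def complete_dual_def)
    have n: "n \<in> {1..n}"
      using n_ge_1 by simp
    have "G n (p 0) = p 0"
      using pH[of 0] n_ge_1 by (simp add: G_last)
    then show "weakly_converges (H n) (x n) (p 0)"
      using wl(1)[OF n] by (simp add: weakly_converges_def)
    show "weakly_converges (H n) (y n) (- (\<Sum>i\<in>{1..<n}. lin_adj P i (p i)))"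
      using wl(2)[OF n] by (simp add: weakly_converges_def complete_dual_def)
  qed
qed

end

text \<open>The conjunct that all iterations are reached keeps the second alternative from speaking
  about iterates that the run leaves unconstrained.\<close>

theorem theorem2:
  fixes P :: "'a::real_inner ps_problem" and R :: "'a ps_run"
  assumes "problem_assumptions P"
    and "algorithm_run P R"
    and "block_delay_assumptions P R"
    and "error_assumptions P R"
    and "stepsize_assumptions P R"
  shows "(\<exists>k. returns_at P R k \<and> (zit R (Suc k), \<lambda>i. wit R i (Suc k)) \<in> kuhn_tucker_set P)
    \<or> ((\<forall>k\<ge>1. reached P R k) \<and>
       (\<exists>zb wb. (zb, wb) \<in> kuhn_tucker_set P \<and>
          weakly_converges_prod P (\<lambda>k. (zit R k, \<lambda>i. wit R i k)) (zb, wb) \<and>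
          (\<forall>i\<in>{1..<num P}. weakly_converges (sp P i) (xit R i) (lin P i zb) \<and>
                           weakly_converges (sp P i) (yit R i) (wb i)) \<and>
          weakly_converges (sp P (num P)) (xit R (num P)) zb \<and>
          weakly_converges (sp P (num P)) (yit R (num P))
            (- (\<Sum>i\<in>{1..<num P}. lin_adj P i (wb i)))))"
proof (cases "\<exists>k. returns_at P R k")
  case True
  interpret ps_run_loc P R
    using assms by unfold_locales
  show ?thesis
    using True returns_in_kuhn_tucker by blast
next
  case False
  obtain M where M: "M \<ge> 1" "\<And>j. j \<ge> 1 \<Longrightarrow> (\<Union>k\<in>{j..j + M - 1}. blk R k) = {1..num P}"
    using assms(3) unfolding block_delay_assumptions_def by blast
  obtain D where D: "\<And>k i. k \<ge> 1 \<Longrightarrow> i \<in> blk R k \<Longrightarrow> k - del R i k \<le> D"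
    using assms(3) unfolding block_delay_assumptions_def by blast
  obtain \<sigma> where "\<sigma> < 1" and err: "\<And>i k. i \<in> bwd P \<Longrightarrow> k \<ge> 1 \<Longrightarrow> reached P R k \<Longrightarrow> last_processed R i k \<ge> 1 \<Longrightarrow>
       (let l = last_info R i k; e = err R i (last_processed R i k) in
          (lin P i (zit R l) - xit R i k) \<bullet> e \<ge> - \<sigma> * (norm (lin P i (zit R l) - xit R i k))\<^sup>2 \<and>
          e \<bullet> (yit R i k - wit R i l) \<le> rho R i l * \<sigma> * (norm (yit R i k - wit R i l))\<^sup>2)"
    using assms(4) unfolding error_assumptions_def by blast
  interpret ps_conv_loc P R M D \<sigma>
    using assms M D \<open>\<sigma> < 1\<close> err False by unfold_locales blast+
  obtain zb wb where "(zb, wb) \<in> kuhn_tucker_set P"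
    "weakly_converges_prod P (\<lambda>k. (z k, \<lambda>i. w i k)) (zb, wb)"
    "\<And>i. i \<in> {1..<n} \<Longrightarrow> weakly_converges (H i) (x i) (G i zb) \<and> weakly_converges (H i) (y i) (wb i)"
    "weakly_converges (H n) (x n) zb"
    "weakly_converges (H n) (y n) (- (\<Sum>i\<in>{1..<n}. lin_adj P i (wb i)))"
    by (rule weak_convergence) blast
  then show ?thesis
    using all_reached by (intro disjI2 conjI exI[of _ zb] exI[of _ wb]) blast+
qed

end
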